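(* The following properties hold as $r\to\infty$ for all $i=1,\ldots,S$. The waiting probability has a non-degenerate limit given by \begin{align*} \mathbb P(W^r_i>0)&\to\mathbb P\left(\hat Q_\Sigma(\infty)\ge\beta\right)\\ &=\left(1+\sqrt{\frac\lambda\mu}\,\frac{\phi(\sqrt{\mu/\lambda}\,\gamma)}{\phi(\gamma)}e^{\gamma(\beta-\gamma)}\frac{\Phi(\gamma)}{\Phi(-\sqrt{\mu/\lambda}\,\gamma)}+\sqrt{\frac\lambda\mu}\,\frac{\phi(\sqrt{\mu/\lambda}\,\gamma)}{\gamma}\left(e^{\gamma(\beta-\gamma)}-1\right)\Phi\!\left(-\sqrt{\frac\mu\lambda}\gamma\right)^{-1}\right)^{-1}. \end{align*} The expected waiting time behaves as $$\sqrt r\,\mathbb E(W^r_i)\to\frac{\alpha_3}{\sqrt{\lambda\mu}}\left(\sqrt{\frac\mu\lambda}\,\phi\!\left(\sqrt{\frac\mu\lambda}\gamma\right)\Phi\!\left(-\sqrt{\frac\mu\lambda}\gamma\right)^{-1}-\frac\mu\lambda\gamma\right),$$ where $\alpha_3=r_3/(r_1+r_2+r_3)$ with $r_1,r_2,r_3$ as defined in the context. Finally, the resource utilizations behave as $$\rho_{F^r_i}\to1,\qquad\rho_{B^r_i}\to1.$$ (For $\gamma=0$, expressions with $\gamma$ in the denominator are read as their limits as $\gamma\to0$.)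
   Context: Model. There are $S\ge 2$ battery swapping stations and $r$ electric vehicles (EVs); $\lambda,\mu>0$. For unordered pairs $\{i,j\}$ of distinct stations let $p_{ij}=p_{ji}\ge 0$ with $\sum_{\{i,j\}}p_{ij}=1$, and let $p_i=\frac12\sum_{j}p_{ij}$. Let $E=\{\{i,j\}:p_{ij}>0\}$; standing assumption: the graph $(\{1,\ldots,S\},E)$ is connected. Station $i$ has $B_i^r=p_i\left(\frac{\lambda r}{\mu}+\beta\sqrt{\frac{\lambda r}{\mu}}\right)$ spare batteries and $F_i^r=p_i\left(\frac{\lambda r}{\mu}+\gamma\sqrt{\frac{\lambda r}{\mu}}\right)$ charging points, where $\beta\in\mathbb{R}$, $\gamma\le\beta$ (integrality is ignored). Dynamics. Each EV not waiting at a station needs a new battery after an exponential time of rate $\lambda$; then with probability $p_{ij}$ it chooses between stations $i$ and $j$, and goes to the one with the smaller value of $Q_\cdot^r(t)/p_\cdot$ (ties broken evenly), where its battery is instantaneously swapped for a fully-charged one if available, and otherwise the EV waits there for one. Each charge takes an exponential time of rate $\mu$; all times are independent. $Q_i^r(t)$ is the number of batteries in need of charging (being charged or waiting for a charging point) at station $i$ at time $t$. Thus $Q^r=(Q^r_1,\ldots,Q^r_S)$ is a Markov chain where, with $L^r=r-\sum_j(Q^r_j-B^r_j)^+$ the number of EVs not waiting, $Q_i^r$ increases by one at rate $\lambda L^r\sum_{j}p_{ij}\left(\mathbf 1\{Q^r_i/p_i<Q^r_j/p_j\}+\frac12\mathbf 1\{Q^r_i/p_i=Q^r_j/p_j\}\right)$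 and decreases by one at rate $\mu\min\{Q^r_i,F^r_i\}$. Quantities. $W^r_i$ is the steady-state waiting time (for a fully-charged battery) of an EV arriving at station $i$; an arriving EV has to wait when it finds no fully-charged battery, i.e. at least $B_i^r$ batteries at station $i$ in need of charging. $\rho_{F_i^r}$ is the steady-state fraction of charging points of station $i$ that are busy, and $\rho_{B_i^r}$ is the steady-state fraction of batteries at station $i$ that are not fully charged relative to the total number of batteries present at the station. $\hat Q_\Sigma(\infty)$ is the steady state of the diffusion process with drift $m(x)=-\lambda(x-\beta)^+-\mu\min\{x,\gamma\}$ and constant infinitesimal variance $2\mu$. $\phi,\Phi$ are the standard normal density and distribution function. The constants are $r_1=1$; $r_2=\frac{\phi(\gamma)}{\Phi(\gamma)}\frac1\gamma(1-e^{-\gamma(\beta-\gamma)})$ if $\gamma\ne0$ and $r_2=\sqrt{2/\pi}\,\beta$ if $\gamma=0$; $r_3=\frac{\phi(\gamma)}{\Phi(\gamma)}e^{-\gamma(\beta-\gamma)}\sqrt{\frac\mu\lambda}\,\phi(\sqrt{\mu/\lambda}\,\gamma)^{-1}\Phi(-\sqrt{\mu/\lambda}\,\gamma)$. *)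

theory Defs
  imports "HOL-Probability.Probability"
begin

section \<open>Continuous-time Markov chains given by their transition rates\<close>

text \<open>A chain is given by its off-diagonal rates \<open>q x y\<close>; the values \<open>q x x\<close> are ignored.\<close>

definition exit_rate :: "('a \<Rightarrow> 'a \<Rightarrow> real) \<Rightarrow> 'a \<Rightarrow> real" where
  "exit_rate q x = (\<Sum>\<^sub>\<infinity>y\<in>-{x}. q x y)"

text \<open>Global balance. The chains below have bounded exit rates, so that there is no explosion and
  global balance means invariance under the transition semigroup.\<close>

definition stationary_pmf :: "('a \<Rightarrow> 'a \<Rightarrow> real) \<Rightarrow> 'a pmf \<Rightarrow> bool" where
  "stationary_pmf q \<pi> \<longleftrightarrow>
     (\<forall>y. (\<Sum>\<^sub>\<infinity>x\<in>-{y}. pmf \<pi> x * q x y) = pmf \<pi> y * exit_rate q y)"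

definition jump_pmf :: "('a \<Rightarrow> 'a \<Rightarrow> real) \<Rightarrow> 'a \<Rightarrow> 'a pmf" where
  "jump_pmf q x = embed_pmf (\<lambda>y. if y = x then 0 else q x y / exit_rate q x)"

text \<open>Law of \<open>min T J\<close>, where \<open>T\<close> is the hitting time of \<open>A\<close> from \<open>x\<close> and \<open>J\<close> the time of the
  \<open>n\<close>-th jump: exponential holding times, independent of the jumps.\<close>

primrec hitting_time_upto :: "('a \<Rightarrow> 'a \<Rightarrow> real) \<Rightarrow> 'a set \<Rightarrow> nat \<Rightarrow> 'a \<Rightarrow> real measure" where
  "hitting_time_upto q A 0 x = return borel 0"
| "hitting_time_upto q A (Suc n) x =
     (if x \<in> A then return borel 0
      else do {
        s \<leftarrow> density lborel (exponential_density (exit_rate q x));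
        y \<leftarrow> measure_pmf (jump_pmf q x);
        t \<leftarrow> hitting_time_upto q A n y;
        return borel (s + t)
      })"

text \<open>The variables \<open>min T J\<close> increase to \<open>T\<close> with \<open>n\<close>, so their distribution functions decrease
  to that of \<open>T\<close>.\<close>

definition hitting_time_law :: "('a \<Rightarrow> 'a \<Rightarrow> real) \<Rightarrow> 'a set \<Rightarrow> 'a \<Rightarrow> real measure" where
  "hitting_time_law q A x = interval_measure (\<lambda>t. lim (\<lambda>n. cdf (hitting_time_upto q A n x) t))"

section \<open>Steady state of a one-dimensional diffusion\<close>

text \<open>Infinitesimal invariance: the generator \<open>f \<mapsto> m f' + (v/2) f''\<close> integrates to zero
  against \<open>\<nu>\<close> for every test function \<open>f\<close> of class C2 with compact support.\<close>

definition diffusion_stationary :: "(real \<Rightarrow> real) \<Rightarrow> real \<Rightarrow> real measure \<Rightarrow> bool" where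
  "diffusion_stationary m v \<nu> \<longleftrightarrow>
     prob_space \<nu> \<and> sets \<nu> = sets borel \<and>
     (\<forall>f f' f''. (\<forall>x. (f has_real_derivative f' x) (at x)) \<longrightarrow>
        (\<forall>x. (f' has_real_derivative f'' x) (at x)) \<longrightarrow>
        continuous_on UNIV f'' \<longrightarrow> (\<exists>K. \<forall>x. \<bar>x\<bar> > K \<longrightarrow> f x = 0) \<longrightarrow>
        (\<integral>x. m x * f' x + v / 2 * f'' x \<partial>\<nu>) = 0)"

section \<open>The battery swapping network\<close>

text \<open>Stations are the elements of the type \<open>'s\<close>. Only the values of \<open>p\<close> at two-element sets
  matter: \<open>p {i, j}\<close> is the probability of choosing between \<open>i\<close> and \<open>j\<close>. The parameters \<open>b\<close> and
  \<open>g\<close> are the coefficients \<open>\<beta>\<close> and \<open>\<gamma>\<close> of the square-root terms. A state \<open>x\<close> gives for each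
  station the number of batteries in need of charging; \<open>r\<close> is the number of vehicles.\<close>

locale swapping_network =
  fixes p :: "'s::finite set \<Rightarrow> real" and lam mu b g :: real
  assumes stations: "CARD('s) \<ge> 2"
    and rates: "lam > 0" "mu > 0"
    and p_nonneg: "\<And>i j. i \<noteq> j \<Longrightarrow> p {i, j} \<ge> 0"
    and p_sum: "(\<Sum>e | card e = 2. p e) = 1"
    and connected: "\<And>i j. (i, j) \<in> {(k, l). k \<noteq> l \<and> p {k, l} > 0}\<^sup>*"
    and g_le_b: "g \<le> b"
begin

definition weight :: "'s \<Rightarrow> real" where
  "weight i = (\<Sum>j\<in>-{i}. p {i, j}) / 2"

text \<open>Integrality is ignored: both quantities are real numbers.\<close>

definition spares :: "nat \<Rightarrow> 's \<Rightarrow> real" where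
  "spares r i = weight i * (lam * real r / mu + b * sqrt (lam * real r / mu))"

definition chargers :: "nat \<Rightarrow> 's \<Rightarrow> real" where
  "chargers r i = weight i * (lam * real r / mu + g * sqrt (lam * real r / mu))"

text \<open>The truncation at 0 is only needed because \<open>spares\<close> need not be an integer: otherwise the
  last arrival could turn the number of vehicles that are not waiting negative.\<close>

definition not_waiting :: "nat \<Rightarrow> ('s \<Rightarrow> nat) \<Rightarrow> real" where
  "not_waiting r x = max 0 (real r - (\<Sum>j\<in>UNIV. max 0 (real (x j) - spares r j)))"

definition arrival_rate :: "nat \<Rightarrow> 's \<Rightarrow> ('s \<Rightarrow> nat) \<Rightarrow> real" where
  "arrival_rate r i x = lam * not_waiting r x *
     (\<Sum>j\<in>-{i}. p {i, j} *
        (if real (x i) / weight i < real (x j) / weight j then 1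
         else if real (x i) / weight i = real (x j) / weight j then 1 / 2 else 0))"

definition charge_rate :: "nat \<Rightarrow> 's \<Rightarrow> ('s \<Rightarrow> nat) \<Rightarrow> real" where
  "charge_rate r i x = mu * min (real (x i)) (chargers r i)"

definition trans_rate :: "nat \<Rightarrow> ('s \<Rightarrow> nat) \<Rightarrow> ('s \<Rightarrow> nat) \<Rightarrow> real" where
  "trans_rate r x y =
     (\<Sum>i\<in>UNIV. (if y = x(i := x i + 1) then arrival_rate r i x else 0) +
               (if x i > 0 \<and> y = x(i := x i - 1) then charge_rate r i x else 0))"

definition steady_state :: "nat \<Rightarrow> ('s \<Rightarrow> nat) pmf" where
  "steady_state r = (THE \<pi>. stationary_pmf (trans_rate r) \<pi>)"

text \<open>The state found by a vehicle arriving at station \<open>i\<close> in steady state. The arrival rate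
  depends on the state, so this is \<open>steady_state\<close> weighted with that rate.\<close>

definition found_state :: "nat \<Rightarrow> 's \<Rightarrow> ('s \<Rightarrow> nat) pmf" where
  "found_state r i = embed_pmf (\<lambda>x. pmf (steady_state r) x * arrival_rate r i x /
     measure_pmf.expectation (steady_state r) (arrival_rate r i))"

text \<open>The system followed together with a tagged vehicle at station \<open>i\<close>: in state \<open>(x, m)\<close> the
  tagged vehicle receives a battery at the \<open>m\<close>-th next charge completion at \<open>i\<close>, waiting
  vehicles being served in order of arrival.\<close>

definition tagged_rate :: "nat \<Rightarrow> 's \<Rightarrow> ('s \<Rightarrow> nat) \<times> nat \<Rightarrow> ('s \<Rightarrow> nat) \<times> nat \<Rightarrow> real" where
  "tagged_rate r i = (\<lambda>(x, m) (y, n).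
     if n = (if y i < x i then m - 1 else m) then trans_rate r x y else 0)"

text \<open>The number of completions needed by a vehicle finding state \<open>x\<close> at \<open>i\<close>: none if there is a
  fully charged battery, and otherwise one more than the number of vehicles already waiting.\<close>

definition completions_needed :: "nat \<Rightarrow> 's \<Rightarrow> ('s \<Rightarrow> nat) \<Rightarrow> nat" where
  "completions_needed r i x =
     (if real (x i) \<ge> spares r i then nat \<lfloor>real (x i) - spares r i\<rfloor> + 1 else 0)"

definition waiting_time :: "nat \<Rightarrow> 's \<Rightarrow> real measure" where
  "waiting_time r i = measure_pmf (found_state r i) \<bind>
     (\<lambda>x. hitting_time_law (tagged_rate r i) {(y, m). m = 0}
        (x(i := x i + 1), completions_needed r i x))"

definition charger_utilization :: "nat \<Rightarrow> 's \<Rightarrow> real" where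
  "charger_utilization r i = measure_pmf.expectation (steady_state r)
     (\<lambda>x. min (real (x i)) (chargers r i) / chargers r i)"

text \<open>The batteries present at a station are its spares and those of the vehicles waiting there.\<close>

definition battery_utilization :: "nat \<Rightarrow> 's \<Rightarrow> real" where
  "battery_utilization r i = measure_pmf.expectation (steady_state r)
     (\<lambda>x. real (x i) / (spares r i + max 0 (real (x i) - spares r i)))"

end

section \<open>The limiting quantities\<close>

definition limit_drift :: "real \<Rightarrow> real \<Rightarrow> real \<Rightarrow> real \<Rightarrow> real \<Rightarrow> real" where
  "limit_drift lam mu b g x = - lam * max 0 (x - b) - mu * min x g"

definition limit_steady_state :: "real \<Rightarrow> real \<Rightarrow> real \<Rightarrow> real \<Rightarrow> real measure" where
  "limit_steady_state lam mu b g =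
     (THE \<nu>. diffusion_stationary (limit_drift lam mu b g) (2 * mu) \<nu>)"

abbreviation std_normal_cdf :: "real \<Rightarrow> real" where
  "std_normal_cdf \<equiv> cdf std_normal_distribution"

definition r1 :: real where
  "r1 = 1"

definition r2 :: "real \<Rightarrow> real \<Rightarrow> real" where
  "r2 b g =
     (if g = 0 then sqrt (2 / pi) * b
      else std_normal_density g / std_normal_cdf g * (1 / g) * (1 - exp (- g * (b - g))))"

definition r3 :: "real \<Rightarrow> real \<Rightarrow> real \<Rightarrow> real \<Rightarrow> real" where
  "r3 lam mu b g =
     std_normal_density g / std_normal_cdf g * exp (- g * (b - g)) * sqrt (mu / lam) *
     inverse (std_normal_density (sqrt (mu / lam) * g)) * std_normal_cdf (- sqrt (mu / lam) * g)"

definition alpha3 :: "real \<Rightarrow> real \<Rightarrow> real \<Rightarrow> real \<Rightarrow> real" where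
  "alpha3 lam mu b g = r3 lam mu b g / (r1 + r2 b g + r3 lam mu b g)"

text \<open>The quotient \<open>(exp (g (b - g)) - 1) / g\<close>, read as its limit for \<open>g = 0\<close>.\<close>

definition exp_quotient :: "real \<Rightarrow> real \<Rightarrow> real" where
  "exp_quotient b g = (if g = 0 then b else (exp (g * (b - g)) - 1) / g)"

end

theory Submission imports Defs "HOL-Real_Asymp.Real_Asymp" begin

text \<open>
  Let \<open>n = \<lambda>r/\<mu>\<close> be the offered load, called \<open>offered\<close>, and \<open>s = \<surd>n\<close> its square root,
  called \<open>scale\<close>. The level of a station is its number of batteries in need of charging divided
  by its weight. Choosing the lower of two levels keeps the levels of all stations together, so
  that each of them behaves like the total, and the total, centred by \<open>n\<close> and divided by \<open>s\<close>,
  behaves like the diffusion with the given drift. The estimates rest on one identity: the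
  generator applied to any function has mean zero in steady state.

  Four test functions give the moments. A quadratic penalty above a high level bounds the
  second moment of the overflow, since beyond that level so many vehicles wait that arrivals
  fall below the charging capacity (\<open>mean_overflow_square\<close>). The total itself, for which arrivals
  balance completions, bounds the idle charging capacity (\<open>mean_deficit\<close>). The weighted variance
  of the levels bounds their spread by a constant, which is negligible against \<open>s\<close>
  (\<open>mean_spread\<close>). Finally \<open>F\<close> of the scaled total, with \<open>F\<close> a solution of the Stein equation
  \<open>m F' + \<mu> F'' = h\<close> with drift \<open>m\<close>, shows that \<open>h\<close> has mean tending to zero whenever it has
  mean zero under the diffusion (\<open>mean_scaled_total_centred\<close>); a second-order Taylor expansion
  replaces the generator of the chain by that of the diffusion, and the first three bounds
  control the error. Together with tightness this gives weak convergence
  (\<open>weak_conv_found_law\<close>). The same Stein equation shows that the steady state of the diffusion is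
  unique, with the explicit density \<open>weight_fn\<close> up to normalization (\<open>limit_steady_state_eq\<close>).

  An arriving vehicle sees the steady state weighted with the arrival rate. Applying the
  generator to \<open>\<Sum>k<x\<^sub>i. f k\<close> expresses the mean of \<open>f\<close> over the state found as the mean of
  \<open>f (x\<^sub>i - 1)\<close> weighted with the charging rate (\<open>mean_arrival_rate_shift\<close>), and this rate is
  constant wherever a vehicle has to wait. For the same reason, the mean waiting time given the
  state found is exactly the number of charge completions needed divided by \<open>\<mu> F\<^sub>i\<close>: all charging
  points stay busy while the vehicle waits (\<open>wait_law\<close>). So the waiting probability and the mean waiting time are means
  of functions of the scaled level. Their limits follow from weak convergence, combined for the
  unbounded excess with its second moment. The integrals of the piecewise Gaussian density then
  produce the constants.
\<close>

section \<open>Stationary distributions of Markov chains\<close>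

text \<open>Induction on the number of states: the state \<open>s\<close> is eliminated by watching the chain only
  outside \<open>s\<close>, which adds to each rate the rate of passing through \<open>s\<close>; the balance equation at \<open>s\<close>
  then determines the weight of \<open>s\<close>. A state that leaves itself at rate zero carries the whole
  measure.\<close>

lemma finite_stationary_measure:
  fixes q :: "'a \<Rightarrow> 'a \<Rightarrow> real"
  assumes "finite S" "S \<noteq> {}" "\<And>x y. 0 \<le> q x y"
  shows "\<exists>v. (\<forall>x. 0 \<le> v x) \<and> (\<exists>x\<in>S. 0 < v x) \<and>
    (\<forall>y\<in>S. (\<Sum>x\<in>S-{y}. v x * q x y) = v y * (\<Sum>z\<in>S-{y}. q y z))"
  using assms
proof (induction S arbitrary: q rule: finite_ne_induct)
  case (singleton s)
  show ?case by (intro exI[of _ "\<lambda>_. 1"]) auto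
next
  case (insert s S)
  define e where "e = (\<Sum>y\<in>S. q s y)"
  have e0: "0 \<le> e" unfolding e_def by (intro sum_nonneg insert.prems)
  show ?case
  proof (cases "e = 0")
    case True
    have z: "q s y = 0" if "y \<in> S" for y
      using True that insert.hyps(1) insert.prems unfolding e_def
      by (subst (asm) sum_nonneg_eq_0_iff) auto
    define v where "v = (\<lambda>x. if x = s then 1 else 0 :: real)"
    have "(\<Sum>x\<in>insert s S-{y}. v x * q x y) = v y * (\<Sum>w\<in>insert s S-{y}. q y w)"
      if "y \<in> insert s S" for y
    proof (cases "y = s")
      case True
      have "(\<Sum>w\<in>insert s S-{s}. q s w) = 0"
        by (rule sum.neutral) (use z in auto)
      moreover have "(\<Sum>x\<in>insert s S-{s}. v x * q x s) = 0"
        by (rule sum.neutral) (auto simp: v_def)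
      ultimately show ?thesis using True by simp
    next
      case False
      have "(\<Sum>x\<in>insert s S-{y}. v x * q x y) = 0"
        by (rule sum.neutral) (use z that False in \<open>auto simp: v_def\<close>)
      then show ?thesis using False by (simp add: v_def)
    qed
    moreover have "\<forall>x. 0 \<le> v x" "\<exists>x\<in>insert s S. 0 < v x" by (auto simp: v_def)
    ultimately show ?thesis by blast
  next
    case False
    with e0 have e: "e > 0" by simp
    \<comment> \<open>the rates of the chain watched outside \<open>s\<close>\<close>
    define q' where "q' = (\<lambda>x y. q x y + q x s * q s y / e)"
    have "\<And>x y. 0 \<le> q' x y"
      unfolding q'_def using insert.prems e by (simp add: add_nonneg_nonneg)
    from insert.IH[of q', OF this] obtain v where v0: "\<And>x. 0 \<le> v x" and vp: "\<exists>x\<in>S. 0 < v x"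
      and bal': "\<forall>y\<in>S. (\<Sum>x\<in>S-{y}. v x * q' x y) = v y * (\<Sum>z\<in>S-{y}. q' y z)"
      by (elim exE conjE) auto
    note bal = bal'[rule_format]
    \<comment> \<open>the balance equation at \<open>s\<close>, solved for its weight\<close>
    define c where "c = (\<Sum>x\<in>S. v x * q x s) / e"
    have c0: "0 \<le> c" unfolding c_def using e v0 insert.prems by (simp add: sum_nonneg)
    define v' where "v' = v(s := c)"
    have v'S: "v' x = v x" if "x \<in> S" for x using that insert.hyps(3) by (auto simp: v'_def)
    have "(\<Sum>x\<in>insert s S-{y}. v' x * q x y) = v' y * (\<Sum>w\<in>insert s S-{y}. q y w)"
      if y: "y \<in> insert s S" for y
    proof (cases "y = s")
      case True
      have *: "insert s S - {s} = S" using insert.hyps(3) by auto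
      have "(\<Sum>x\<in>S. v' x * q x s) = (\<Sum>x\<in>S. v x * q x s)"
        by (rule sum.cong) (simp_all add: v'S)
      then show ?thesis using True e by (simp add: * v'_def c_def e_def)
    next
      case False
      with y have yS: "y \<in> S" and ys: "y \<noteq> s" by auto
      have *: "insert s S - {y} = insert s (S - {y})" using ys by auto
      have fin: "finite (S - {y})" and nin: "s \<notin> S - {y}" using insert.hyps by auto
      have split: "(\<Sum>x\<in>S. f x) = f y + (\<Sum>x\<in>S-{y}. f x)" for f :: "'a \<Rightarrow> real"
        using insert.hyps(1) yS by (simp add: sum.remove)
      have b: "(\<Sum>x\<in>S-{y}. v x * q x y) + (\<Sum>x\<in>S-{y}. v x * q x s) * (q s y / e)
          = v y * ((\<Sum>z\<in>S-{y}. q y z) + q y s * (\<Sum>z\<in>S-{y}. q s z) / e)"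
        using bal[OF yS] unfolding q'_def
        by (simp add: sum.distrib sum_distrib_left sum_distrib_right sum_divide_distrib
            distrib_left mult.assoc)
      have ee: "(\<Sum>z\<in>S-{y}. q s z) = e - q s y" unfolding e_def using split[of "q s"] by simp
      have cc: "(\<Sum>x\<in>S-{y}. v x * q x s) = c * e - v y * q y s"
        unfolding c_def using split[of "\<lambda>x. v x * q x s"] e by simp
      have "(\<Sum>x\<in>insert s S-{y}. v' x * q x y) = c * q s y + (\<Sum>x\<in>S-{y}. v x * q x y)"
        using fin nin unfolding * by (simp add: v'_def v'S cong: sum.cong)
          (rule sum.cong, auto simp: v'_def)
      moreover have "v' y * (\<Sum>w\<in>insert s S-{y}. q y w) = v y * (q y s + (\<Sum>z\<in>S-{y}. q y z))"
        using fin nin yS unfolding * by (simp add: v'S)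
      moreover have "e * (c * q s y + (\<Sum>x\<in>S-{y}. v x * q x y)) = e * (v y * (q y s + (\<Sum>z\<in>S-{y}. q y z)))"
        using b e unfolding ee cc by (simp add: field_simps)
      ultimately show ?thesis using e by simp
    qed
    moreover have "\<forall>x. 0 \<le> v' x" using v0 c0 by (simp add: v'_def)
    moreover have "\<exists>x\<in>insert s S. 0 < v' x" using vp v'S by force
    ultimately show ?thesis by blast
  qed
qed

lemma exit_rate_finite:
  assumes "finite S" "\<And>y. y \<notin> S \<Longrightarrow> q x y = 0"
  shows "exit_rate q x = (\<Sum>y\<in>S-{x}. q x y)"
  unfolding exit_rate_def using assms
  by (subst infsum_cong_neutral[of "S - {x}" "-{x}" "q x" "q x"]) auto

lemma stationary_pmf_exists:
  fixes q :: "'a \<Rightarrow> 'a \<Rightarrow> real"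
  assumes S: "finite S" "S \<noteq> {}" and q0: "\<And>x y. 0 \<le> q x y"
    and closed: "\<And>x y. x \<in> S \<Longrightarrow> y \<notin> S \<Longrightarrow> q x y = 0"
  shows "\<exists>\<pi>. stationary_pmf q \<pi> \<and> set_pmf \<pi> \<subseteq> S"
proof -
  obtain v where v0: "\<And>x. 0 \<le> v x" and vp: "\<exists>x\<in>S. 0 < v x"
    and bal: "\<And>y. y \<in> S \<Longrightarrow> (\<Sum>x\<in>S-{y}. v x * q x y) = v y * (\<Sum>z\<in>S-{y}. q y z)"
    using finite_stationary_measure[OF S, of q, OF q0] by (elim exE conjE) auto
  define Z where "Z = (\<Sum>x\<in>S. v x)"
  have Z: "Z > 0" unfolding Z_def using vp v0 S by (metis sum_pos2)
  define w where "w = (\<lambda>x. if x \<in> S then v x / Z else 0)"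
  have w0: "0 \<le> w x" for x using v0 Z by (simp add: w_def)
  have fs: "{x. ennreal (w x) \<noteq> 0} \<subseteq> S" by (auto simp: w_def)
  have "(\<integral>\<^sup>+x. ennreal (w x) \<partial>count_space UNIV) = (\<Sum>x\<in>S. ennreal (w x))"
    by (rule nn_integral_count_space'[OF S(1)]) (auto simp: w_def)
  also have "\<dots> = ennreal (\<Sum>x\<in>S. w x)" using w0 by (simp add: sum_ennreal)
  also have "(\<Sum>x\<in>S. w x) = 1" using Z by (simp add: w_def Z_def flip: sum_divide_distrib)
  finally have "(\<integral>\<^sup>+x. ennreal (w x) \<partial>count_space UNIV) = 1" by simp
  then have pm: "pmf (embed_pmf w) x = w x" for x using w0 by (simp add: pmf_embed_pmf)
  have "(\<Sum>\<^sub>\<infinity>x\<in>-{y}. w x * q x y) = w y * exit_rate q y" for y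
  proof -
    have "(\<Sum>\<^sub>\<infinity>x\<in>-{y}. w x * q x y) = (\<Sum>x\<in>S-{y}. w x * q x y)"
      using S by (subst infsum_cong_neutral[of "S - {y}" "-{y}" _ "\<lambda>x. w x * q x y"]) (auto simp: w_def)
    also have "\<dots> = w y * exit_rate q y"
    proof (cases "y \<in> S")
      case True
      have "(\<Sum>x\<in>S-{y}. w x * q x y) = (\<Sum>x\<in>S-{y}. v x * q x y) / Z"
        by (simp add: w_def sum_divide_distrib)
      then show ?thesis using True using bal[OF True] exit_rate_finite[OF S(1), of q y, OF closed[OF True]]
        by (simp add: w_def)
    next
      case False
      have "(\<Sum>x\<in>S-{y}. w x * q x y) = 0"
        by (rule sum.neutral) (use False closed in auto)
      then show ?thesis using False by (simp add: w_def)
    qed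
    finally show ?thesis .
  qed
  then have "stationary_pmf q (embed_pmf w)" by (simp add: stationary_pmf_def pm)
  moreover have "set_pmf (embed_pmf w) \<subseteq> S"
    unfolding set_pmf_eq pm by (auto simp: w_def)
  ultimately show ?thesis by blast
qed

text \<open>Global balance tested against \<open>f\<close>. The finite closed set \<open>S\<close> makes every function integrable.\<close>

lemma stationary_expectation_generator:
  fixes q :: "'a \<Rightarrow> 'a \<Rightarrow> real" and f :: "'a \<Rightarrow> real"
  assumes st: "stationary_pmf q \<pi>" and S: "finite S" "set_pmf \<pi> \<subseteq> S"
    and closed: "\<And>x y. x \<in> S \<Longrightarrow> y \<notin> S \<Longrightarrow> q x y = 0"
  shows "measure_pmf.expectation \<pi> (\<lambda>x. \<Sum>y\<in>S. q x y * (f y - f x)) = 0"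
proof -
  have out: "pmf \<pi> x = 0" if "x \<notin> S" for x using that S(2) by (auto simp: set_pmf_iff)
  have bal: "(\<Sum>x\<in>S-{y}. pmf \<pi> x * q x y) = pmf \<pi> y * (\<Sum>z\<in>S-{y}. q y z)" if "y \<in> S" for y
  proof -
    have "(\<Sum>\<^sub>\<infinity>x\<in>-{y}. pmf \<pi> x * q x y) = (\<Sum>x\<in>S-{y}. pmf \<pi> x * q x y)"
      using S out
      by (subst infsum_cong_neutral[of "S - {y}" "-{y}" _ "\<lambda>x. pmf \<pi> x * q x y"]) auto
    then show ?thesis using st exit_rate_finite[OF S(1), of q y, OF closed[OF that]]
      by (simp add: stationary_pmf_def)
  qed
  have bal': "(\<Sum>x\<in>S. pmf \<pi> x * q x y) = pmf \<pi> y * (\<Sum>z\<in>S. q y z)" if "y \<in> S" for y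
    using bal[OF that] S(1) that by (simp add: sum.remove distrib_left)
  have "measure_pmf.expectation \<pi> (\<lambda>x. \<Sum>y\<in>S. q x y * (f y - f x))
      = (\<Sum>x\<in>S. pmf \<pi> x * (\<Sum>y\<in>S. q x y * (f y - f x)))"
    using S by (subst integral_measure_pmf[of S]) auto
  also have "\<dots> = (\<Sum>x\<in>S. \<Sum>y\<in>S. pmf \<pi> x * q x y * f y) - (\<Sum>x\<in>S. \<Sum>y\<in>S. pmf \<pi> x * q x y * f x)"
    by (simp add: sum_distrib_left sum_subtractf[symmetric] algebra_simps)
  also have "(\<Sum>x\<in>S. \<Sum>y\<in>S. pmf \<pi> x * q x y * f y) = (\<Sum>y\<in>S. (\<Sum>x\<in>S. pmf \<pi> x * q x y) * f y)"
    by (subst sum.swap) (simp add: sum_distrib_right)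
  also have "\<dots> = (\<Sum>y\<in>S. (pmf \<pi> y * (\<Sum>z\<in>S. q y z)) * f y)"
    by (intro sum.cong refl) (simp add: bal')
  also have "\<dots> = (\<Sum>x\<in>S. \<Sum>y\<in>S. pmf \<pi> x * q x y * f x)"
    by (simp add: sum_distrib_right sum_distrib_left)
  finally show ?thesis by simp
qed

lemma infsum_pmf: "pmf \<pi> summable_on A" "infsum (pmf \<pi>) UNIV = 1"
proof -
  have a: "Infinite_Sum.abs_summable_on (pmf \<pi>) A" for A
    using abs_summable_equivalent pmf_abs_summable by blast
  show "pmf \<pi> summable_on A" by (rule abs_summable_summable[OF a])
  show "infsum (pmf \<pi>) UNIV = 1"
    using infsetsum_infsum[OF pmf_abs_summable[of \<pi> UNIV]] infsetsum_pmf_eq_1[of \<pi> UNIV] by simp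
qed

lemma real_summable_infsum_diff:
  fixes f h :: "'a \<Rightarrow> real"
  assumes "f summable_on A" "h summable_on A"
  shows "(\<lambda>x. f x - h x) summable_on A"
    and "(\<Sum>\<^sub>\<infinity>x\<in>A. f x - h x) = infsum f A - infsum h A"
proof -
  have "((\<lambda>x. f x - h x) has_sum (infsum f A - infsum h A)) A"
    using has_sum_add[OF has_sum_infsum[OF assms(1)] has_sum_uminusI[OF has_sum_infsum[OF assms(2)]]]
    by simp
  then show "(\<lambda>x. f x - h x) summable_on A"
    "(\<Sum>\<^sub>\<infinity>x\<in>A. f x - h x) = infsum f A - infsum h A"
    by (auto simp: has_sum_iff)
qed

text \<open>For the difference \<open>\<delta>\<close> of two solutions the triangle inequality makes \<open>|\<delta>|\<close> a subsolution
  of the balance equations; summing over all states shows that equality holds. Hence \<open>|\<delta>| + \<delta>\<close> and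
  \<open>|\<delta>| - \<delta>\<close> are nonnegative solutions, and each of them, unless it vanishes, is positive at the
  common state \<open>z\<close>. They cannot both be positive there. The sums run over infinitely many states,
  since uniqueness is needed among all distributions, and the bound on the exit rates makes them
  converge.\<close>

lemma stationary_pmf_unique:
  fixes q :: "'a \<Rightarrow> 'a \<Rightarrow> real"
  assumes st: "stationary_pmf q \<pi>" "stationary_pmf q \<pi>'"
    and q0: "\<And>x y. 0 \<le> q x y"
    and fin: "\<And>x. finite {y. q x y \<noteq> 0}"
    and bound: "\<And>x. exit_rate q x \<le> R"
    and reach: "\<And>x. (x, z) \<in> {(x, y). x \<noteq> y \<and> 0 < q x y}\<^sup>*"
  shows "\<pi> = \<pi>'"
proof -
  define q1 where "q1 = (\<lambda>x y. if x = y then 0 else q x y)"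
  define e where "e = exit_rate q"
  have q10: "0 \<le> q1 x y" for x y using q0 by (simp add: q1_def)
  have e_sum: "((\<lambda>y. q1 x y) has_sum e x) UNIV" for x
  proof -
    have "(q1 x has_sum (\<Sum>y\<in>{y. q x y \<noteq> 0}-{x}. q x y)) UNIV"
    proof (rule has_sum_finite_neutralI[OF finite_Diff[OF fin]])
      show "(\<Sum>y\<in>{y. q x y \<noteq> 0}-{x}. q x y) = (\<Sum>y\<in>{y. q x y \<noteq> 0}-{x}. q1 x y)"
        by (rule sum.cong) (auto simp: q1_def)
    qed (auto simp: q1_def)
    moreover have "e x = (\<Sum>y\<in>{y. q x y \<noteq> 0}-{x}. q x y)"
      unfolding e_def by (rule exit_rate_finite) (use fin in auto)
    ultimately show ?thesis by simp
  qed
  have e0: "0 \<le> e x" for x using e_sum[of x] q10 has_sum_nonneg by blast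
  have qe: "q1 x y \<le> e x" for x y
    using has_sum_mono2[OF has_sum_finite[of "{y}" "q1 x"] e_sum[of x]] q10 by simp
  have qR: "q1 x y \<le> R" for x y using qe[of x y] bound[of x] by (simp add: e_def)
  have R0: "0 \<le> R" using q10 qR order_trans by blast
  have summ: "(\<lambda>x. w x * q1 x y) summable_on UNIV" if "w summable_on UNIV" "\<And>x. 0 \<le> w x" for w y
    by (rule summable_on_comparison_test[OF summable_on_cmult_left[OF that(1), of R]])
       (use that q10 qR in \<open>auto intro!: mult_left_mono\<close>)
  have bal: "(\<Sum>\<^sub>\<infinity>x\<in>UNIV. pmf \<pi> x * q1 x y) = pmf \<pi> y * e y" if "stationary_pmf q \<pi>" for \<pi> y
  proof -
    have "(\<Sum>\<^sub>\<infinity>x\<in>UNIV. pmf \<pi> x * q1 x y) = (\<Sum>\<^sub>\<infinity>x\<in>-{y}. pmf \<pi> x * q x y)"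
      by (rule infsum_cong_neutral) (auto simp: q1_def)
    then show ?thesis using that by (simp add: stationary_pmf_def e_def)
  qed
  define \<delta> where "\<delta> x = pmf \<pi> x - pmf \<pi>' x" for x
  define d where "d x = \<bar>\<delta> x\<bar>" for x
  have d0: "0 \<le> d x" for x by (simp add: d_def)
  have sd: "d summable_on UNIV"
    by (rule summable_on_comparison_test[OF summable_on_add[OF infsum_pmf(1)[of \<pi>] infsum_pmf(1)[of \<pi>']]])
       (auto simp: d_def \<delta>_def abs_le_iff add_increasing add_increasing2)
  have sdq: "(\<lambda>x. d x * q1 x y) summable_on UNIV" for y by (rule summ[OF sd d0])
  have bal\<delta>: "((\<lambda>x. \<delta> x * q1 x y) has_sum (\<delta> y * e y)) UNIV" for y
  proof -
    have "((\<lambda>x. pmf \<pi> x * q1 x y) has_sum (pmf \<pi> y * e y)) UNIV"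
      "((\<lambda>x. pmf \<pi>' x * q1 x y) has_sum (pmf \<pi>' y * e y)) UNIV"
      using bal st summ[OF infsum_pmf(1)] by (auto simp: has_sum_iff)
    from has_sum_add[OF this(1) has_sum_uminusI[OF this(2)]] show ?thesis by (simp add: \<delta>_def left_diff_distrib)
  qed
  define I where "I y = (\<Sum>\<^sub>\<infinity>x\<in>UNIV. d x * q1 x y)" for y
  have hI: "((\<lambda>x. d x * q1 x y) has_sum I y) UNIV" for y
    using sdq by (simp add: I_def)
  have ge: "d y * e y \<le> I y" for y
  proof -
    have "norm (\<delta> y * e y) \<le> I y"
    proof (rule norm_has_sum_bound[OF _ bal\<delta>])
      have "(\<lambda>x. norm (\<delta> x * q1 x y)) = (\<lambda>x. d x * q1 x y)"
        using q10 by (simp add: d_def abs_mult)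
      then show "((\<lambda>x. norm (\<delta> x * q1 x y)) has_sum I y) UNIV" using hI by simp
    qed
    then show ?thesis using e0 by (simp add: d_def abs_mult)
  qed
  have sde: "(\<lambda>x. d x * e x) summable_on UNIV"
    by (rule summable_on_comparison_test[OF summable_on_cmult_left[OF sd, of R]])
       (use d0 e0 bound in \<open>auto intro!: mult_left_mono simp: e_def\<close>)
  have prod: "(\<lambda>(x,y). d x * q1 x y) summable_on UNIV \<times> UNIV"
    by (rule summable_on_SigmaI[where g = "\<lambda>x. d x * e x"])
       (use sde d0 q10 e_sum in \<open>auto intro!: has_sum_cmult_right\<close>)
  have "(\<Sum>\<^sub>\<infinity>x\<in>UNIV. d x * e x) = (\<Sum>\<^sub>\<infinity>x\<in>UNIV. \<Sum>\<^sub>\<infinity>y\<in>UNIV. d x * q1 x y)"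
    using e_sum by (intro infsum_cong) (simp add: infsum_cmult_right' infsumI[OF e_sum])
  also have "\<dots> = (\<Sum>\<^sub>\<infinity>y\<in>UNIV. I y)"
    unfolding I_def by (rule infsum_swap_banach[OF prod])
  finally have eqs: "(\<Sum>\<^sub>\<infinity>x\<in>UNIV. d x * e x) = (\<Sum>\<^sub>\<infinity>y\<in>UNIV. I y)" .
  have sI: "I summable_on UNIV"
  proof -
    have "(\<lambda>(y,x). d x * q1 x y) summable_on UNIV \<times> UNIV"
      using summable_on_swap[of "\<lambda>(x,y). d x * q1 x y" UNIV UNIV] prod by (simp add: case_prod_unfold)
    from summable_on_Sigma_banach[OF this] show ?thesis unfolding I_def by simp
  qed
  \<comment> \<open>both sides of \<open>ge\<close> have the same finite sum\<close>
  have Ieq: "I y = d y * e y" for y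
  proof -
    have "(\<Sum>\<^sub>\<infinity>y\<in>UNIV. I y - d y * e y) \<le> 0"
      using real_summable_infsum_diff(2)[OF sI sde] eqs by simp
    from nonneg_infsum_le_0D[OF this real_summable_infsum_diff(1)[OF sI sde]] ge show ?thesis by simp
  qed
  have spread: "0 < w z" if w: "w = (\<lambda>x. d x + \<delta> x) \<or> w = (\<lambda>x. d x - \<delta> x)" and wx: "0 < w x" for w x
  proof -
    have w0: "0 \<le> w x" for x using w by (auto simp: d_def)
    have wb: "((\<lambda>x. w x * q1 x y) has_sum (w y * e y)) UNIV" for y
      using w has_sum_add[OF hI bal\<delta>, of y] has_sum_add[OF hI has_sum_uminusI[OF bal\<delta>], of y]
      by (auto simp: Ieq ring_distribs)
    have step: "0 < w y" if "x \<noteq> y" "0 < q x y" "0 < w x" for x y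
    proof -
      have "w x * q1 x y \<le> w y * e y"
        using has_sum_mono2[OF has_sum_finite[of "{x}" "\<lambda>x. w x * q1 x y"] wb[of y]] q10 w0 by simp
      moreover have "0 < w x * q1 x y" using that by (simp add: q1_def)
      ultimately show ?thesis using w0[of y] by (cases "w y = 0") auto
    qed
    from reach[of x] show ?thesis
      by (induction rule: rtrancl_induct) (use wx step in auto)
  qed
  have "(\<forall>x. \<delta> x \<le> 0) \<or> (\<forall>x. 0 \<le> \<delta> x)"
  proof (rule ccontr)
    assume "\<not> ?thesis"
    then obtain x y where "0 < \<delta> x" "\<delta> y < 0" by (auto simp: not_le)
    then have "0 < d x + \<delta> x" "0 < d y - \<delta> y" by (auto simp: d_def)
    then have "0 < d z + \<delta> z" "0 < d z - \<delta> z" using spread by blast+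
    then show False by (auto simp: d_def)
  qed
  moreover have "pmf \<pi>1 = pmf \<pi>2" if le: "\<And>x. pmf \<pi>1 x \<le> pmf \<pi>2 x" for \<pi>1 \<pi>2 :: "'a pmf"
  proof
    fix x
    have "(\<Sum>\<^sub>\<infinity>x\<in>UNIV. pmf \<pi>2 x - pmf \<pi>1 x) \<le> 0"
      using real_summable_infsum_diff(2)[OF infsum_pmf(1)[of \<pi>2 UNIV] infsum_pmf(1)[of \<pi>1 UNIV]] infsum_pmf(2)[of \<pi>1] infsum_pmf(2)[of \<pi>2] by simp
    from nonneg_infsum_le_0D[OF this real_summable_infsum_diff(1)[OF infsum_pmf(1) infsum_pmf(1)]] le
    show "pmf \<pi>1 x = pmf \<pi>2 x" by (auto simp: le_diff_eq)
  qed
  ultimately have "pmf \<pi> = pmf \<pi>'" unfolding \<delta>_def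
    by (metis diff_le_0_iff_le diff_ge_0_iff_ge)
  then show ?thesis by (simp add: pmf_eq_iff)
qed

section \<open>Hitting times\<close>

declare hitting_time_upto.simps(2) [simp del]

lemma exponential_subprob: "subprob_space (density lborel (exponential_density l))"
proof (cases "0 < l")
  case True
  then show ?thesis
    by (intro prob_space_imp_subprob_space prob_space_exponential_density)
next
  case False
  then have "(\<lambda>x. ennreal (exponential_density l x)) = (\<lambda>x. 0)"
    by (auto simp: exponential_density_def fun_eq_iff not_less ennreal_neg mult_nonpos_nonneg)
  then have "density lborel (exponential_density l) = null_measure (lborel :: real measure)"
    by (simp add: null_measure_eq_density)
  then show ?thesis by (simp add: subprob_space_null_measure)
qed

lemma hitting_time_upto_kernel [measurable]:
  "hitting_time_upto q A n \<in> count_space UNIV \<rightarrow>\<^sub>M subprob_algebra borel"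
proof (induction n)
  case 0
  then show ?case
    by (auto simp: space_subprob_algebra intro!: subprob_space_return)
next
  case (Suc n)
  note Suc [measurable]
  have E: "density lborel (exponential_density l) \<in> space (subprob_algebra borel)" for l
    using exponential_subprob by (simp add: space_subprob_algebra)
  have "(density lborel (exponential_density l) \<bind>
        (\<lambda>s. measure_pmf J \<bind> (\<lambda>y. hitting_time_upto q A n y \<bind> (\<lambda>t. return borel (s + t)))))
      \<in> space (subprob_algebra borel)" for l :: real and J
  proof -
    have "(\<lambda>_::unit. density lborel (exponential_density l) \<bind>
        (\<lambda>s. measure_pmf J \<bind> (\<lambda>y. hitting_time_upto q A n y \<bind> (\<lambda>t. return borel (s + t)))))
      \<in> count_space UNIV \<rightarrow>\<^sub>M subprob_algebra borel"
      using E[of l] by measurable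
    from measurable_space[OF this, of "()"] show ?thesis by simp
  qed
  moreover have "return borel (0::real) \<in> space (subprob_algebra borel)"
    by (simp add: space_subprob_algebra subprob_space_return)
  ultimately have "hitting_time_upto q A (Suc n) x \<in> space (subprob_algebra borel)" for x
    by (cases "x \<in> A") (simp_all add: hitting_time_upto.simps(2))
  then show ?case by (intro measurable_count_space_eq1[THEN iffD2]) auto
qed

lemma hitting_time_upto_subprob: "subprob_space (hitting_time_upto q A n x)"
  and sets_hitting_time_upto [simp, measurable_cong]: "sets (hitting_time_upto q A n x) = sets borel"
  using measurable_space[OF hitting_time_upto_kernel[of q A n], of x]
  by (auto simp: space_subprob_algebra)

lemma space_hitting_time_upto [simp]: "space (hitting_time_upto q A n x) = UNIV"
  using sets_eq_imp_space_eq[OF sets_hitting_time_upto] by simp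

lemma nn_integral_hitting_time_upto_Suc:
  assumes [measurable]: "f \<in> borel_measurable borel"
  shows "(\<integral>\<^sup>+t. f t \<partial>hitting_time_upto q A (Suc n) x) =
    (if x \<in> A then f 0 else
      (\<integral>\<^sup>+s. (\<integral>\<^sup>+y. (\<integral>\<^sup>+t. f (s + t) \<partial>hitting_time_upto q A n y) \<partial>measure_pmf (jump_pmf q x))
        \<partial>density lborel (exponential_density (exit_rate q x))))"
proof (cases "x \<in> A")
  case True
  then show ?thesis by (simp add: hitting_time_upto.simps(2) nn_integral_return)
next
  case False
  have m3: "(\<lambda>t. return borel (s + t)) \<in> hitting_time_upto q A n y \<rightarrow>\<^sub>M subprob_algebra borel" for s y
    by measurable
  have m2: "(\<lambda>y. hitting_time_upto q A n y \<bind> (\<lambda>t. return borel (s + t))) \<in> measure_pmf (jump_pmf q x) \<rightarrow>\<^sub>M subprob_algebra borel"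
    for s by measurable
  have m1: "(\<lambda>s. measure_pmf (jump_pmf q x) \<bind> (\<lambda>y. hitting_time_upto q A n y \<bind> (\<lambda>t. return borel (s + t))))
    \<in> density lborel (exponential_density (exit_rate q x)) \<rightarrow>\<^sub>M subprob_algebra borel"
    by measurable
  show ?thesis using False
    by (simp add: hitting_time_upto.simps(2) nn_integral_bind[OF assms m1] nn_integral_bind[OF assms m2]
        nn_integral_bind[OF assms m3] nn_integral_return)
qed

lemma AE_exponential_nonneg: "AE s in density lborel (exponential_density l). 0 \<le> (s::real)"
  by (subst AE_density) (auto simp: exponential_density_def)

lemma AE_hitting_time_upto_nonneg: "AE t in hitting_time_upto q A n x. 0 \<le> t"
proof -
  have "(\<integral>\<^sup>+t. indicator {..<0} t \<partial>hitting_time_upto q A n x) = 0"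
  proof (induction n arbitrary: x)
    case 0
    then show ?case by (simp add: nn_integral_return)
  next
    case (Suc n)
    have "(\<integral>\<^sup>+t. indicator {..<0} (s + t) \<partial>hitting_time_upto q A n y) = 0" if "0 \<le> s" for s y
    proof -
      have "(\<integral>\<^sup>+t. indicator {..<0} (s + t) \<partial>hitting_time_upto q A n y)
          \<le> (\<integral>\<^sup>+t. indicator {..<0} t \<partial>hitting_time_upto q A n y)"
        using that by (intro nn_integral_mono) (auto split: split_indicator)
      then show ?thesis using Suc by simp
    qed
    note z = this
    have "AE s in density lborel (exponential_density (exit_rate q x)).
        (\<integral>\<^sup>+y. (\<integral>\<^sup>+t. indicator {..<0} (s + t) \<partial>hitting_time_upto q A n y) \<partial>measure_pmf (jump_pmf q x)) = 0"
      by (rule AE_mp[OF AE_exponential_nonneg[of "exit_rate q x"]], intro AE_I2) (simp add: z)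
    then have "(\<integral>\<^sup>+s. (\<integral>\<^sup>+y. (\<integral>\<^sup>+t. indicator {..<0} (s + t) \<partial>hitting_time_upto q A n y) \<partial>measure_pmf (jump_pmf q x))
        \<partial>density lborel (exponential_density (exit_rate q x))) = (\<integral>\<^sup>+s. 0 \<partial>density lborel (exponential_density (exit_rate q x)))"
      by (rule nn_integral_cong_AE)
    then show ?case
      by (simp del: nn_integral_indicator add: nn_integral_hitting_time_upto_Suc)
  qed
  then show ?thesis
    by (subst (asm) nn_integral_indicator) (auto intro!: AE_I[of _ _ "{..<0}"])
qed

text \<open>One more jump can only lengthen the time. This monotonicity makes the limit in the definition
  of the hitting time law exist.\<close>

lemma emeasure_hitting_time_upto_Suc_le:
  "emeasure (hitting_time_upto q A (Suc n) x) {..c} \<le> emeasure (hitting_time_upto q A n x) {..c}"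
proof (induction n arbitrary: x c)
  case 0
  interpret subprob_space "hitting_time_upto q A (Suc 0) x" by (rule hitting_time_upto_subprob)
  show ?case
  proof (cases "0 \<le> c")
    case True
    then show ?thesis using subprob_emeasure_le_1[of "{..c}"] by (simp)
  next
    case False
    have "emeasure (hitting_time_upto q A (Suc 0) x) {..c} = 0"
    proof -
      have "AE t in hitting_time_upto q A (Suc 0) x. \<not> t \<le> c"
        by (rule AE_mp[OF AE_hitting_time_upto_nonneg], intro AE_I2) (use False in auto)
      from emeasure_eq_0_AE[OF this] show ?thesis by (simp add: atMost_def)
    qed
    then show ?thesis by simp
  qed
next
  case (Suc n)
  have c: "(\<integral>\<^sup>+t. indicator {..c} (s + t) \<partial>hitting_time_upto q A n y) = emeasure (hitting_time_upto q A n y) {..c - s}"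
    for s n y
  proof -
    have "(\<integral>\<^sup>+t. indicator {..c} (s + t) \<partial>hitting_time_upto q A n y)
        = (\<integral>\<^sup>+t. indicator {..c - s} t \<partial>hitting_time_upto q A n y)"
      by (intro nn_integral_cong) (auto split: split_indicator)
    then show ?thesis by simp
  qed
  have e: "emeasure (hitting_time_upto q A (Suc n) x) {..c} = (if x \<in> A then indicator {..c} (0::real) else
      (\<integral>\<^sup>+s. (\<integral>\<^sup>+y. emeasure (hitting_time_upto q A n y) {..c - s} \<partial>measure_pmf (jump_pmf q x))
        \<partial>density lborel (exponential_density (exit_rate q x))))" for n
    using nn_integral_hitting_time_upto_Suc[of "indicator {..c}" q A n x]
    by (simp add: c)
  show ?case unfolding e[of n] e[of "Suc n"]
    using Suc by (auto intro!: nn_integral_mono)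
qed

lemma hitting_time_upto_prob:
  assumes closed: "\<And>x y. x \<in> I \<Longrightarrow> x \<notin> A \<Longrightarrow> y \<in> set_pmf (jump_pmf q x) \<Longrightarrow> y \<in> I"
    and pos: "\<And>x. x \<in> I \<Longrightarrow> x \<notin> A \<Longrightarrow> 0 < exit_rate q x"
    and x: "x \<in> I"
  shows "prob_space (hitting_time_upto q A n x)"
proof
  have "(\<integral>\<^sup>+t. 1 \<partial>hitting_time_upto q A n x) = 1" using x
  proof (induction n arbitrary: x)
    case 0
    then show ?case by simp
  next
    case (Suc n)
    show ?case
    proof (cases "x \<in> A")
      case True
      then show ?thesis by (simp add: hitting_time_upto.simps(2))
    next
      case False
      interpret E: prob_space "density lborel (exponential_density (exit_rate q x))"
        by (rule prob_space_exponential_density[OF pos[OF Suc.prems False]])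
      have "(\<integral>\<^sup>+y. (\<integral>\<^sup>+t. 1 \<partial>hitting_time_upto q A n y) \<partial>measure_pmf (jump_pmf q x))
          = (\<integral>\<^sup>+y. 1 \<partial>measure_pmf (jump_pmf q x))"
        using Suc.IH closed[OF Suc.prems False]
        by (intro nn_integral_cong_AE) (simp add: AE_measure_pmf_iff)
      then show ?thesis using False E.emeasure_space_1
        by (simp add: nn_integral_hitting_time_upto_Suc del: nn_integral_const)
          (simp add: E.emeasure_space_1)
    qed
  qed
  then show "emeasure (hitting_time_upto q A n x) (space (hitting_time_upto q A n x)) = 1"
    by simp
qed

lemma nn_integral_exponential:
  assumes "0 < l"
  shows "(\<integral>\<^sup>+s. ennreal s \<partial>density lborel (exponential_density l)) = ennreal (1 / l)"
proof -
  interpret prob_space "density lborel (exponential_density l)"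
    by (rule prob_space_exponential_density[OF assms])
  have D: "distributed (density lborel (exponential_density l)) lborel (\<lambda>x. x) (exponential_density l)"
    unfolding distributed_def by (auto simp: distr_id2 intro!: measurable_ident_sets)
  have "(\<integral>\<^sup>+s. ennreal s \<partial>density lborel (exponential_density l))
      = ennreal (expectation (\<lambda>s. s))"
    by (rule nn_integral_eq_integral)
      (use AE_exponential_nonneg erlang_ith_moment_integrable[OF assms D, of 1] in auto)
  then show ?thesis using exponential_distributed_expectation[OF assms D] by simp
qed

lemma nn_integral_hitting_time_upto_mean:
  assumes closed: "\<And>x y. x \<in> I \<Longrightarrow> x \<notin> A \<Longrightarrow> y \<in> set_pmf (jump_pmf q x) \<Longrightarrow> y \<in> I"
    and pos: "\<And>x. x \<in> I \<Longrightarrow> x \<notin> A \<Longrightarrow> 0 < exit_rate q x"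
    and x: "x \<in> I" "x \<notin> A"
  shows "(\<integral>\<^sup>+t. ennreal t \<partial>hitting_time_upto q A (Suc n) x) = ennreal (1 / exit_rate q x) +
    (\<integral>\<^sup>+y. (\<integral>\<^sup>+t. ennreal t \<partial>hitting_time_upto q A n y) \<partial>measure_pmf (jump_pmf q x))"
proof -
  interpret E: prob_space "density lborel (exponential_density (exit_rate q x))"
    by (rule prob_space_exponential_density[OF pos[OF x]])
  have split: "(\<integral>\<^sup>+t. ennreal (s + t) \<partial>hitting_time_upto q A n y)
      = ennreal s + (\<integral>\<^sup>+t. ennreal t \<partial>hitting_time_upto q A n y)" if "0 \<le> s" "y \<in> I" for s y
  proof -
    interpret P: prob_space "hitting_time_upto q A n y"
      using hitting_time_upto_prob[where A = A, OF closed pos that(2)] .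
    have "(\<integral>\<^sup>+t. ennreal (s + t) \<partial>hitting_time_upto q A n y)
        = (\<integral>\<^sup>+t. ennreal s + ennreal t \<partial>hitting_time_upto q A n y)"
      by (rule nn_integral_cong_AE, rule AE_mp[OF AE_hitting_time_upto_nonneg], intro AE_I2)
        (use that in \<open>simp add: ennreal_plus\<close>)
    also have "\<dots> = ennreal s + (\<integral>\<^sup>+t. ennreal t \<partial>hitting_time_upto q A n y)"
      using P.emeasure_space_1 by (subst nn_integral_add) auto
    finally show ?thesis .
  qed
  let ?m = "\<integral>\<^sup>+y. (\<integral>\<^sup>+t. ennreal t \<partial>hitting_time_upto q A n y) \<partial>measure_pmf (jump_pmf q x)"
  have split2: "(\<integral>\<^sup>+y. (\<integral>\<^sup>+t. ennreal (s + t) \<partial>hitting_time_upto q A n y) \<partial>measure_pmf (jump_pmf q x))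
      = ennreal s + ?m" if "0 \<le> s" for s
  proof -
    have "(\<integral>\<^sup>+y. (\<integral>\<^sup>+t. ennreal (s + t) \<partial>hitting_time_upto q A n y) \<partial>measure_pmf (jump_pmf q x))
        = (\<integral>\<^sup>+y. ennreal s + (\<integral>\<^sup>+t. ennreal t \<partial>hitting_time_upto q A n y) \<partial>measure_pmf (jump_pmf q x))"
      using closed[OF x] by (intro nn_integral_cong_AE) (simp add: AE_measure_pmf_iff split that)
    then show ?thesis by (simp add: nn_integral_add)
  qed
  have "(\<integral>\<^sup>+t. ennreal t \<partial>hitting_time_upto q A (Suc n) x)
      = (\<integral>\<^sup>+s. ennreal s + ?m \<partial>density lborel (exponential_density (exit_rate q x)))"
    using x by (simp add: nn_integral_hitting_time_upto_Suc,
      intro nn_integral_cong_AE, rule_tac AE_mp[OF AE_exponential_nonneg], intro AE_I2)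
      (simp add: split2)
  also have "\<dots> = ennreal (1 / exit_rate q x) + ?m"
    using E.emeasure_space_1
    by (subst nn_integral_add) (auto simp: nn_integral_exponential[OF pos[OF x]])
  finally show ?thesis .
qed

text \<open>The mean as the integral of the tail: Fubini on the region below the diagonal. It makes means
  pass to the limit together with distribution functions.\<close>

lemma nn_integral_eq_tail_integral:
  assumes "real_distribution M" and nonneg: "AE t in M. 0 \<le> t"
  shows "(\<integral>\<^sup>+t. ennreal t \<partial>M) = (\<integral>\<^sup>+t. ennreal (1 - cdf M t) * indicator {0..} t \<partial>lborel)"
proof -
  interpret M: real_distribution M by fact
  interpret P: pair_sigma_finite lborel M ..
  have "(\<integral>\<^sup>+x. ennreal x \<partial>M) = (\<integral>\<^sup>+x. (\<integral>\<^sup>+t. indicator {z. 0 \<le> fst z \<and> fst z < snd z} (t, x) \<partial>lborel) \<partial>M)"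
  proof (rule nn_integral_cong_AE, rule AE_mp[OF nonneg], intro AE_I2 impI)
    fix x :: real assume "0 \<le> x"
    have "(\<integral>\<^sup>+t. indicator {z. 0 \<le> fst z \<and> fst z < snd z} (t, x) \<partial>lborel) = (\<integral>\<^sup>+t. indicator {0..<x} t \<partial>lborel)"
      by (intro nn_integral_cong) (auto split: split_indicator)
    then show "ennreal x = (\<integral>\<^sup>+t. indicator {z. 0 \<le> fst z \<and> fst z < snd z} (t, x) \<partial>lborel)"
      using \<open>0 \<le> x\<close> by simp
  qed
  also have "\<dots> = (\<integral>\<^sup>+t. (\<integral>\<^sup>+x. indicator {z. 0 \<le> fst z \<and> fst z < snd z} (t, x) \<partial>M) \<partial>lborel)"
    by (rule P.Fubini') measurable
  also have "\<dots> = (\<integral>\<^sup>+t. ennreal (1 - cdf M t) * indicator {0..} t \<partial>lborel)"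
  proof (rule nn_integral_cong)
    fix t :: real
    have "(\<integral>\<^sup>+x. indicator {z. 0 \<le> fst z \<and> fst z < snd z} (t, x) \<partial>M)
        = (\<integral>\<^sup>+x. indicator {0..} t * indicator {t<..} x \<partial>M)"
      by (intro nn_integral_cong) (auto split: split_indicator)
    also have "\<dots> = indicator {0..} t * emeasure M {t<..}"
      by (simp add: nn_integral_cmult)
    also have "emeasure M {t<..} = ennreal (1 - cdf M t)"
      using M.prob_compl[of "{..t}"] by (simp add: M.emeasure_eq_measure cdf_def Compl_eq_Diff_UNIV[symmetric])
    finally show "(\<integral>\<^sup>+x. indicator {z. 0 \<le> fst z \<and> fst z < snd z} (t, x) \<partial>M)
        = ennreal (1 - cdf M t) * indicator {0..} t" by (simp add: mult.commute)
  qed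
  finally show ?thesis .
qed

lemma hitting_time_law_eq_return:
  assumes "x \<in> A"
  shows "hitting_time_law q A x = return borel 0"
proof -
  have "hitting_time_upto q A n x = return borel 0" for n
    using assms by (cases n) (auto simp: hitting_time_upto.simps(2))
  then have F: "hitting_time_law q A x = interval_measure (cdf (return borel 0))"
    by (simp add: hitting_time_law_def)
  interpret R: real_distribution "return borel (0::real)"
    by (auto simp: real_distribution_def real_distribution_axioms_def intro!: prob_space_return)
  have "real_distribution (interval_measure (cdf (return borel 0)))"
    using R.cdf_nondecreasing R.cdf_is_right_cont R.cdf_lim_at_bot R.cdf_lim_at_top_prob
    by (intro real_distribution_interval_measure)
  moreover have "cdf (interval_measure (cdf (return borel 0))) = cdf (return borel (0::real))"
    using R.cdf_nondecreasing R.cdf_is_right_cont R.cdf_lim_at_bot by (intro cdf_interval_measure)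
  ultimately show ?thesis unfolding F
    using cdf_unique R.real_distribution_axioms by blast
qed

text \<open>The mean of the time truncated after \<open>n\<close> jumps satisfies the recursion that \<open>h\<close> solves, and so
  does \<open>h\<close> itself up to the error \<open>\<rho> ^ n * V x\<close>: the geometric decay of \<open>V\<close> replaces an argument that
  the set is reached almost surely. Thus the truncated means increase to \<open>h x\<close>. By the Markov
  inequality they leave no mass at infinity in the limit, so the limiting distribution function is
  that of a probability law, and monotone convergence of the tails gives its mean.\<close>

lemma hitting_time_law:
  fixes h V :: "'a \<Rightarrow> real"
  assumes closed: "\<And>x y. x \<in> I \<Longrightarrow> x \<notin> A \<Longrightarrow> y \<in> set_pmf (jump_pmf q x) \<Longrightarrow> y \<in> I"
    and pos: "\<And>x. x \<in> I \<Longrightarrow> x \<notin> A \<Longrightarrow> 0 < exit_rate q x"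
    and h0: "\<And>x. x \<in> I \<Longrightarrow> x \<in> A \<Longrightarrow> h x = 0"
    and h_step: "\<And>x. x \<in> I \<Longrightarrow> x \<notin> A \<Longrightarrow>
      ennreal (h x) = ennreal (1 / exit_rate q x) + (\<integral>\<^sup>+y. ennreal (h y) \<partial>measure_pmf (jump_pmf q x))"
    and V: "\<And>x. x \<in> I \<Longrightarrow> h x \<le> V x" and \<rho>: "0 \<le> \<rho>" "\<rho> < 1"
    and V_step: "\<And>x. x \<in> I \<Longrightarrow> x \<notin> A \<Longrightarrow>
      (\<integral>\<^sup>+y. ennreal (V y) \<partial>measure_pmf (jump_pmf q x)) \<le> ennreal (\<rho> * V x)"
    and x: "x \<in> I" "x \<notin> A"
  shows "real_distribution (hitting_time_law q A x)"
    and "measure (hitting_time_law q A x) {0<..} = 1"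
    and "(\<integral>\<^sup>+t. ennreal t \<partial>hitting_time_law q A x) = ennreal (h x)"
proof -
  define H where "H n = hitting_time_upto q A n x" for n
  have rd: "real_distribution (H n)" for n
    using hitting_time_upto_prob[where A = A and n = n, OF closed pos x(1)] unfolding H_def
    by (auto simp: real_distribution_def real_distribution_axioms_def)
  interpret H: real_distribution "H n" for n by (rule rd)
  define m where "m n z = (\<integral>\<^sup>+t. ennreal t \<partial>hitting_time_upto q A n z)" for n z
  have m_tail: "m n x = (\<integral>\<^sup>+t. ennreal (1 - cdf (H n) t) * indicator {0..} t \<partial>lborel)" for n
    unfolding m_def H_def
    by (rule nn_integral_eq_tail_integral[OF rd[unfolded H_def] AE_hitting_time_upto_nonneg])
  have m_Suc: "m (Suc n) z = (if z \<in> A then 0 else ennreal (1 / exit_rate q z) + (\<integral>\<^sup>+y. m n y \<partial>measure_pmf (jump_pmf q z)))"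
    if "z \<in> I" for n z
    using nn_integral_hitting_time_upto_mean[OF closed pos that] unfolding m_def
    by (auto simp: hitting_time_upto.simps(2) nn_integral_return)
  have m0: "m 0 z = 0" for z by (simp add: m_def nn_integral_return)
  have m_le: "m n z \<le> ennreal (h z)" if "z \<in> I" for n z using that
  proof (induction n arbitrary: z)
    case (Suc n)
    have "(\<integral>\<^sup>+y. m n y \<partial>measure_pmf (jump_pmf q z)) \<le> (\<integral>\<^sup>+y. ennreal (h y) \<partial>measure_pmf (jump_pmf q z))"
      if "z \<notin> A" using Suc.IH closed[OF Suc.prems that]
      by (intro nn_integral_mono_AE) (simp add: AE_measure_pmf_iff)
    then show ?case using Suc.prems
      by (auto simp: m_Suc h_step intro!: add_left_mono)
  qed (simp add: m0)
  \<comment> \<open>\<open>h\<close> exceeds the truncated mean by at most what \<open>V\<close> retains after \<open>n\<close> jumps\<close>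
  have le_m: "ennreal (h z) \<le> m n z + ennreal (\<rho> ^ n * V z)" if "z \<in> I" for n z using that
  proof (induction n arbitrary: z)
    case 0
    then show ?case using V by (simp add: m0 ennreal_leI)
  next
    case (Suc n)
    show ?case
    proof (cases "z \<in> A")
      case True
      then show ?thesis using Suc.prems h0 by simp
    next
      case False
      let ?J = "measure_pmf (jump_pmf q z)"
      have "(\<integral>\<^sup>+y. ennreal (h y) \<partial>?J) \<le> (\<integral>\<^sup>+y. m n y + ennreal (\<rho> ^ n * V y) \<partial>?J)"
        using Suc.IH closed[OF Suc.prems False]
        by (intro nn_integral_mono_AE) (simp add: AE_measure_pmf_iff)
      also have "\<dots> = (\<integral>\<^sup>+y. m n y \<partial>?J) + ennreal (\<rho> ^ n) * (\<integral>\<^sup>+y. ennreal (V y) \<partial>?J)"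
        using \<rho> by (simp add: nn_integral_add nn_integral_cmult ennreal_mult')
      also have "\<dots> \<le> (\<integral>\<^sup>+y. m n y \<partial>?J) + ennreal (\<rho> ^ n) * ennreal (\<rho> * V z)"
        by (intro add_left_mono mult_left_mono V_step Suc.prems False) simp
      also have "ennreal (\<rho> ^ n) * ennreal (\<rho> * V z) = ennreal (\<rho> ^ Suc n * V z)"
        using \<rho> by (simp add: ennreal_mult'[symmetric] mult.assoc mult.left_commute)
      finally show ?thesis
        using Suc.prems False by (simp add: m_Suc h_step add.assoc add_left_mono)
    qed
  qed
  have m_lim: "(\<lambda>n. m n x) \<longlonglongrightarrow> ennreal (h x)"
  proof (rule tendsto_sandwich)
    show "eventually (\<lambda>n. ennreal (h x) - ennreal (\<rho> ^ n * V x) \<le> m n x) sequentially"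
      using le_m[OF x(1)] by (intro always_eventually allI) (simp add: ennreal_minus_le_iff add.commute)
    show "eventually (\<lambda>n. m n x \<le> ennreal (h x)) sequentially"
      using m_le[OF x(1)] by simp
    have "(\<lambda>n. \<rho> ^ n * V x) \<longlonglongrightarrow> 0 * V x"
      using \<rho> by (intro tendsto_mult_right LIMSEQ_realpow_zero)
    then have "(\<lambda>n. ennreal (\<rho> ^ n * V x)) \<longlonglongrightarrow> ennreal 0" by (intro tendsto_ennrealI) simp
    then have "(\<lambda>n. ennreal (h x) - ennreal (\<rho> ^ n * V x)) \<longlonglongrightarrow> ennreal (h x) - ennreal 0"
      by (intro tendsto_diff_ennreal) auto
    then show "(\<lambda>n. ennreal (h x) - ennreal (\<rho> ^ n * V x)) \<longlonglongrightarrow> ennreal (h x)" by simp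
  qed simp
  define F where "F t = lim (\<lambda>n. cdf (H n) t)" for t
  have dec: "decseq (\<lambda>n. cdf (H n) t)" for t
  proof (rule decseq_SucI)
    fix n
    have "ennreal (cdf (H (Suc n)) t) \<le> ennreal (cdf (H n) t)"
      using emeasure_hitting_time_upto_Suc_le[of q A n x t]
      by (simp add: H_def[symmetric] H.emeasure_eq_measure cdf_def)
    then show "cdf (H (Suc n)) t \<le> cdf (H n) t"
      by (simp add: H.cdf_nonneg)
  qed
  have F_lim: "(\<lambda>n. cdf (H n) t) \<longlonglongrightarrow> F t" for t
  proof -
    have "convergent (\<lambda>n. cdf (H n) t)"
      using dec[of t] H.cdf_nonneg by (intro Bseq_monoseq_convergent decseq_imp_monoseq)
        (auto intro!: BseqI'[of _ 1] simp: H.cdf_bounded_prob)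
    then show ?thesis unfolding F_def by (simp add: convergent_LIMSEQ_iff)
  qed
  have F_le: "F t \<le> cdf (H n) t" for n t
    using decseq_ge[OF dec F_lim] .
  have F_ge: "0 \<le> F t" for t
    by (rule LIMSEQ_le_const[OF F_lim]) (auto simp: H.cdf_nonneg)
  have F_mono: "F s \<le> F t" if "s \<le> t" for s t
    by (rule LIMSEQ_le[OF F_lim F_lim]) (use that in \<open>auto simp: H.cdf_nondecreasing\<close>)
  \<comment> \<open>a decreasing limit of right-continuous monotone functions\<close>
  have F_right: "continuous (at_right a) F" for a
    unfolding continuous_within
  proof (rule tendstoI)
    fix e :: real assume e: "0 < e"
    have "eventually (\<lambda>n. cdf (H n) a < F a + e) sequentially"
      using order_tendstoD(2)[OF F_lim[of a]] e by simp
    then obtain n where n: "cdf (H n) a < F a + e" by (auto simp: eventually_sequentially)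
    have "eventually (\<lambda>t. cdf (H n) t < F a + e) (at_right a)"
      using order_tendstoD(2)[OF H.cdf_is_right_cont[where a = a, unfolded continuous_within] n] .
    then show "eventually (\<lambda>t. dist (F t) (F a) < e) (at_right a)"
      using eventually_at_right_less[of a]
    proof eventually_elim
      case (elim t)
      then show ?case using F_le[of t n] F_mono[of a t] by (simp add: dist_real_def)
    qed
  qed
  \<comment> \<open>outside of \<open>A\<close> the first holding time is already positive\<close>
  have cdf0: "cdf (H 1) t = 0" if "t \<le> 0" for t
  proof -
    let ?E = "density lborel (exponential_density (exit_rate q x))"
    have "AE s in ?E. 0 < s"
    proof (subst AE_density)
      show "AE s in lborel. 0 < ennreal (exponential_density (exit_rate q x) s) \<longrightarrow> 0 < s"
        using AE_lborel_singleton[of 0]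
        by (rule AE_mp) (auto simp: exponential_density_def)
    qed simp
    then have "AE s in ?E. indicator {..t} s = (0::ennreal)"
      by (rule AE_mp) (use that in auto)
    then have "(\<integral>\<^sup>+s. indicator {..t} s \<partial>?E) = (\<integral>\<^sup>+s. 0 \<partial>?E)"
      by (rule nn_integral_cong_AE)
    moreover have "emeasure (H 1) {..t} = (\<integral>\<^sup>+s. indicator {..t} s \<partial>?E)"
      using nn_integral_hitting_time_upto_Suc[of "indicator {..t}" q A 0 x] x
      by (simp add: H_def nn_integral_return del: nn_integral_indicator)
         (simp add: nn_integral_indicator)
    ultimately show ?thesis by (simp add: cdf_def measure_def)
  qed
  have F0: "F t = 0" if "t \<le> 0" for t
    using F_le[of t 1] F_ge[of t] cdf0[OF that] by simp
  have F_bot: "(F \<longlongrightarrow> 0) at_bot"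
    by (rule tendsto_eventually) (auto simp: eventually_at_bot_linorder F0 intro!: exI[of _ 0])
  have F_le1: "F t \<le> 1" for t using order_trans[OF F_le[of t 0] H.cdf_bounded_prob] .
  have markov: "1 - h x / t \<le> F t" if t: "0 < t" for t
  proof (rule LIMSEQ_le_const[OF F_lim], intro exI allI impI)
    fix n
    have "emeasure (H n) {s\<in>space (H n). 1 \<le> ennreal (1/t) * ennreal s} \<le> ennreal (1/t) * (\<integral>\<^sup>+s. ennreal s * indicator (space (H n)) s \<partial>H n)"
      by (rule nn_integral_Markov_inequality) auto
    also have "(\<integral>\<^sup>+s. ennreal s * indicator (space (H n)) s \<partial>H n) = m n x"
      unfolding m_def H_def by simp
    also have "ennreal (1/t) * m n x \<le> ennreal (1/t) * ennreal (h x)"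
      by (intro mult_left_mono m_le x) simp
    finally have 1: "emeasure (H n) {s\<in>space (H n). 1 \<le> ennreal (1/t) * ennreal s} \<le> ennreal (h x / t)"
      using t by (simp add: ennreal_mult'[symmetric])
    have "emeasure (H n) {t<..} \<le> emeasure (H n) {s\<in>space (H n). 1 \<le> ennreal (1/t) * ennreal s}"
      using t by (intro emeasure_mono) (auto simp: ennreal_mult'[symmetric])
    also note 1
    finally have 2: "ennreal (measure (H n) {t<..}) \<le> ennreal (h x / t)"
      by (simp add: H.emeasure_eq_measure)
    have "ennreal (h x) \<noteq> 0" using h_step[OF x] pos[OF x] by simp
    then have "0 < h x" by (simp add: ennreal_eq_0_iff)
    with 2 t have "measure (H n) {t<..} \<le> h x / t" by simp
    moreover have "measure (H n) {t<..} = 1 - cdf (H n) t"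
      using H.prob_compl[where A = "{..t}"] by (simp add: cdf_def Compl_eq_Diff_UNIV[symmetric])
    ultimately show "1 - h x / t \<le> cdf (H n) t" by simp
  qed
  have F_top: "(F \<longlongrightarrow> 1) at_top"
  proof (rule tendsto_sandwich)
    show "eventually (\<lambda>t. 1 - h x / t \<le> F t) at_top"
      using eventually_gt_at_top[of 0] by eventually_elim (rule markov)
    show "eventually (\<lambda>t. F t \<le> 1) at_top" by (simp add: F_le1)
    have "((\<lambda>t. 1 - h x / t) \<longlongrightarrow> 1 - 0) at_top"
      by (intro tendsto_intros real_tendsto_divide_at_top[OF tendsto_const filterlim_ident])
    then show "((\<lambda>t. 1 - h x / t) \<longlongrightarrow> 1) at_top" by simp
  qed simp
  have law: "hitting_time_law q A x = interval_measure F"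
    by (simp add: hitting_time_law_def F_def[abs_def] H_def)
  show rdF: "real_distribution (hitting_time_law q A x)"
    unfolding law by (rule real_distribution_interval_measure[OF F_mono F_right F_bot F_top])
  have cdfF: "cdf (hitting_time_law q A x) = F"
    unfolding law by (rule cdf_interval_measure[OF F_mono F_right F_bot])
  interpret T: real_distribution "hitting_time_law q A x" by (rule rdF)
  have "measure (hitting_time_law q A x) {..0} = 0"
    using cdfF F0[of 0] by (metis cdf_def order_refl)
  then show pos1: "measure (hitting_time_law q A x) {0<..} = 1"
    using T.prob_compl[of "{..0}"] by (simp add: Compl_eq_Diff_UNIV[symmetric])
  then have "AE t in hitting_time_law q A x. t \<in> {0<..}"
    by (subst (asm) T.prob_eq_1) auto
  then have "AE t in hitting_time_law q A x. 0 \<le> t" by (rule AE_mp) auto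
  from nn_integral_eq_tail_integral[OF rdF this]
  have "(\<integral>\<^sup>+t. ennreal t \<partial>hitting_time_law q A x) = (\<integral>\<^sup>+t. ennreal (1 - F t) * indicator {0..} t \<partial>lborel)"
    by (simp add: cdfF)
  also have "\<dots> = (\<integral>\<^sup>+t. (SUP n. ennreal (1 - cdf (H n) t) * indicator {0..} t) \<partial>lborel)"
  proof (rule nn_integral_cong)
    fix t
    have inc: "incseq (\<lambda>n. ennreal (1 - cdf (H n) t) * indicator {0..} t)"
      using dec[of t] by (auto simp: incseq_def decseq_def intro!: mult_right_mono ennreal_leI)
    have "(\<lambda>n. ennreal (1 - cdf (H n) t) * indicator {0..} t) \<longlonglongrightarrow> ennreal (1 - F t) * indicator {0..} t"
      by (intro tendsto_mult_ennreal tendsto_intros tendsto_ennrealI F_lim) (auto split: split_indicator)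
    from LIMSEQ_unique[OF this LIMSEQ_SUP[OF inc]]
    show "ennreal (1 - F t) * indicator {0..} t = (SUP n. ennreal (1 - cdf (H n) t) * indicator {0..} t)" .
  qed
  also have "\<dots> = (SUP n. \<integral>\<^sup>+t. ennreal (1 - cdf (H n) t) * indicator {0..} t \<partial>lborel)"
  proof (rule nn_integral_monotone_convergence_SUP)
    show "incseq (\<lambda>n t. ennreal (1 - cdf (H n) t) * indicator {0..} t)"
      using dec by (auto simp: incseq_def decseq_def le_fun_def intro!: mult_right_mono ennreal_leI)
    show "(\<lambda>t. ennreal (1 - cdf (H n) t) * indicator {0..} t) \<in> borel_measurable lborel" for n
    proof -
      have "cdf (H n) \<in> borel_measurable borel"
        by (intro borel_measurable_mono monoI H.cdf_nondecreasing)
      then show ?thesis by measurable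
    qed
  qed
  also have "\<dots> = (SUP n. m n x)"
    by (simp add: m_tail)
  also have "\<dots> = ennreal (h x)"
  proof -
    have "incseq (\<lambda>n. m n x)"
    proof (rule incseq_SucI)
      fix n
      have "(\<integral>\<^sup>+t. ennreal (1 - cdf (H n) t) * indicator {0..} t \<partial>lborel)
        \<le> (\<integral>\<^sup>+t. ennreal (1 - cdf (H (Suc n)) t) * indicator {0..} t \<partial>lborel)"
        using dec by (auto simp: decseq_def intro!: nn_integral_mono mult_right_mono ennreal_leI)
      then show "m n x \<le> m (Suc n) x"
        by (simp add: m_tail)
    qed
    from LIMSEQ_unique[OF LIMSEQ_SUP[OF this] m_lim] show ?thesis .
  qed
  finally show "(\<integral>\<^sup>+t. ennreal t \<partial>hitting_time_law q A x) = ennreal (h x)" .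
qed

section \<open>The density of the limiting diffusion\<close>

lemma has_real_derivative_max0_square:
  "((\<lambda>x. (max 0 (x - c))\<^sup>2) has_real_derivative 2 * max 0 (x - c)) (at x)"
proof -
  consider "x < c" | "x > c" | "x = c" by linarith
  then show ?thesis
  proof cases
    case 1
    have "((\<lambda>x. 0) has_real_derivative 2 * max 0 (x - c)) (at x)" using 1 by simp
    then show ?thesis
      by (rule DERIV_cong_ev[THEN iffD1, rotated -1])
        (use 1 in \<open>auto intro!: eventually_mono[OF order_tendstoD(2)[OF tendsto_ident_at 1]] eventually_nhds_in_open simp: eventually_nhds_conv_at\<close>)
  next
    case 2
    have "((\<lambda>x. (x - c)\<^sup>2) has_real_derivative 2 * max 0 (x - c)) (at x)"
      using 2 by (auto intro!: derivative_eq_intros)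
    then show ?thesis
      by (rule DERIV_cong_ev[THEN iffD1, rotated -1])
        (use 2 in \<open>auto intro!: eventually_mono[OF order_tendstoD(1)[OF tendsto_ident_at 2]] simp: eventually_nhds_conv_at\<close>)
  next
    case 3
    have "((\<lambda>h. (max 0 h)\<^sup>2 / h) \<longlongrightarrow> 0) (at (0::real))"
    proof (rule tendsto_0_le[where K = 1])
      show "((\<lambda>h::real. h) \<longlongrightarrow> 0) (at 0)" by (rule tendsto_ident_at)
      show "eventually (\<lambda>h. norm ((max 0 h)\<^sup>2 / h) \<le> norm h * 1) (at (0::real))"
        by (intro always_eventually allI) (auto simp: max_def power2_eq_square)
    qed
    then show ?thesis using 3 by (simp add: DERIV_def)
  qed
qed

lemma real_antiderivative_exists:
  fixes f :: "real \<Rightarrow> real"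
  assumes "continuous_on UNIV f"
  obtains F where "\<And>x. (F has_real_derivative f x) (at x)"
proof -
  have "\<exists>F. \<forall>x. -\<infinity> < ereal x \<longrightarrow> ereal x < \<infinity> \<longrightarrow> (F has_vector_derivative f x) (at x)"
    using assms by (intro einterval_antiderivative) (auto simp: continuous_on_eq_continuous_at)
  then show ?thesis using that by (auto simp: has_real_derivative_iff_has_vector_derivative)
qed

text \<open>Applied with \<open>F\<close> the product of a derivative and the density, this is the integration by parts
  behind invariance.\<close>

lemma integral_compact_support_FTC:
  fixes F f :: "real \<Rightarrow> real"
  assumes d: "\<And>x. (F has_real_derivative f x) (at x)" and c: "continuous_on UNIV f"
    and z: "\<And>x. x \<notin> {l..u} \<Longrightarrow> f x = 0" and le: "l \<le> u"
  shows "has_bochner_integral lborel f (F u - F l)"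
proof -
  have "has_bochner_integral lborel (\<lambda>x. f x * indicator {l..u} x) (F u - F l)"
    using d c le by (intro has_bochner_integral_FTC_Icc_real) (auto simp: continuous_on_eq_continuous_at)
  moreover have "(\<lambda>x. f x * indicator {l..u} x) = f" using z by (auto split: split_indicator)
  ultimately show ?thesis by simp
qed

lemma const_of_derivative_zero:
  fixes F :: "real \<Rightarrow> real"
  assumes d: "\<And>x. (F has_real_derivative f x) (at x)" and z: "\<And>z. x < z \<Longrightarrow> z < y \<Longrightarrow> f z = 0"
    and xy: "x \<le> y"
  shows "F x = F y"
proof (cases "x = y")
  case False
  with xy have "x < y" by simp
  from MVT2[OF this, of F f] d z show ?thesis by fastforce
qed simp

locale limit_diffusion =
  fixes lam mu b g :: real
  assumes lam_pos: "0 < lam" and mu_pos: "0 < mu" and g_le_b': "g \<le> b"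
begin

abbreviation "drift \<equiv> limit_drift lam mu b g"

text \<open>The invariant density up to normalization, a solution of \<open>w' = (drift / mu) * w\<close>. The squared
  positive parts, which are differentiable, replace a case distinction at \<open>g\<close> and \<open>b\<close>.\<close>

definition weight_fn :: "real \<Rightarrow> real" where
  "weight_fn x = exp (- (x\<^sup>2 / 2 - (max 0 (x - g))\<^sup>2 / 2 + lam / (2 * mu) * (max 0 (x - b))\<^sup>2))"

lemma weight_fn_pos [simp]: "0 < weight_fn x" and weight_fn_nonneg [simp]: "0 \<le> weight_fn x"
  by (simp_all add: weight_fn_def)

lemma weight_fn_derivative:
  "(weight_fn has_real_derivative (drift x / mu * weight_fn x)) (at x)"
proof -
  define P where "P c x = (max 0 (x - c))\<^sup>2" for c x :: real
  have d: "(P c has_real_derivative 2 * max 0 (x - c)) (at x)" for c x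
    using has_real_derivative_max0_square[of c x] by (simp add: P_def[abs_def])
  have e: "drift x / mu = - (x - max 0 (x - g) + lam / mu * max 0 (x - b))"
    using mu_pos by (simp add: limit_drift_def field_simps min_def max_def)
  have "((\<lambda>x. exp (- (x\<^sup>2 / 2 - P g x / 2 + lam / (2 * mu) * P b x))) has_real_derivative
      (drift x / mu * exp (- (x\<^sup>2 / 2 - P g x / 2 + lam / (2 * mu) * P b x)))) (at x)"
    unfolding e using mu_pos by (auto intro!: derivative_eq_intros d)
  then show ?thesis by (simp add: P_def weight_fn_def[abs_def])
qed

lemma continuous_drift: "continuous_on A drift"
  unfolding limit_drift_def by (intro continuous_intros)

lemma continuous_weight_fn: "continuous_on A weight_fn"
  unfolding weight_fn_def by (intro continuous_intros) auto

lemma weight_fn_measurable [measurable]: "weight_fn \<in> borel_measurable borel"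
  using borel_measurable_continuous_onI[OF continuous_weight_fn] .

lemma drift_measurable [measurable]: "drift \<in> borel_measurable borel"
  using borel_measurable_continuous_onI[OF continuous_drift] .

text \<open>The argument of the normal density and distribution function in the part above \<open>b\<close>.\<close>

definition aspect :: real where "aspect = sqrt (mu / lam) * g"

definition mass1 :: real where "mass1 = sqrt (2 * pi) * std_normal_cdf g"
definition mass2 :: real where "mass2 = exp (- g * g / 2) * (if g = 0 then b else (1 - exp (- g * (b - g))) / g)"
definition mass3 :: real where
  "mass3 = exp (g\<^sup>2 / 2 - g * b) * sqrt (mu / lam) * exp (aspect\<^sup>2 / 2) * (sqrt (2 * pi) * std_normal_cdf (- aspect))"

text \<open>The integral of \<open>(x - b) * weight_fn x\<close> over \<open>x \<ge> b\<close>.\<close>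

definition moment3 :: real where
  "moment3 = exp (g\<^sup>2 / 2 - g * b) * (mu / lam) * exp (aspect\<^sup>2 / 2) *
     (exp (- aspect\<^sup>2 / 2) - aspect * (sqrt (2 * pi) * std_normal_cdf (- aspect)))"

end

lemma has_bochner_integral_gauss_lower:
  "has_bochner_integral lborel (\<lambda>x. indicator {..<c} x * exp (- x\<^sup>2 / 2)) (sqrt (2 * pi) * std_normal_cdf c)"
proof -
  have "(\<integral>\<^sup>+x. ennreal (indicator {..<c} x * std_normal_density x) \<partial>lborel)
      = (\<integral>\<^sup>+x. ennreal (std_normal_density x) * indicator {..c} x \<partial>lborel)"
    by (intro nn_integral_cong_AE) (use AE_lborel_singleton[of c] in \<open>auto elim!: AE_mp split: split_indicator\<close>)
  also have "\<dots> = emeasure std_normal_distribution {..c}"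
    by (subst emeasure_density) auto
  also have "\<dots> = ennreal (std_normal_cdf c)"
  proof -
    interpret prob_space std_normal_distribution by (rule prob_space_normal_density) simp
    show ?thesis by (simp add: cdf_def emeasure_eq_measure)
  qed
  finally have "has_bochner_integral lborel (\<lambda>x. indicator {..<c} x * std_normal_density x) (std_normal_cdf c)"
    by (intro has_bochner_integral_nn_integral) (auto simp: cdf_def)
  from has_bochner_integral_mult_right[OF this, of "sqrt (2 * pi)"]
  show ?thesis by (simp add: std_normal_density_def)
qed

lemma has_bochner_integral_gauss_upper:
  "has_bochner_integral lborel (\<lambda>x. indicator {c<..} x * exp (- x\<^sup>2 / 2)) (sqrt (2 * pi) * std_normal_cdf (- c))"
proof -
  have "has_bochner_integral lborel (\<lambda>x. indicator {..<-c} (0 + (-1) * x) * exp (- (0 + (-1) * x)\<^sup>2 / 2))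
     (inverse \<bar>-1\<bar> *\<^sub>R (sqrt (2 * pi) * std_normal_cdf (- c)))"
    using has_bochner_integral_gauss_lower[of "-c"]
    by (subst lborel_has_bochner_integral_real_affine_iff[symmetric]) auto
  moreover have "(\<lambda>x. indicator {..<-c} (0 + (-1) * x) * exp (- (0 + (-1) * x)\<^sup>2 / 2))
      = (\<lambda>x::real. indicator {c<..} x * exp (- x\<^sup>2 / 2))"
    by (auto split: split_indicator)
  ultimately show ?thesis by simp
qed

text \<open>Here \<open>x * exp (- x\<^sup>2 / 2)\<close> is the derivative of \<open>- exp (- x\<^sup>2 / 2)\<close>.\<close>

lemma has_bochner_integral_gauss_upper_moment:
  fixes c :: real
  shows "has_bochner_integral lborel (\<lambda>x. indicator {c<..} x * (x * exp (- x\<^sup>2 / 2))) (exp (- c\<^sup>2 / 2))"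
proof -
  let ?f = "\<lambda>x::real. x * exp (- x\<^sup>2 / 2)"
  have int: "integrable lborel ?f"
    using integrable_mult_right[OF integrable_std_normal_moment[of 1], of "sqrt (2 * pi)"]
    by (simp add: std_normal_density_def mult.commute)
  have fin: "has_bochner_integral lborel (\<lambda>x. ?f x * indicator {c..c + real n} x)
      (- exp (- (c + real n)\<^sup>2 / 2) - - exp (- c\<^sup>2 / 2))" for n
    by (rule has_bochner_integral_FTC_Icc_real) (auto intro!: derivative_eq_intros continuous_intros)
  have "(\<lambda>n. \<integral>x. ?f x * indicator {c..c + real n} x \<partial>lborel) \<longlonglongrightarrow> (\<integral>x. ?f x * indicator {c..} x \<partial>lborel)"
  proof (rule integral_dominated_convergence[where w = "\<lambda>x. norm (?f x)"])
    show "AE x in lborel. (\<lambda>n. ?f x * indicator {c..c + real n} x) \<longlonglongrightarrow> ?f x * indicator {c..} x"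
    proof (intro AE_I2 tendsto_mult_left tendsto_eventually)
      fix x
      obtain N :: nat where N: "x - c \<le> real N" using real_arch_simple by blast
      show "eventually (\<lambda>n. indicator {c..c + real n} x = (indicator {c..} x :: real)) sequentially"
        by (rule eventually_sequentiallyI[of N]) (use N in \<open>auto split: split_indicator\<close>)
    qed
  qed (use int in \<open>auto split: split_indicator\<close>)
  moreover have "(\<lambda>n. \<integral>x. ?f x * indicator {c..c + real n} x \<partial>lborel) \<longlonglongrightarrow> - 0 - - exp (- c\<^sup>2 / 2)"
    unfolding has_bochner_integral_integral_eq[OF fin]
    by (intro tendsto_intros filterlim_compose[OF exp_at_bot]) real_asymp
  ultimately have "(\<integral>x. ?f x * indicator {c..} x \<partial>lborel) = exp (- c\<^sup>2 / 2)"
    using LIMSEQ_unique by fastforce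
  moreover have "integrable lborel (\<lambda>x. ?f x * indicator {c..} x)"
    by (rule integrable_real_mult_indicator[OF _ int]) simp
  ultimately have 1: "has_bochner_integral lborel (\<lambda>x. ?f x * indicator {c..} x) (exp (- c\<^sup>2 / 2))"
    by (simp add: has_bochner_integral_iff)
  show ?thesis
    by (rule has_bochner_integral_cong_AE[THEN iffD1, OF _ _ _ 1])
      (auto intro!: AE_mp[OF AE_lborel_singleton[of c] AE_I2] split: split_indicator)
qed

context limit_diffusion
begin

text \<open>Below \<open>g\<close> the density is Gaussian, between \<open>g\<close> and \<open>b\<close> exponential and above \<open>b\<close> again Gaussian,
  of variance \<open>mu / lam\<close>; the three masses are those of these ranges.\<close>

lemma mass1: "has_bochner_integral lborel (\<lambda>x. indicator {..<g} x * weight_fn x) mass1"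
proof -
  have "(\<lambda>x. indicator {..<g} x * weight_fn x) = (\<lambda>x. indicator {..<g} x * exp (- x\<^sup>2 / 2))"
    using g_le_b' by (auto simp: weight_fn_def split: split_indicator)
  then show ?thesis unfolding mass1_def using has_bochner_integral_gauss_lower by simp
qed

lemma mass2: "has_bochner_integral lborel (\<lambda>x. indicator {g..<b} x * weight_fn x) mass2"
proof -
  have w: "weight_fn x = exp (- g * g / 2) * exp (- g * (x - g))" if "g \<le> x" "x \<le> b" for x
    using that by (simp add: weight_fn_def exp_add[symmetric] power2_eq_square field_simps)
  define F where "F x = exp (- g * g / 2) * (if g = 0 then x else - exp (- g * (x - g)) / g)" for x
  have d: "(F has_real_derivative exp (- g * g / 2) * exp (- g * (x - g))) (at x)" for x
    unfolding F_def by (cases "g = 0") (auto intro!: derivative_eq_intros)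
  have "has_bochner_integral lborel (\<lambda>x. (exp (- g * g / 2) * exp (- g * (x - g))) * indicator {g..b} x) (F b - F g)"
    using d g_le_b' by (intro has_bochner_integral_FTC_Icc_real) (auto intro!: continuous_intros)
  also have "F b - F g = mass2" by (auto simp: F_def mass2_def field_simps)
  finally have 1: "has_bochner_integral lborel (\<lambda>x. (exp (- g * g / 2) * exp (- g * (x - g))) * indicator {g..b} x) mass2" .
  show ?thesis
  proof (rule has_bochner_integral_cong_AE[THEN iffD1, OF _ _ _ 1])
    show "AE x in lborel. exp (- g * g / 2) * exp (- g * (x - g)) * indicator {g..b} x = indicator {g..<b} x * weight_fn x"
      by (rule AE_mp[OF AE_lborel_singleton[of b]]) (auto simp: w split: split_indicator)
  qed auto
qed

text \<open>Completing the square above \<open>b\<close>.\<close>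

lemma weight_fn_upper:
  assumes "b \<le> x"
  shows "weight_fn x = exp (g\<^sup>2 / 2 - g * b) * exp (aspect\<^sup>2 / 2) * exp (- (sqrt (lam / mu) * (x - b) + aspect)\<^sup>2 / 2)"
proof -
  have s: "sqrt (lam / mu) * aspect = g" "(sqrt (lam / mu))\<^sup>2 = lam / mu"
    using lam_pos mu_pos by (simp_all add: aspect_def real_sqrt_divide power_divide)
  have "(sqrt (lam / mu) * (x - b) + aspect)\<^sup>2 = lam / mu * (x - b)\<^sup>2 + 2 * g * (x - b) + aspect\<^sup>2"
    using s by (simp add: power2_sum power_mult_distrib)
  note q = this
  have "- (x\<^sup>2 / 2 - (x - g)\<^sup>2 / 2 + lam / (2 * mu) * (x - b)\<^sup>2)
      = (g\<^sup>2 / 2 - g * b) + aspect\<^sup>2 / 2 + - (sqrt (lam / mu) * (x - b) + aspect)\<^sup>2 / 2"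
    unfolding q using mu_pos by (simp add: power2_eq_square field_simps)
  then show ?thesis using assms g_le_b' unfolding exp_add[symmetric] by (simp add: weight_fn_def)
qed

lemma mass3: "has_bochner_integral lborel (\<lambda>x. indicator {b..} x * weight_fn x) mass3"
  and moment3: "has_bochner_integral lborel (\<lambda>x. indicator {b..} x * ((x - b) * weight_fn x)) moment3"
proof -
  define s where "s = sqrt (lam / mu)"
  define C where "C = exp (g\<^sup>2 / 2 - g * b) * exp (aspect\<^sup>2 / 2)"
  have s: "0 < s" using lam_pos mu_pos by (simp add: s_def)
  have inv_s: "inverse s = sqrt (mu / lam)" using lam_pos mu_pos by (simp add: s_def real_sqrt_divide)
  have in_iff: "aspect < (aspect - s * b) + s * x \<longleftrightarrow> b < x" for x
    using s by (simp add: algebra_simps)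
  have AE: "AE x in lborel. indicator {b..} x = (indicator {aspect<..} ((aspect - s * b) + s * x) :: real)"
    by (rule AE_mp[OF AE_lborel_singleton[of b]]) (use in_iff in \<open>auto split: split_indicator\<close>)
  have w: "indicator {b..} x * weight_fn x = indicator {b..} x * (C * exp (- ((aspect - s * b) + s * x)\<^sup>2 / 2))" for x
    by (auto simp: weight_fn_upper C_def s_def algebra_simps split: split_indicator)
  have i0: "has_bochner_integral lborel (\<lambda>x. indicator {aspect<..} ((aspect - s * b) + s * x) * exp (- ((aspect - s * b) + s * x)\<^sup>2 / 2))
      (inverse s * (sqrt (2 * pi) * std_normal_cdf (- aspect)))"
    using lborel_has_bochner_integral_real_affine_iff[of s "\<lambda>x. indicator {aspect<..} x * exp (- x\<^sup>2 / 2)" _ "aspect - s * b"]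
      has_bochner_integral_gauss_upper[of aspect] s by auto
  have i1: "has_bochner_integral lborel (\<lambda>x. indicator {aspect<..} ((aspect - s * b) + s * x) * (((aspect - s * b) + s * x) * exp (- ((aspect - s * b) + s * x)\<^sup>2 / 2)))
      (inverse s * exp (- aspect\<^sup>2 / 2))"
    using lborel_has_bochner_integral_real_affine_iff[of s "\<lambda>x. indicator {aspect<..} x * (x * exp (- x\<^sup>2 / 2))" _ "aspect - s * b"]
      has_bochner_integral_gauss_upper_moment[of aspect] s by auto
  show "has_bochner_integral lborel (\<lambda>x. indicator {b..} x * weight_fn x) mass3"
  proof (rule has_bochner_integral_cong_AE[THEN iffD1])
    show "has_bochner_integral lborel (\<lambda>x. C * (indicator {aspect<..} ((aspect - s * b) + s * x) * exp (- ((aspect - s * b) + s * x)\<^sup>2 / 2))) mass3"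
      using has_bochner_integral_mult_right[OF i0, of C] unfolding mass3_def inv_s C_def by (simp add: mult_ac)
    show "AE x in lborel. C * (indicator {aspect<..} ((aspect - s * b) + s * x) * exp (- ((aspect - s * b) + s * x)\<^sup>2 / 2)) = indicator {b..} x * weight_fn x"
      unfolding w using AE by (rule AE_mp) (intro AE_I2, simp)
  qed auto
  have i2: "has_bochner_integral lborel (\<lambda>x. (C / s) * (indicator {aspect<..} ((aspect - s * b) + s * x) * (((aspect - s * b) + s * x) * exp (- ((aspect - s * b) + s * x)\<^sup>2 / 2))
      - aspect * (indicator {aspect<..} ((aspect - s * b) + s * x) * exp (- ((aspect - s * b) + s * x)\<^sup>2 / 2))))
      ((C / s) * (inverse s * exp (- aspect\<^sup>2 / 2) - aspect * (inverse s * (sqrt (2 * pi) * std_normal_cdf (- aspect)))))"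
    by (intro has_bochner_integral_mult_right has_bochner_integral_diff i0 i1)
  have ss: "inverse s * inverse s = mu / lam"
    unfolding inv_s using lam_pos mu_pos by simp
  have m: "(C / s) * (inverse s * exp (- aspect\<^sup>2 / 2) - aspect * (inverse s * (sqrt (2 * pi) * std_normal_cdf (- aspect)))) = moment3"
  proof -
    have "(C / s) * (inverse s * E - a * (inverse s * T)) = C * (inverse s * inverse s) * (E - a * T)" for E a T
      using s by (simp add: field_simps)
    note e = this
    show ?thesis unfolding e unfolding ss moment3_def C_def by (simp add: mult_ac)
  qed
  show "has_bochner_integral lborel (\<lambda>x. indicator {b..} x * ((x - b) * weight_fn x)) moment3"
  proof (rule has_bochner_integral_cong_AE[THEN iffD1, OF _ _ _ i2[unfolded m]])
    have f1: "(C / s) * (I * (((aspect - s * b) + s * x) * E) - aspect * (I * E)) = I * ((x - b) * (C * E))" for I E x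
      using s by (simp add: field_simps)
    have f2: "indicator {b..} x * ((x - b) * weight_fn x) = indicator {b..} x * ((x - b) * (C * exp (- ((aspect - s * b) + s * x)\<^sup>2 / 2)))" for x
      using w[of x] by (auto split: split_indicator)
    show "AE x in lborel. (C / s) * (indicator {aspect<..} ((aspect - s * b) + s * x) * (((aspect - s * b) + s * x) * exp (- ((aspect - s * b) + s * x)\<^sup>2 / 2))
      - aspect * (indicator {aspect<..} ((aspect - s * b) + s * x) * exp (- ((aspect - s * b) + s * x)\<^sup>2 / 2))) = indicator {b..} x * ((x - b) * weight_fn x)"
      unfolding f1 f2 using AE by (rule AE_mp) (intro AE_I2, simp)
  qed auto
qed

definition total_mass :: real where "total_mass = mass1 + mass2 + mass3"

lemma normal_cdf_pos: "0 < std_normal_cdf x"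
proof -
  interpret prob_space std_normal_distribution by (rule prob_space_normal_density) simp
  have "std_normal_cdf x \<noteq> 0"
  proof
    assume "std_normal_cdf x = 0"
    then have "emeasure std_normal_distribution {..x} = 0" by (simp add: cdf_def emeasure_eq_measure)
    then have "AE y in lborel. y \<notin> {..x}"
      by (subst (asm) emeasure_density) (auto simp: nn_integral_0_iff_AE less_imp_neq[OF normal_density_pos, symmetric] indicator_def not_le)
    then have "emeasure lborel {..x} = 0"
      by (subst (asm) AE_iff_measurable[OF _ refl]) (auto simp: atMost_def)
    moreover have "emeasure lborel {x - 1..x} \<le> emeasure lborel {..x}" by (intro emeasure_mono) auto
    ultimately show False by simp
  qed
  then show ?thesis by (simp add: cdf_def less_le)
qed

lemma mass1_pos: "0 < mass1" by (simp add: mass1_def normal_cdf_pos)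

lemma mass3_pos: "0 < mass3"
  using lam_pos mu_pos by (simp add: mass3_def normal_cdf_pos)

lemma mass2_nonneg: "0 \<le> mass2"
  using has_bochner_integral_integral_eq[OF mass2] integral_nonneg_AE[of "\<lambda>x. indicator {g..<b} x * weight_fn x" lborel] by simp

lemma total_mass_pos: "0 < total_mass"
  using mass1_pos mass2_nonneg mass3_pos by (simp add: total_mass_def)

lemma has_bochner_integral_weight_fn: "has_bochner_integral lborel weight_fn total_mass"
proof -
  have "has_bochner_integral lborel (\<lambda>x. (indicator {..<g} x * weight_fn x + indicator {g..<b} x * weight_fn x)
      + indicator {b..} x * weight_fn x) total_mass"
    unfolding total_mass_def by (intro has_bochner_integral_add mass1 mass2 mass3)
  moreover have "(\<lambda>x. (indicator {..<g} x * weight_fn x + indicator {g..<b} x * weight_fn x)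
      + indicator {b..} x * weight_fn x) = weight_fn"
    using g_le_b' by (auto simp: fun_eq_iff split: split_indicator)
  ultimately show ?thesis by simp
qed

definition steady_law :: "real measure" where
  "steady_law = density lborel (\<lambda>x. ennreal (weight_fn x / total_mass))"

lemma sets_steady_law [simp, measurable_cong]: "sets steady_law = sets borel"
  and space_steady_law [simp]: "space steady_law = UNIV"
  by (simp_all add: steady_law_def)

lemma has_bochner_integral_steady_law:
  fixes f :: "real \<Rightarrow> real"
  assumes [measurable]: "f \<in> borel_measurable borel"
    and "has_bochner_integral lborel (\<lambda>x. f x * weight_fn x) c"
  shows "has_bochner_integral steady_law f (c / total_mass)"
  unfolding steady_law_def
proof (rule has_bochner_integral_density)
  show "has_bochner_integral lborel (\<lambda>x. (weight_fn x / total_mass) *\<^sub>R f x) (c / total_mass)"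
    using has_bochner_integral_divide_zero[OF assms(2), of total_mass] by (simp add: mult.commute)
qed (use total_mass_pos in auto)

lemma integral_steady_law:
  fixes f :: "real \<Rightarrow> real"
  assumes [measurable]: "f \<in> borel_measurable borel"
  shows "(\<integral>x. f x \<partial>steady_law) = (\<integral>x. f x * weight_fn x \<partial>lborel) / total_mass"
  unfolding steady_law_def using total_mass_pos
  by (subst integral_density) (auto simp: mult.commute)

lemma real_distribution_steady_law: "real_distribution steady_law"
proof -
  have "prob_space steady_law"
  proof
    have "emeasure steady_law UNIV = (\<integral>\<^sup>+x. ennreal (weight_fn x / total_mass) \<partial>lborel)"
      unfolding steady_law_def by (subst emeasure_density) auto
    also have "\<dots> = ennreal (total_mass / total_mass)"
    proof -
      have h: "has_bochner_integral lborel (\<lambda>x. weight_fn x / total_mass) (total_mass / total_mass)"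
        by (rule has_bochner_integral_divide_zero[OF has_bochner_integral_weight_fn])
      show ?thesis
        using nn_integral_eq_integral[OF integrable.intros[OF h]] total_mass_pos
          has_bochner_integral_integral_eq[OF h] by simp
    qed
    finally show "emeasure steady_law (space steady_law) = 1" using total_mass_pos by simp
  qed
  then show ?thesis by (simp add: real_distribution_def real_distribution_axioms_def)
qed

end

section \<open>Stein equation and characterization of the steady state\<close>

context limit_diffusion
begin

lemma finite_mass_outside:
  assumes "real_distribution M" "0 < e"
  shows "\<exists>R\<ge>0. measure M {x. R < \<bar>x\<bar>} \<le> e"
proof -
  interpret M: real_distribution M by fact
  have "(\<lambda>n. measure M {x. real n < \<bar>x\<bar>}) \<longlonglongrightarrow> measure M (\<Inter>n. {x. real n < \<bar>x\<bar>})"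
    by (rule M.finite_Lim_measure_decseq) (auto simp: decseq_def)
  moreover have "(\<Inter>n. {x::real. real n < \<bar>x\<bar>}) = {}"
  proof -
    have "\<exists>n. \<not> real n < \<bar>x\<bar>" for x :: real
      using real_arch_simple[of "\<bar>x\<bar>"] by (auto simp: not_less)
    then show ?thesis by blast
  qed
  ultimately have "(\<lambda>n. measure M {x. real n < \<bar>x\<bar>}) \<longlonglongrightarrow> 0" by simp
  from order_tendstoD(2)[OF this assms(2)] obtain n where "measure M {x. real n < \<bar>x\<bar>} < e"
    by (auto simp: eventually_sequentially)
  then show ?thesis by (intro exI[of _ "real n"]) auto
qed

text \<open>The equation is a first-order linear one for \<open>F'\<close>, with integrating factor \<open>weight_fn\<close>:
  \<open>F'\<close> is the integral of \<open>h * weight_fn\<close> up to \<open>x\<close>, divided by \<open>mu * weight_fn x\<close>. It vanishes to the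
  right of the support of \<open>h\<close> exactly because \<open>h\<close> is centred.\<close>

lemma stein_equation_solution:
  assumes h: "continuous_on UNIV h" and K: "0 \<le> K" "\<And>x. K < \<bar>x\<bar> \<Longrightarrow> h x = 0"
    and centred: "(\<integral>x. h x * weight_fn x \<partial>lborel) = 0"
  shows "\<exists>F F' F''. (\<forall>x. (F has_real_derivative F' x) (at x)) \<and> (\<forall>x. (F' has_real_derivative F'' x) (at x)) \<and>
    continuous_on UNIV F'' \<and> (\<forall>x. K < \<bar>x\<bar> \<longrightarrow> F' x = 0) \<and> (\<forall>x. drift x * F' x + mu * F'' x = h x)"
proof -
  have cW: "continuous_on UNIV (\<lambda>x. h x * weight_fn x)"
    by (intro continuous_intros h continuous_weight_fn)
  obtain H0 where H0: "\<And>x. (H0 has_real_derivative h x * weight_fn x) (at x)"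
    using real_antiderivative_exists[OF cW] by blast
  \<comment> \<open>the antiderivative that vanishes to the left of the support\<close>
  define H where "H x = H0 x - H0 (- K)" for x
  have H: "(H has_real_derivative h x * weight_fn x) (at x)" for x
    unfolding H_def by (auto intro!: derivative_eq_intros H0)
  have "has_bochner_integral lborel (\<lambda>x. h x * weight_fn x) (H K - H (- K))"
    by (rule integral_compact_support_FTC[OF H cW]) (use K in auto)
  then have HK: "H K = 0" using centred by (auto dest: has_bochner_integral_integral_eq simp: H_def)
  have Hout: "H x = 0" if "K < \<bar>x\<bar>" for x
  proof (cases "0 \<le> x")
    case True
    then have "H K = H x" using that K by (intro const_of_derivative_zero[OF H]) auto
    then show ?thesis using HK by simp
  next
    case False
    then have "H x = H (- K)" using that K by (intro const_of_derivative_zero[OF H]) auto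
    then show ?thesis by (simp add: H_def)
  qed
  define F' where "F' x = H x / (mu * weight_fn x)" for x
  define F'' where "F'' x = (h x - drift x * F' x) / mu" for x
  have ne: "mu * weight_fn x \<noteq> 0" for x using mu_pos less_imp_neq[OF weight_fn_pos[of x]] by simp
  have dF': "(F' has_real_derivative F'' x) (at x)" for x
    unfolding F'_def[abs_def]
    by (rule derivative_eq_intros H weight_fn_derivative ne refl)+
      (use mu_pos less_imp_neq[OF weight_fn_pos[of x]] in \<open>simp add: F''_def F'_def field_simps\<close>)
  have cF': "continuous_on UNIV F'"
    using dF' by (auto simp: continuous_on_eq_continuous_at intro: DERIV_isCont)
  have cF'': "continuous_on UNIV F''"
    unfolding F''_def using mu_pos by (intro continuous_intros h continuous_drift cF') auto
  obtain F where "\<And>x. (F has_real_derivative F' x) (at x)"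
    using real_antiderivative_exists[OF cF'] by blast
  moreover have "drift x * F' x + mu * F'' x = h x" for x
    using mu_pos by (simp add: F''_def)
  ultimately show ?thesis using dF' cF'' Hout by (intro exI[of _ F] exI[of _ F'] exI[of _ F'']) (auto simp: F'_def)
qed

text \<open>The generator applied to \<open>f\<close>, times the density, is the derivative of \<open>mu * (f' * weight_fn)\<close>.\<close>

lemma diffusion_stationary_steady_law: "diffusion_stationary drift (2 * mu) steady_law"
  unfolding diffusion_stationary_def
proof (intro conjI allI impI)
  show "prob_space steady_law" using real_distribution_steady_law by (simp add: real_distribution_def)
  fix f f' f'' :: "real \<Rightarrow> real"
  assume f: "\<forall>x. (f has_real_derivative f' x) (at x)" and f': "\<forall>x. (f' has_real_derivative f'' x) (at x)"
    and c: "continuous_on UNIV f''" and "\<exists>K. \<forall>x. \<bar>x\<bar> > K \<longrightarrow> f x = 0"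
  then obtain K where K: "\<And>x. \<bar>x\<bar> > K \<Longrightarrow> f x = 0" by auto
  define L where "L = max K 0"
  have KL: "K \<le> L" "0 \<le> L" by (auto simp: L_def)
  have op: "open {x::real. K < \<bar>x\<bar>}" by (intro open_Collect_less continuous_intros)
  have z': "f' x = 0" if "K < \<bar>x\<bar>" for x
  proof -
    have "((\<lambda>_. 0) has_real_derivative f' x) (at x)"
      by (rule has_field_derivative_transform_within_open[OF f[rule_format] op]) (use that K in auto)
    then show ?thesis using DERIV_unique[OF _ DERIV_const] by blast
  qed
  have z'': "f'' x = 0" if "K < \<bar>x\<bar>" for x
  proof -
    have "((\<lambda>_. 0) has_real_derivative f'' x) (at x)"
      by (rule has_field_derivative_transform_within_open[OF f'[rule_format] op]) (use that z' in auto)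
    then show ?thesis using DERIV_unique[OF _ DERIV_const] by blast
  qed
  have cf': "continuous_on UNIV f'"
    using f' by (auto simp: continuous_on_eq_continuous_at intro: DERIV_isCont)
  let ?g = "\<lambda>x. (drift x * f' x + 2 * mu / 2 * f'' x) * weight_fn x"
  have "((\<lambda>x. mu * (f' x * weight_fn x)) has_real_derivative ?g x) (at x)" for x
    by (rule derivative_eq_intros f'[rule_format] weight_fn_derivative refl)+
      (use mu_pos in \<open>simp add: field_simps\<close>)
  moreover have "continuous_on UNIV ?g"
    by (intro continuous_intros continuous_drift continuous_weight_fn cf' c)
  ultimately have "has_bochner_integral lborel ?g
      (mu * (f' (L + 1) * weight_fn (L + 1)) - mu * (f' (- (L + 1)) * weight_fn (- (L + 1))))"
    by (rule integral_compact_support_FTC) (use KL z' z'' in auto)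
  then have "has_bochner_integral lborel ?g 0" using z'[of "L + 1"] z'[of "- (L + 1)"] KL by simp
  then show "(\<integral>x. drift x * f' x + 2 * mu / 2 * f'' x \<partial>steady_law) = 0"
    using borel_measurable_continuous_onI[OF cf'] borel_measurable_continuous_onI[OF c]
    by (subst integral_steady_law) (auto dest: has_bochner_integral_integral_eq)
qed simp

text \<open>The normalized antiderivative of the bump \<open>(max 0 (1 - x\<^sup>2))\<^sup>2\<close>, which is just smooth enough for a
  step of class C2.\<close>

lemma smooth_step_exists:
  obtains P P' P'' :: "real \<Rightarrow> real" and B where
    "\<And>x. (P has_real_derivative P' x) (at x)" "\<And>x. (P' has_real_derivative P'' x) (at x)"
    "continuous_on UNIV P''" "\<And>x. x \<le> -1 \<Longrightarrow> P x = 0" "\<And>x. 1 \<le> x \<Longrightarrow> P x = 1"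
    "\<And>x. 1 < \<bar>x\<bar> \<Longrightarrow> P' x = 0" "\<And>x. 1 < \<bar>x\<bar> \<Longrightarrow> P'' x = 0" "\<And>x. \<bar>P' x\<bar> \<le> B" "\<And>x. \<bar>P'' x\<bar> \<le> B"
proof -
  define Q where "Q y = (max 0 (y - 0))\<^sup>2" for y :: real
  have Q: "(Q has_real_derivative 2 * max 0 (y - 0)) (at y)" for y
    unfolding Q_def by (rule has_real_derivative_max0_square)
  define p where "p x = Q (1 - x\<^sup>2)" for x
  define p' where "p' x = 2 * max 0 (1 - x\<^sup>2) * (- 2 * x)" for x :: real
  have p: "(p has_real_derivative p' x) (at x)" for x
  proof -
    have "((\<lambda>x. Q (1 - x\<^sup>2)) has_real_derivative (2 * max 0 ((1 - x\<^sup>2) - 0)) * (- 2 * x)) (at x)"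
      by (rule DERIV_chain2[where f = Q and g = "\<lambda>x. 1 - x\<^sup>2", OF Q]) (auto intro!: derivative_eq_intros)
    then show ?thesis by (simp add: p_def[abs_def] p'_def)
  qed
  have cp: "continuous_on UNIV p" using p by (auto simp: continuous_on_eq_continuous_at intro: DERIV_isCont)
  obtain P0 where P0: "\<And>x. (P0 has_real_derivative p x) (at x)" using real_antiderivative_exists[OF cp] by blast
  have sq: "1 < x\<^sup>2" if "1 < \<bar>x\<bar>" for x :: real using that by (metis abs_ge_zero power2_abs one_less_power pos2)
  have pz: "p x = 0" "p' x = 0" if "1 < \<bar>x\<bar>" for x
    using sq[OF that] by (auto simp: p_def p'_def Q_def)
  obtain z where z: "-1 < z" "z < 1" "P0 1 - P0 (-1) = (1 - (-1)) * p z"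
    using MVT2[of "-1" 1 P0 p] P0 by auto
  have "z\<^sup>2 < 1" using z by (simp add: abs_square_less_1)
  then have "0 < p z" by (simp add: p_def Q_def)
  then have pos: "0 < P0 1 - P0 (-1)" using z(3) by simp
  define T where "T = P0 1 - P0 (-1)"
  have T: "0 < T" using pos by (simp add: T_def)
  have le: "\<bar>p x\<bar> \<le> 4" "\<bar>p' x\<bar> \<le> 4" for x
  proof -
    have m: "0 \<le> max 0 (1 - x\<^sup>2)" "max 0 (1 - x\<^sup>2) \<le> 1" by auto
    show "\<bar>p x\<bar> \<le> 4" using power_mono[OF m(2,1), of 2] by (simp add: p_def Q_def)
    show "\<bar>p' x\<bar> \<le> 4"
    proof (cases "1 < \<bar>x\<bar>")
      case False
      then show ?thesis using mult_mono[of "max 0 (1 - x\<^sup>2)" 1 "\<bar>x\<bar>" 1] m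
        by (simp add: p'_def abs_mult)
    qed (use pz in simp)
  qed
  show ?thesis
  proof (rule that[of "\<lambda>x. (P0 x - P0 (-1)) / T" "\<lambda>x. p x / T" "\<lambda>x. p' x / T" "4 / T"])
    show "((\<lambda>x. (P0 x - P0 (-1)) / T) has_real_derivative p x / T) (at x)" for x
      using T by (auto intro!: derivative_eq_intros P0)
    show "((\<lambda>x. p x / T) has_real_derivative p' x / T) (at x)" for x
      using T by (auto intro!: derivative_eq_intros p)
    show "continuous_on UNIV (\<lambda>x. p' x / T)" unfolding p'_def using T by (intro continuous_intros) auto
    show "(P0 x - P0 (-1)) / T = 0" if "x \<le> -1" for x
      using const_of_derivative_zero[OF P0, of x "-1"] that pz by auto
    show "(P0 x - P0 (-1)) / T = 1" if "1 \<le> x" for x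
      using const_of_derivative_zero[OF P0, of 1 x] that pz T by (auto simp: T_def)
    show "\<bar>p x / T\<bar> \<le> 4 / T" "\<bar>p' x / T\<bar> \<le> 4 / T" for x
      using le[of x] T by (auto simp: divide_right_mono)
  qed (use pz in auto)
qed

text \<open>The generator maps the solution \<open>F\<close> of the Stein equation to \<open>h\<close>, but \<open>F\<close> has different
  constant values at the two ends and hence no compact support. Subtracting a step of height \<open>c\<close>,
  stretched to width \<open>k\<close>, repairs this. The drift grows linearly, so the generator of the stretched
  step stays bounded, and it tends to zero pointwise as \<open>k\<close> grows: dominated convergence removes it
  for every probability measure.\<close>

lemma diffusion_stationary_centred:
  assumes st: "diffusion_stationary drift (2 * mu) M"
    and h: "continuous_on UNIV h" and K: "0 \<le> K" "\<And>x. K < \<bar>x\<bar> \<Longrightarrow> h x = 0"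
    and centred: "(\<integral>x. h x * weight_fn x \<partial>lborel) = 0"
  shows "(\<integral>x. h x \<partial>M) = 0"
proof -
  interpret M: prob_space M using st by (simp add: diffusion_stationary_def)
  have sM [measurable_cong]: "sets M = sets borel" using st by (simp add: diffusion_stationary_def)
  obtain F F' F'' where F: "\<And>x. (F has_real_derivative F' x) (at x)"
    and F': "\<And>x. (F' has_real_derivative F'' x) (at x)" and cF'': "continuous_on UNIV F''"
    and F'z: "\<And>x. K < \<bar>x\<bar> \<Longrightarrow> F' x = 0" and eq: "\<And>x. drift x * F' x + mu * F'' x = h x"
    using stein_equation_solution[OF h K centred] by blast
  obtain P P' P'' B where P: "\<And>x. (P has_real_derivative P' x) (at x)" and P': "\<And>x. (P' has_real_derivative P'' x) (at x)"
    and cP'': "continuous_on UNIV P''" and P0: "\<And>x. x \<le> -1 \<Longrightarrow> P x = 0" and P1: "\<And>x. 1 \<le> x \<Longrightarrow> P x = 1"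
    and P'z: "\<And>x. 1 < \<bar>x\<bar> \<Longrightarrow> P' x = 0" and P''z: "\<And>x. 1 < \<bar>x\<bar> \<Longrightarrow> P'' x = 0"
    and P'B: "\<And>x. \<bar>P' x\<bar> \<le> B" and P''B: "\<And>x. \<bar>P'' x\<bar> \<le> B"
    by (rule smooth_step_exists) blast
  have B0: "0 \<le> B" using P'B[of 0] by linarith
  define c where "c = F (K + 1) - F (- (K + 1))"
  have FL: "F x = F (- (K + 1))" if "x < - K" for x
  proof (cases "x \<le> - (K + 1)")
    case True
    then show ?thesis using K by (intro const_of_derivative_zero[OF F]) (auto intro!: F'z)
  next
    case False
    then have "F (- (K + 1)) = F x" using K that by (intro const_of_derivative_zero[OF F]) (auto intro!: F'z)
    then show ?thesis by simp
  qed
  have FR: "F x = F (K + 1)" if "K < x" for x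
  proof (cases "x \<le> K + 1")
    case True
    then show ?thesis using K that by (intro const_of_derivative_zero[OF F]) (auto intro!: F'z)
  next
    case False
    then have "F (K + 1) = F x" using K that by (intro const_of_derivative_zero[OF F]) (auto intro!: F'z)
    then show ?thesis by simp
  qed
  \<comment> \<open>the step rises over \<open>[K, K + 2 k]\<close>, to the right of the support of \<open>h\<close>\<close>
  define t where "t k x = (x - (K + k)) / k" for k x :: real
  define R where "R k x = drift x * (P' (t k x) / k) + mu * (P'' (t k x) / k / k)" for k x
  have dt: "(t k has_real_derivative 1 / k) (at x)" if "0 < k" for k x
    unfolding t_def using that by (auto intro!: derivative_eq_intros)
  have test: "(\<integral>x. h x - c * R k x \<partial>M) = 0" if k: "0 < k" for k
  proof -
    let ?f = "\<lambda>x. F x - F (- (K + 1)) - c * P (t k x)"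
    let ?f' = "\<lambda>x. F' x - c * (P' (t k x) / k)"
    let ?f'' = "\<lambda>x. F'' x - c * (P'' (t k x) / k / k)"
    have k': "k \<noteq> 0" using k by simp
    have 1: "(?f has_real_derivative ?f' x) (at x)" for x
      by (rule derivative_eq_intros F DERIV_chain2[OF P dt[OF k]] refl)+ (use k in simp)
    have 2: "(?f' has_real_derivative ?f'' x) (at x)" for x
      by (rule derivative_eq_intros F' DERIV_chain2[OF P' dt[OF k]] k' refl)+ (use k in simp)
    have 3: "continuous_on UNIV ?f''"
    proof -
      have "continuous_on UNIV (\<lambda>x. P'' (t k x))"
        by (rule continuous_on_compose2[OF cP'']) (use k' in \<open>auto simp: t_def intro!: continuous_intros\<close>)
      then show ?thesis by (intro continuous_intros cF'') (use k' in auto)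
    qed
    have 4: "?f x = 0" if "K + 2 * k < \<bar>x\<bar>" for x
    proof (cases "0 \<le> x")
      case True
      then have "1 \<le> t k x" using that k by (simp add: t_def field_simps)
      moreover have "K < x" using True that k by simp
      ultimately show ?thesis using P1 FR[of x] by (simp add: c_def)
    next
      case False
      then have "t k x \<le> -1" using that k K by (simp add: t_def field_simps)
      moreover have "x < - K" using False that k by simp
      ultimately show ?thesis using P0 FL[of x] by simp
    qed
    have "(\<integral>x. drift x * ?f' x + 2 * mu / 2 * ?f'' x \<partial>M) = 0"
      by (rule st[unfolded diffusion_stationary_def, THEN conjunct2, THEN conjunct2, THEN spec, THEN spec,
            THEN spec, THEN mp, THEN mp, THEN mp, THEN mp]) (use 1 2 3 4 in blast)+
    moreover have "drift x * ?f' x + 2 * mu / 2 * ?f'' x = h x - c * R k x" for x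
      by (simp add: R_def eq[symmetric] algebra_simps)
    ultimately show ?thesis by simp
  qed
  have Rbound: "\<bar>R k x\<bar> \<le> (lam * (2 + K + \<bar>b\<bar>) + mu * (2 + K + \<bar>g\<bar>)) * B + mu * B" if k: "1 \<le> k" for k x
  proof (cases "\<bar>t k x\<bar> \<le> 1")
    case False
    then show ?thesis using P'z P''z B0 lam_pos mu_pos K by (auto simp: R_def intro!: add_nonneg_nonneg mult_nonneg_nonneg)
  next
    case True
    then have "K \<le> x" "x \<le> K + 2 * k" using k by (auto simp: t_def abs_le_iff field_simps)
    then have x: "\<bar>x\<bar> \<le> K + 2 * k" using K by simp
    have k1: "K + \<bar>b\<bar> \<le> (K + \<bar>b\<bar>) * k" "K + \<bar>g\<bar> \<le> (K + \<bar>g\<bar>) * k"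
      using k K mult_left_mono[of 1 k "K + \<bar>b\<bar>"] mult_left_mono[of 1 k "K + \<bar>g\<bar>"] by auto
    have "\<bar>max 0 (x - b)\<bar> \<le> (2 + K + \<bar>b\<bar>) * k" "\<bar>min x g\<bar> \<le> (2 + K + \<bar>g\<bar>) * k"
      using x k1 k K by (auto simp: algebra_simps)
    then have "\<bar>drift x\<bar> \<le> lam * ((2 + K + \<bar>b\<bar>) * k) + mu * ((2 + K + \<bar>g\<bar>) * k)"
      using lam_pos mu_pos unfolding limit_drift_def
      by (intro order_trans[OF abs_triangle_ineq4] add_mono) (auto simp: abs_mult)
    then have d: "\<bar>drift x / k\<bar> \<le> lam * (2 + K + \<bar>b\<bar>) + mu * (2 + K + \<bar>g\<bar>)"
      using k by (simp add: field_simps)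
    have "\<bar>drift x * (P' (t k x) / k)\<bar> = \<bar>drift x / k\<bar> * \<bar>P' (t k x)\<bar>" by (simp add: abs_mult)
    also have "\<dots> \<le> (lam * (2 + K + \<bar>b\<bar>) + mu * (2 + K + \<bar>g\<bar>)) * B"
      using d P'B[of "t k x"] B0 lam_pos mu_pos K by (intro mult_mono) (auto intro!: add_nonneg_nonneg mult_nonneg_nonneg)
    finally have a1: "\<bar>drift x * (P' (t k x) / k)\<bar> \<le> (lam * (2 + K + \<bar>b\<bar>) + mu * (2 + K + \<bar>g\<bar>)) * B" .
    have "\<bar>P'' (t k x) / k / k\<bar> \<le> B"
    proof -
      have "\<bar>P'' (t k x)\<bar> \<le> B * k" using P''B[of "t k x"] mult_left_mono[OF k B0] by simp
      also have "\<dots> \<le> B * k * k" using mult_left_mono[OF k, of "B * k"] B0 k by simp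
      finally show ?thesis using k by (simp add: field_simps)
    qed
    then have "\<bar>mu * (P'' (t k x) / k / k)\<bar> \<le> mu * B"
      unfolding abs_mult using mu_pos mult_left_mono[of _ B mu] by (simp only: abs_of_pos less_imp_le)
    with a1 show ?thesis unfolding R_def by linarith
  qed
  have [measurable]: "h \<in> borel_measurable borel" "P' \<in> borel_measurable borel" "P'' \<in> borel_measurable borel"
    using borel_measurable_continuous_onI h cP'' P' by (auto simp: continuous_on_eq_continuous_at intro!: borel_measurable_continuous_onI DERIV_isCont)
  have [measurable]: "R k \<in> borel_measurable borel" for k
    unfolding R_def t_def by measurable
  have intR: "integrable M (R k)" if "1 \<le> k" for k
    by (rule M.integrable_const_bound[of _ "(lam * (2 + K + \<bar>b\<bar>) + mu * (2 + K + \<bar>g\<bar>)) * B + mu * B"])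
      (use Rbound[OF that] in auto)
  obtain Bh where Bh: "\<And>x. \<bar>h x\<bar> \<le> Bh"
  proof -
    have "compact (h ` {-K..K})" by (intro compact_continuous_image continuous_on_subset[OF h]) auto
    then obtain C where C: "\<And>x. x \<in> {-K..K} \<Longrightarrow> \<bar>h x\<bar> \<le> C"
      by (metis bounded_iff compact_imp_bounded imageI real_norm_def)
    have "\<bar>h x\<bar> \<le> max C 0" for x
    proof (cases "K < \<bar>x\<bar>")
      case False
      then have "x \<in> {-K..K}" by auto
      from C[OF this] show ?thesis by simp
    qed (simp add: K(2))
    then show ?thesis using that by blast
  qed
  have inth: "integrable M h" by (rule M.integrable_const_bound[of _ Bh]) (use Bh in auto)
  have hR: "(\<integral>x. h x \<partial>M) = c * (\<integral>x. R (real (Suc k)) x \<partial>M)" for k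
    using test[of "real (Suc k)"] intR[of "real (Suc k)"] inth by (simp add: integrable_mult_right)
  have "(\<lambda>k. \<integral>x. R (real (Suc k)) x \<partial>M) \<longlonglongrightarrow> (\<integral>x. 0 \<partial>M)"
  proof (rule integral_dominated_convergence[where w = "\<lambda>_. (lam * (2 + K + \<bar>b\<bar>) + mu * (2 + K + \<bar>g\<bar>)) * B + mu * B"])
    show "AE x in M. (\<lambda>k. R (real (Suc k)) x) \<longlonglongrightarrow> 0"
    proof (intro AE_I2)
      fix x
      have i: "(\<lambda>k. inverse (real (Suc k))) \<longlonglongrightarrow> 0" by (rule LIMSEQ_inverse_real_of_nat)
      have 1: "(\<lambda>k. P' (t (real (Suc k)) x) * inverse (real (Suc k))) \<longlonglongrightarrow> 0"
        by (rule tendsto_0_le[OF i, where K = B]) (use P'B in \<open>auto simp: abs_mult intro!: mult_right_mono always_eventually\<close>)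
      have 2: "(\<lambda>k. P'' (t (real (Suc k)) x) * inverse (real (Suc k))) \<longlonglongrightarrow> 0"
        by (rule tendsto_0_le[OF i, where K = B]) (use P''B in \<open>auto simp: abs_mult intro!: mult_right_mono always_eventually\<close>)
      have "(\<lambda>k. drift x * (P' (t (real (Suc k)) x) * inverse (real (Suc k)))
          + mu * (P'' (t (real (Suc k)) x) * inverse (real (Suc k)) * inverse (real (Suc k)))) \<longlonglongrightarrow> drift x * 0 + mu * (0 * 0)"
        by (intro tendsto_intros 1 2 i)
      then show "(\<lambda>k. R (real (Suc k)) x) \<longlonglongrightarrow> 0" by (simp add: R_def divide_inverse)
    qed
    show "AE x in M. norm (R (real (Suc k)) x) \<le> (lam * (2 + K + \<bar>b\<bar>) + mu * (2 + K + \<bar>g\<bar>)) * B + mu * B" for k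
      using Rbound[of "real (Suc k)"] by auto
  qed auto
  then have "(\<lambda>k. c * (\<integral>x. R (real (Suc k)) x \<partial>M)) \<longlonglongrightarrow> c * 0"
    by (intro tendsto_mult_left) simp
  then show ?thesis unfolding hR[symmetric] by (simp add: LIMSEQ_const_iff)
qed

text \<open>A bounded continuous \<open>f\<close> is compared with a constant \<open>a\<close>: the function \<open>\<kappa> * (f - a)\<close>, with a
  cutoff \<open>\<kappa>\<close> of compact support, is centred for a suitable \<open>a\<close>, so its integrals vanish in the limit,
  and the cutoff costs only the mass outside a large interval.\<close>

lemma weak_conv_steady_law:
  assumes M: "\<And>n. real_distribution (M n)"
    and stein: "\<And>h K. continuous_on UNIV h \<Longrightarrow> 0 \<le> K \<Longrightarrow> (\<And>x. K < \<bar>x\<bar> \<Longrightarrow> h x = 0) \<Longrightarrow>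
      (\<integral>x. h x * weight_fn x \<partial>lborel) = 0 \<Longrightarrow> (\<lambda>n. \<integral>x. h x \<partial>M n) \<longlonglongrightarrow> 0"
    and tight: "\<And>e. 0 < e \<Longrightarrow> \<exists>R. eventually (\<lambda>n. measure (M n) {x. R < \<bar>x\<bar>} \<le> e) sequentially"
  shows "weak_conv_m M steady_law"
proof (rule integral_bdd_continuous_conv_imp_weak_conv[OF M real_distribution_steady_law])
  fix f :: "real \<Rightarrow> real" assume f: "\<And>x. isCont f x" and f1: "\<And>x. \<bar>f x\<bar> \<le> 1"
  have [measurable]: "f \<in> borel_measurable borel"
    using f by (intro borel_measurable_continuous_onI) (auto simp: continuous_on_eq_continuous_at)
  interpret N: real_distribution steady_law by (rule real_distribution_steady_law)
  show "(\<lambda>n. \<integral>x. f x \<partial>M n) \<longlonglongrightarrow> (\<integral>x. f x \<partial>steady_law)"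
  proof (rule LIMSEQ_I)
    fix r :: real assume r: "0 < r"
    \<comment> \<open>a value below \<open>1\<close> leaves the cutoff with positive mass\<close>
    define e where "e = min (1/2) (r / 8)"
    have e: "0 < e" "e < 1" "4 * e < r" using r by (auto simp: e_def min_def)
    obtain R1 where R1: "eventually (\<lambda>n. measure (M n) {x. R1 < \<bar>x\<bar>} \<le> e) sequentially" using tight[OF e(1)] by blast
    obtain R2 where R2: "measure steady_law {x. R2 < \<bar>x\<bar>} \<le> e"
      using finite_mass_outside[OF real_distribution_steady_law e(1)] by blast
    define R where "R = max 0 (max R1 R2)"
    have R: "0 \<le> R" "R1 \<le> R" "R2 \<le> R" by (auto simp: R_def)
    define \<kappa> where "\<kappa> x = max 0 (min 1 (R + 1 - \<bar>x\<bar>))" for x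
    have \<kappa>: "0 \<le> \<kappa> x" "\<kappa> x \<le> 1" for x by (auto simp: \<kappa>_def)
    have c\<kappa>: "continuous_on UNIV \<kappa>" unfolding \<kappa>_def by (intro continuous_intros)
    have [measurable]: "\<kappa> \<in> borel_measurable borel" using borel_measurable_continuous_onI[OF c\<kappa>] .
    have \<kappa>1: "1 - \<kappa> x \<le> indicator {x. R < \<bar>x\<bar>} x" for x by (auto simp: \<kappa>_def split: split_indicator)
    have key: "\<bar>(\<integral>x. f x \<partial>L) - a\<bar> \<le> 2 * e + \<bar>\<integral>x. \<kappa> x * (f x - a) \<partial>L\<bar>"
      if L: "real_distribution L" and out: "measure L {x. R < \<bar>x\<bar>} \<le> e" and a: "\<bar>a\<bar> \<le> 1" for L a
    proof -
      interpret L: real_distribution L by fact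
      have i1: "integrable L f" by (rule L.integrable_const_bound[of _ 1]) (use f1 in auto)
      have b: "\<bar>\<kappa> x * (f x - a)\<bar> \<le> 2" for x
        using mult_mono[of "\<bar>\<kappa> x\<bar>" 1 "\<bar>f x - a\<bar>" 2] \<kappa>[of x] f1[of x] a by (simp add: abs_mult)
      have i2: "integrable L (\<lambda>x. \<kappa> x * (f x - a))" by (rule L.integrable_const_bound[of _ 2]) (use b in auto)
      have "(\<integral>x. f x \<partial>L) - a - (\<integral>x. \<kappa> x * (f x - a) \<partial>L) = (\<integral>x. (1 - \<kappa> x) * (f x - a) \<partial>L)"
      proof -
        have "(\<integral>x. f x \<partial>L) - a = (\<integral>x. f x - a \<partial>L)" using i1 L.prob_space by simp
        moreover have "(\<integral>x. f x - a \<partial>L) - (\<integral>x. \<kappa> x * (f x - a) \<partial>L) = (\<integral>x. (f x - a) - \<kappa> x * (f x - a) \<partial>L)"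
          using i1 i2 by (intro Bochner_Integration.integral_diff[symmetric]) auto
        moreover have "(\<lambda>x. (f x - a) - \<kappa> x * (f x - a)) = (\<lambda>x. (1 - \<kappa> x) * (f x - a))"
          by (auto simp: algebra_simps)
        ultimately show ?thesis by simp
      qed
      also have "\<bar>\<dots>\<bar> \<le> (\<integral>x. 2 * indicator {x. R < \<bar>x\<bar>} x \<partial>L)"
      proof (rule integral_abs_bound_integral[of L, simplified])
        fix x
        have "\<bar>(1 - \<kappa> x) * (f x - a)\<bar> \<le> indicator {x. R < \<bar>x\<bar>} x * 2"
          unfolding abs_mult using \<kappa>[of x] \<kappa>1[of x] f1[of x] a by (intro mult_mono) auto
        then show "\<bar>(1 - \<kappa> x) * (f x - a)\<bar> \<le> 2 * indicator {x. R < \<bar>x\<bar>} x" by simp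
      next
        have "(\<lambda>x. (1 - \<kappa> x) * (f x - a)) = (\<lambda>x. (f x - a) - \<kappa> x * (f x - a))" by (auto simp: algebra_simps)
        then show "integrable L (\<lambda>x. (1 - \<kappa> x) * (f x - a))" using i1 i2 by simp
      qed (auto intro!: integrable_mult_right integrable_real_indicator simp: L.emeasure_eq_measure)
      also have "\<dots> \<le> 2 * e" using out by simp
      finally show ?thesis by linarith
    qed
    have outN: "measure steady_law {x. R < \<bar>x\<bar>} \<le> e"
      by (rule order_trans[OF N.finite_measure_mono R2]) (use R in auto)
    define z where "z = (\<integral>x. \<kappa> x \<partial>steady_law)"
    have i\<kappa>: "integrable steady_law \<kappa>" by (rule N.integrable_const_bound[of _ 1]) (use \<kappa> in auto)
    have i\<kappa>f: "integrable steady_law (\<lambda>x. \<kappa> x * f x)"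
      by (rule N.integrable_const_bound[of _ 1])
        (use \<kappa> f1 mult_mono[of _ 1 _ 1] in \<open>auto simp: abs_mult mult_le_one\<close>)
    have "1 - z = (\<integral>x. 1 - \<kappa> x \<partial>steady_law)" using i\<kappa> N.prob_space by (simp add: z_def)
    also have "\<dots> \<le> (\<integral>x. indicator {x. R < \<bar>x\<bar>} x \<partial>steady_law)"
      using i\<kappa> \<kappa>1 by (intro integral_mono) (auto intro!: integrable_real_indicator simp: N.emeasure_eq_measure)
    also have "\<dots> \<le> e" using outN by simp
    finally have z: "0 < z" using e by simp
    \<comment> \<open>the constant that makes \<open>\<kappa> * (f - a)\<close> centred\<close>
    define a where "a = (\<integral>x. \<kappa> x * f x \<partial>steady_law) / z"
    have "\<bar>\<integral>x. \<kappa> x * f x \<partial>steady_law\<bar> \<le> z" unfolding z_def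
      using i\<kappa>f i\<kappa> \<kappa> f1 by (intro integral_abs_bound_integral) (auto simp: abs_mult mult_left_le)
    then have a: "\<bar>a\<bar> \<le> 1" using z by (simp add: a_def)
    have N0: "(\<integral>x. \<kappa> x * (f x - a) \<partial>steady_law) = 0"
      using i\<kappa>f i\<kappa> z by (simp add: right_diff_distrib a_def z_def[symmetric])
    then have "(\<integral>x. \<kappa> x * (f x - a) * weight_fn x \<partial>lborel) = 0"
      using total_mass_pos by (subst (asm) integral_steady_law) auto
    then have "(\<lambda>n. \<integral>x. \<kappa> x * (f x - a) \<partial>M n) \<longlonglongrightarrow> 0"
      using R f by (intro stein[where K = "R + 1"])
        (auto intro!: continuous_intros c\<kappa> simp: continuous_on_eq_continuous_at \<kappa>_def)
    then have "eventually (\<lambda>n. \<bar>\<integral>x. \<kappa> x * (f x - a) \<partial>M n\<bar> < r - 4 * e) sequentially"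
      using e by (auto dest!: tendstoD[where e = "r - 4 * e"] simp: dist_real_def)
    with R1 have "eventually (\<lambda>n. \<bar>(\<integral>x. f x \<partial>M n) - (\<integral>x. f x \<partial>steady_law)\<bar> < r) sequentially"
    proof eventually_elim
      case (elim n)
      interpret Mn: real_distribution "M n" by (rule M)
      have "measure (M n) {x. R < \<bar>x\<bar>} \<le> e"
        by (rule order_trans[OF Mn.finite_measure_mono elim(1)]) (use R in auto)
      from key[OF M this a] key[OF real_distribution_steady_law outN a] N0 elim(2)
      show ?case by linarith
    qed
    then show "\<exists>no. \<forall>n\<ge>no. norm ((\<integral>x. f x \<partial>M n) - (\<integral>x. f x \<partial>steady_law)) < r"
      by (simp add: eventually_sequentially)
  qed
qed

lemma measure_steady_law_null:
  assumes "emeasure lborel A = 0" "A \<in> sets borel"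
  shows "measure steady_law A = 0"
proof -
  have "emeasure steady_law A = (\<integral>\<^sup>+x. ennreal (weight_fn x / total_mass) * indicator A x \<partial>lborel)"
    unfolding steady_law_def using assms by (subst emeasure_density) auto
  also have "\<dots> = 0" using assms
    by (intro nn_integral_null_set) (auto simp: null_sets_def)
  finally show ?thesis by (simp add: measure_def)
qed

text \<open>A constant sequence of measures also converges weakly to the steady law.\<close>

lemma diffusion_stationary_unique:
  assumes st: "diffusion_stationary drift (2 * mu) M"
  shows "M = steady_law"
proof -
  have rd: "real_distribution M"
    using st by (simp add: diffusion_stationary_def real_distribution_def real_distribution_axioms_def)
  interpret M: real_distribution M by (rule rd)
  interpret N: real_distribution steady_law by (rule real_distribution_steady_law)
  have tight: "\<exists>R. eventually (\<lambda>n::nat. measure M {x. R < \<bar>x\<bar>} \<le> e) sequentially" if "0 < e" for e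
    using finite_mass_outside[OF rd that] by auto
  have "weak_conv_m (\<lambda>_. M) steady_law"
    by (rule weak_conv_steady_law[OF rd _ tight]) (auto simp: diffusion_stationary_centred[OF st])
  moreover have "isCont (cdf steady_law) x" for x
    unfolding N.isCont_cdf by (rule measure_steady_law_null) auto
  ultimately have "cdf M = cdf steady_law"
    by (auto simp: weak_conv_m_def weak_conv_def LIMSEQ_const_iff)
  then show ?thesis by (rule cdf_unique[OF rd real_distribution_steady_law])
qed

lemma limit_steady_state_eq: "limit_steady_state lam mu b g = steady_law"
  unfolding limit_steady_state_def
  by (rule the_equality) (rule diffusion_stationary_steady_law, erule diffusion_stationary_unique)

lemma measure_steady_law_upper: "measure steady_law {b..} = mass3 / total_mass"
proof -
  have "has_bochner_integral steady_law (indicator {b..}) (mass3 / total_mass)"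
    by (rule has_bochner_integral_steady_law) (use mass3 in auto)
  from has_bochner_integral_integral_eq[OF this] show ?thesis by simp
qed

lemma has_bochner_integral_steady_law_excess:
  "has_bochner_integral steady_law (\<lambda>x. max 0 (x - b)) (moment3 / total_mass)"
proof (rule has_bochner_integral_steady_law)
  have "(\<lambda>x. max 0 (x - b) * weight_fn x) = (\<lambda>x. indicator {b..} x * ((x - b) * weight_fn x))"
    by (auto split: split_indicator)
  then show "has_bochner_integral lborel (\<lambda>x. max 0 (x - b) * weight_fn x) moment3"
    using moment3 by simp
qed auto

end

section \<open>The network as a Markov chain\<close>

context swapping_network
begin

definition pair_prob :: "'s \<Rightarrow> 's \<Rightarrow> real" where
  "pair_prob i j = (if i = j then 0 else p {i, j})"

lemma pair_prob_nonneg [simp]: "0 \<le> pair_prob i j"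
  using p_nonneg by (simp add: pair_prob_def)

lemma pair_prob_sym: "pair_prob i j = pair_prob j i"
  by (simp add: pair_prob_def insert_commute)

lemma sum_pair_prob_cong: "(\<Sum>j\<in>-{i}. p {i, j} * f j) = (\<Sum>j\<in>UNIV. pair_prob i j * f j)"
proof -
  have "(\<Sum>j\<in>UNIV. pair_prob i j * f j) = (\<Sum>j\<in>-{i}. pair_prob i j * f j)"
    by (rule sum.mono_neutral_right) (auto simp: pair_prob_def)
  then show ?thesis by (auto simp: pair_prob_def intro!: sum.cong)
qed

lemma sum_pair_prob: "(\<Sum>j\<in>UNIV. pair_prob i j) = 2 * weight i"
  using sum_pair_prob_cong[of i "\<lambda>_. 1"] by (simp add: weight_def)

lemma sum_pair_prob_swap: "(\<Sum>i\<in>UNIV. \<Sum>j\<in>UNIV. pair_prob i j * f i j) = (\<Sum>i\<in>UNIV. \<Sum>j\<in>UNIV. pair_prob i j * f j i)"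
  by (subst sum.swap) (simp add: pair_prob_sym)

lemma sum_weight: "(\<Sum>i\<in>UNIV. weight i) = 1"
proof -
  let ?P = "SIGMA i:(UNIV :: 's set). -{i}"
  have "(\<Sum>i\<in>UNIV. \<Sum>j\<in>-{i}. p {i, j}) = (\<Sum>z\<in>?P. p {fst z, snd z})"
    by (simp add: sum.Sigma case_prod_unfold)
  also have "\<dots> = (\<Sum>e\<in>{e. card e = 2}. \<Sum>z\<in>{z\<in>?P. {fst z, snd z} = e}. p {fst z, snd z})"
  proof (rule sum.group[symmetric])
    show "(\<lambda>z. {fst z, snd z}) ` ?P \<subseteq> {e. card e = 2}"
    proof (rule image_subsetI)
      fix z assume "z \<in> ?P"
      then have "fst z \<noteq> snd z" by auto
      then show "{fst z, snd z} \<in> {e. card e = 2}" by simp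
    qed
  qed auto
  also have "\<dots> = (\<Sum>e\<in>{e. card e = 2}. 2 * p e)"
  proof (rule sum.cong[OF refl])
    fix e :: "'s set" assume "e \<in> {e. card e = 2}"
    then obtain a c where e: "e = {a, c}" "a \<noteq> c" by (auto simp: card_2_iff)
    then have "{z\<in>?P. {fst z, snd z} = e} = {(a, c), (c, a)}" by (auto simp: doubleton_eq_iff)
    moreover have "(\<Sum>z\<in>{(a, c), (c, a)}. p {fst z, snd z}) = 2 * p e"
      using e by (simp add: insert_commute)
    ultimately show "(\<Sum>z\<in>{z\<in>?P. {fst z, snd z} = e}. p {fst z, snd z}) = 2 * p e" by simp
  qed
  also have "\<dots> = 2" using p_sum by (simp add: sum_distrib_left[symmetric])
  finally show ?thesis by (simp add: weight_def sum_divide_distrib[symmetric])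
qed

lemma weight_pos [simp]: "0 < weight i"
proof -
  have "\<exists>j. j \<noteq> i"
  proof (rule ccontr)
    assume "\<not> ?thesis"
    then have "UNIV = {i}" by auto
    then have "CARD('s) = card {i}" by (rule arg_cong)
    then show False using stations by simp
  qed
  then obtain j where j: "j \<noteq> i" by blast
  from connected[of i j] obtain k where k: "i \<noteq> k" "0 < p {i, k}"
    by (rule converse_rtranclE) (use j in auto)
  have "0 < (\<Sum>j\<in>-{i}. p {i, j})"
    by (rule sum_pos2[of _ k]) (use k p_nonneg in auto)
  then show ?thesis by (simp add: weight_def)
qed

lemma weight_nonneg [simp]: "0 \<le> weight i" and weight_neq_0 [simp]: "weight i \<noteq> 0"
  using weight_pos[of i] by linarith+

lemma weight_le_1: "weight i \<le> 1"
  using member_le_sum[of i UNIV weight] sum_weight by simp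

definition level :: "('s \<Rightarrow> nat) \<Rightarrow> 's \<Rightarrow> real" where
  "level x i = real (x i) / weight i"

lemma weight_level [simp]: "weight i * level x i = real (x i)"
  by (simp add: level_def)

lemma level_nonneg [simp]: "0 \<le> level x i" by (simp add: level_def)

lemma level_upd: "level (x(i := k)) j = (if j = i then real k / weight i else level x j)"
  by (simp add: level_def)

text \<open>The loss against a random split in \<open>sum_arrival_rate_mono\<close>, for \<open>k\<close> the identity.\<close>

definition spread :: "('s \<Rightarrow> nat) \<Rightarrow> real" where
  "spread x = (\<Sum>i\<in>UNIV. \<Sum>j\<in>UNIV. pair_prob i j * \<bar>level x i - level x j\<bar>) / 4"

lemma spread_nonneg [simp]: "0 \<le> spread x"
  unfolding spread_def by (auto intro!: sum_nonneg divide_nonneg_pos)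

text \<open>A pair \<open>{i, j}\<close> contributes the value of \<open>k\<close> at the lower of its two levels, which is the
  average of both values minus half of their distance. This is the effect of the choice: compared
  with a random split according to the weights, arrivals lower \<open>k\<close> by the spread of its values.\<close>

lemma sum_arrival_rate_mono:
  assumes "mono k"
  shows "(\<Sum>i\<in>UNIV. arrival_rate r i x * k (level x i)) = lam * not_waiting r x *
    ((\<Sum>i\<in>UNIV. weight i * k (level x i)) -
     (\<Sum>i\<in>UNIV. \<Sum>j\<in>UNIV. pair_prob i j * \<bar>k (level x i) - k (level x j)\<bar>) / 4)"
proof -
  define u where "u = level x"
  define t where "t i j = (if u i < u j then 1 else if u i = u j then 1 / 2 else 0 :: real)" for i j
  have a: "arrival_rate r i x = lam * not_waiting r x * (\<Sum>j\<in>UNIV. pair_prob i j * t i j)" for i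
    unfolding arrival_rate_def t_def u_def level_def sum_pair_prob_cong by (rule refl)
  let ?S = "\<Sum>i\<in>UNIV. \<Sum>j\<in>UNIV. pair_prob i j * (t i j * k (u i))"
  \<comment> \<open>the minimum of two values is their average minus half of their distance; ties agree with this\<close>
  have tk: "t i j * k (u i) + t j i * k (u j) = (k (u i) + k (u j)) / 2 - \<bar>k (u i) - k (u j)\<bar> / 2" for i j
    using monoD[OF assms, of "u i" "u j"] monoD[OF assms, of "u j" "u i"]
    by (cases "u i" "u j" rule: linorder_cases) (auto simp: t_def field_simps)
  have "2 * ?S = ?S + (\<Sum>i\<in>UNIV. \<Sum>j\<in>UNIV. pair_prob i j * (t j i * k (u j)))"
    using sum_pair_prob_swap[of "\<lambda>i j. t i j * k (u i)"] by simp
  also have "\<dots> = (\<Sum>i\<in>UNIV. \<Sum>j\<in>UNIV. pair_prob i j * (t i j * k (u i) + t j i * k (u j)))"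
    by (simp add: sum.distrib distrib_left)
  also have "\<dots> = (\<Sum>i\<in>UNIV. \<Sum>j\<in>UNIV. pair_prob i j * k (u i)) / 2 + (\<Sum>i\<in>UNIV. \<Sum>j\<in>UNIV. pair_prob i j * k (u j)) / 2
      - (\<Sum>i\<in>UNIV. \<Sum>j\<in>UNIV. pair_prob i j * \<bar>k (u i) - k (u j)\<bar>) / 2"
    unfolding tk by (simp add: algebra_simps sum.distrib sum_subtractf sum_divide_distrib add_divide_distrib diff_divide_distrib)
  also have "(\<Sum>i\<in>UNIV. \<Sum>j\<in>UNIV. pair_prob i j * k (u j)) = (\<Sum>i\<in>UNIV. \<Sum>j\<in>UNIV. pair_prob i j * k (u i))"
    using sum_pair_prob_swap[of "\<lambda>i j. k (u i)"] by simp
  also have "(\<Sum>i\<in>UNIV. \<Sum>j\<in>UNIV. pair_prob i j * k (u i)) = 2 * (\<Sum>i\<in>UNIV. weight i * k (u i))"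
    by (simp add: sum_distrib_right[symmetric] sum_pair_prob sum_distrib_left mult.assoc)
  finally have S: "?S = (\<Sum>i\<in>UNIV. weight i * k (u i)) - (\<Sum>i\<in>UNIV. \<Sum>j\<in>UNIV. pair_prob i j * \<bar>k (u i) - k (u j)\<bar>) / 4"
    by simp
  have "(\<Sum>i\<in>UNIV. arrival_rate r i x * k (u i)) = lam * not_waiting r x * ?S"
    by (simp add: a sum_distrib_left sum_distrib_right mult.assoc)
  then show ?thesis unfolding S by (simp add: u_def)
qed

lemma not_waiting_nonneg [simp]: "0 \<le> not_waiting r x" by (simp add: not_waiting_def)

lemma arrival_rate_nonneg [simp]: "0 \<le> arrival_rate r i x"
  unfolding arrival_rate_def using rates p_nonneg
  by (intro mult_nonneg_nonneg sum_nonneg) auto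

lemma sum_arrival_rate: "(\<Sum>i\<in>UNIV. arrival_rate r i x) = lam * not_waiting r x"
  using sum_arrival_rate_mono[of "\<lambda>_. 1" r x] by (simp add: mono_def sum_weight)

lemma sum_arrival_rate_level:
  "(\<Sum>i\<in>UNIV. arrival_rate r i x * level x i) = lam * not_waiting r x * ((\<Sum>i\<in>UNIV. real (x i)) - spread x)"
  using sum_arrival_rate_mono[of "\<lambda>u. u" r x] by (simp add: mono_def spread_def)

lemma sum_arrival_rate_mono_le:
  assumes "mono k"
  shows "(\<Sum>i\<in>UNIV. arrival_rate r i x * k (level x i)) \<le> lam * not_waiting r x * (\<Sum>i\<in>UNIV. weight i * k (level x i))"
  unfolding sum_arrival_rate_mono[OF assms] using rates
  by (intro mult_left_mono) (auto intro!: sum_nonneg divide_nonneg_pos)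

text \<open>The spread bounds the level differences along the edges; along a path they add up, and the
  graph is connected.\<close>

lemma level_diff_le_spread: "\<exists>C\<ge>0. \<forall>x i j. \<bar>level x i - level x j\<bar> \<le> C * spread x"
proof -
  have edge: "\<bar>level x i - level x j\<bar> \<le> 4 / p {i, j} * spread x" if "i \<noteq> j" "0 < p {i, j}" for x i j
  proof -
    have "pair_prob i j * \<bar>level x i - level x j\<bar> \<le> (\<Sum>j\<in>UNIV. pair_prob i j * \<bar>level x i - level x j\<bar>)"
      by (rule member_le_sum) auto
    also have "\<dots> \<le> (\<Sum>i\<in>UNIV. \<Sum>j\<in>UNIV. pair_prob i j * \<bar>level x i - level x j\<bar>)"
      by (rule member_le_sum[of i UNIV "\<lambda>i. \<Sum>j\<in>UNIV. pair_prob i j * \<bar>level x i - level x j\<bar>"]) (auto intro!: sum_nonneg)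
    finally show ?thesis using that by (simp add: spread_def pair_prob_def field_simps)
  qed
  have "\<exists>C\<ge>0. \<forall>x. \<bar>level x i - level x j\<bar> \<le> C * spread x" for i j
    using connected[of i j]
  proof (induction rule: rtrancl_induct)
    case base
    show ?case by (intro exI[of _ 0]) auto
  next
    case (step j k)
    then obtain C where C: "0 \<le> C" "\<And>x. \<bar>level x i - level x j\<bar> \<le> C * spread x" by auto
    have jk: "j \<noteq> k" "0 < p {j, k}" using step by auto
    have "\<bar>level x i - level x k\<bar> \<le> (C + 4 / p {j, k}) * spread x" for x
      using C(2)[of x] edge[OF jk, of x] by (simp add: distrib_right)
    then show ?case using C jk by (intro exI[of _ "C + 4 / p {j, k}"]) auto
  qed
  then obtain C where C: "\<And>i j. 0 \<le> C i j" "\<And>i j x. \<bar>level x i - level x j\<bar> \<le> C i j * spread x" by metis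
  have "C i j \<le> (\<Sum>i\<in>UNIV. \<Sum>j\<in>UNIV. C i j)" for i j
    using C(1) member_le_sum[of j UNIV "C i"] member_le_sum[of i UNIV "\<lambda>i. \<Sum>j\<in>UNIV. C i j"]
    by (meson finite UNIV_I order_trans sum_nonneg)
  then have "\<bar>level x i - level x j\<bar> \<le> (\<Sum>i\<in>UNIV. \<Sum>j\<in>UNIV. C i j) * spread x" for x i j
    using C(2)[of x i j] by (meson mult_right_mono order_trans spread_nonneg)
  moreover have "0 \<le> (\<Sum>i\<in>UNIV. \<Sum>j\<in>UNIV. C i j)" using C(1) by (intro sum_nonneg) auto
  ultimately show ?thesis by blast
qed

definition total :: "('s \<Rightarrow> nat) \<Rightarrow> real" where "total x = (\<Sum>i\<in>UNIV. real (x i))"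

lemma level_total_diff_le_spread: "\<exists>C\<ge>0. \<forall>x i. \<bar>level x i - total x\<bar> \<le> C * spread x"
proof -
  obtain C where C: "0 \<le> C" "\<And>x i j. \<bar>level x i - level x j\<bar> \<le> C * spread x"
    using level_diff_le_spread by blast
  have "\<bar>level x i - total x\<bar> \<le> C * spread x" for x i
  proof -
    have "level x i - total x = (\<Sum>j\<in>UNIV. weight j * (level x i - level x j))"
      by (simp add: total_def right_diff_distrib sum_subtractf sum_distrib_right[symmetric] sum_weight)
    also have "\<bar>\<dots>\<bar> \<le> (\<Sum>j\<in>UNIV. weight j * (C * spread x))"
      by (rule order_trans[OF sum_abs sum_mono]) (auto simp: abs_mult intro!: mult_left_mono C)
    also have "\<dots> = C * spread x" by (simp add: sum_distrib_right[symmetric] sum_weight)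
    finally show ?thesis .
  qed
  then show ?thesis using C(1) by blast
qed

definition offered :: "nat \<Rightarrow> real" where "offered r = lam * real r / mu"
definition scale :: "nat \<Rightarrow> real" where "scale r = sqrt (offered r)"
definition cap :: "nat \<Rightarrow> real" where "cap r = offered r + g * scale r"
definition excess :: "nat \<Rightarrow> ('s \<Rightarrow> nat) \<Rightarrow> real" where
  "excess r x = (\<Sum>j\<in>UNIV. max 0 (real (x j) - spares r j))"

text \<open>The stations have a positive number of spares and charging points from some \<open>r\<close> on only, since
  \<open>b\<close> and \<open>g\<close> may be negative.\<close>

definition large :: "nat \<Rightarrow> bool" where "large r \<longleftrightarrow> 1 \<le> scale r \<and> 0 < cap r"

text \<open>The waiting vehicles cannot outnumber all vehicles by more than one. The additional one is
  possible because the number of spares need not be an integer.\<close>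

definition feasible :: "nat \<Rightarrow> ('s \<Rightarrow> nat) set" where "feasible r = {x. excess r x \<le> real r + 1}"

lemma chargers_eq: "chargers r i = weight i * cap r"
  by (simp add: chargers_def cap_def scale_def offered_def)

lemma spares_eq: "spares r i = weight i * (offered r + b * scale r)"
  by (simp add: spares_def scale_def offered_def)

lemma offered_nonneg [simp]: "0 \<le> offered r" using rates by (simp add: offered_def)
lemma scale_nonneg [simp]: "0 \<le> scale r" by (simp add: scale_def)
lemma scale_square: "scale r * scale r = offered r" by (simp add: scale_def)

lemma charge_rate_eq: "charge_rate r i x = mu * weight i * min (level x i) (cap r)"
proof -
  have "min (weight i * level x i) (weight i * cap r) = weight i * min (level x i) (cap r)"
    by (simp add: min_mult_distrib_left)
  then show ?thesis unfolding charge_rate_def chargers_eq weight_level by (simp add: mult.assoc)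
qed

lemma excess_eq: "excess r x = (\<Sum>j\<in>UNIV. weight j * max 0 (level x j - (offered r + b * scale r)))"
  unfolding excess_def spares_eq
  by (intro sum.cong refl) (simp add: max_mult_distrib_left right_diff_distrib)

lemma not_waiting_eq: "not_waiting r x = max 0 (real r - excess r x)"
  by (simp add: not_waiting_def excess_def)

lemma excess_nonneg [simp]: "0 \<le> excess r x"
  unfolding excess_def by (intro sum_nonneg) auto

definition generator :: "nat \<Rightarrow> (('s \<Rightarrow> nat) \<Rightarrow> real) \<Rightarrow> ('s \<Rightarrow> nat) \<Rightarrow> real" where
  "generator r f x = (\<Sum>i\<in>UNIV. arrival_rate r i x * (f (x(i := x i + 1)) - f x) +
     charge_rate r i x * (f (x(i := x i - 1)) - f x))"

lemma finite_feasible: "finite (feasible r)"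
proof -
  define N where "N = (\<Sum>i\<in>UNIV. nat \<lceil>spares r i + real r + 1\<rceil>)"
  have "x i \<le> N" if "x \<in> feasible r" for x i
  proof -
    have "max 0 (real (x i) - spares r i) \<le> excess r x"
      unfolding excess_def by (rule member_le_sum) auto
    then have "real (x i) \<le> spares r i + real r + 1" using that by (simp add: feasible_def)
    then have "x i \<le> nat \<lceil>spares r i + real r + 1\<rceil>" by linarith
    also have "\<dots> \<le> N" unfolding N_def by (rule member_le_sum) auto
    finally show ?thesis .
  qed
  then have "feasible r \<subseteq> PiE UNIV (\<lambda>_. {..N})" by (auto simp: PiE_def Pi_def)
  then show ?thesis by (rule finite_subset) (intro finite_PiE; simp)
qed

definition neighbours :: "('s \<Rightarrow> nat) \<Rightarrow> ('s \<Rightarrow> nat) set" where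
  "neighbours x = range (\<lambda>i. x(i := x i + 1)) \<union> range (\<lambda>i. x(i := x i - 1))"

lemma finite_neighbours: "finite (neighbours x)" by (simp add: neighbours_def)

lemma trans_rate_neighbours: "y \<notin> neighbours x \<Longrightarrow> trans_rate r x y = 0"
  unfolding trans_rate_def neighbours_def by (intro sum.neutral) auto

lemma trans_rate_self: "trans_rate r x x = 0"
proof -
  have up: "(x = x(i := x i + 1)) = False" and down: "(0 < x i \<and> x = x(i := x i - 1)) = False" for i
    by (auto simp: fun_eq_iff intro!: exI[of _ i])
  show ?thesis unfolding trans_rate_def up down by simp
qed

context
  fixes r :: nat
  assumes large: "large r"
begin

lemma cap_pos: "0 < cap r" and scale_ge_1: "1 \<le> scale r"
  using large by (auto simp: large_def)

lemma spares_pos: "0 < spares r i"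
proof -
  have "g * scale r \<le> b * scale r" using g_le_b by (intro mult_right_mono) auto
  then show ?thesis using cap_pos unfolding spares_eq cap_def by (intro mult_pos_pos) auto
qed

lemma chargers_pos: "0 < chargers r i" using cap_pos by (simp add: chargers_eq)

lemma chargers_le_spares: "chargers r i \<le> spares r i"
  unfolding chargers_eq spares_eq cap_def using g_le_b
  by (intro mult_left_mono add_left_mono mult_right_mono) auto

lemma charge_rate_nonneg: "0 \<le> charge_rate r i x"
  unfolding charge_rate_def using rates chargers_pos[of i] by simp

lemma charge_rate_pos: "0 < x i \<Longrightarrow> 0 < charge_rate r i x"
  unfolding charge_rate_def using rates chargers_pos[of i] by simp

lemma charge_rate_0: "x i = 0 \<Longrightarrow> charge_rate r i x = 0"
  unfolding charge_rate_def using chargers_pos[of i] by simp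

lemma trans_rate_nonneg: "0 \<le> trans_rate r x y"
  unfolding trans_rate_def using charge_rate_nonneg by (intro sum_nonneg) auto

text \<open>An arrival raises the excess by at most one, so it leaves the set only from an excess above \<open>r\<close>,
  where no vehicle is left that could arrive.\<close>

lemma up_feasible:
  assumes "x \<in> feasible r" "x(i := x i + 1) \<notin> feasible r"
  shows "arrival_rate r i x = 0"
proof -
  have "excess r (x(i := x i + 1)) \<le> excess r x + (\<Sum>j\<in>UNIV. if j = i then 1 else 0)"
    unfolding excess_def sum.distrib[symmetric] by (intro sum_mono) auto
  then have "real r < excess r x" using assms(2) by (simp add: feasible_def)
  then show ?thesis by (simp add: arrival_rate_def not_waiting_eq)
qed

lemma down_feasible: "x \<in> feasible r \<Longrightarrow> x(i := x i - 1) \<in> feasible r"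
proof -
  have "excess r (x(i := x i - 1)) \<le> excess r x"
    unfolding excess_def by (intro sum_mono) auto
  then show "x \<in> feasible r \<Longrightarrow> x(i := x i - 1) \<in> feasible r" by (simp add: feasible_def)
qed

lemma zero_feasible: "(\<lambda>_. 0) \<in> feasible r"
  using spares_pos by (auto simp: feasible_def excess_def less_imp_le max_def not_le intro!: order_trans[OF sum_nonpos])

lemma trans_rate_closed:
  assumes "x \<in> feasible r" "y \<notin> feasible r"
  shows "trans_rate r x y = 0"
proof -
  have up: "(if y = x(i := x i + 1) then arrival_rate r i x else 0) = 0" for i
    using assms(2) up_feasible[OF assms(1), of i] by (cases "y = x(i := x i + 1)") auto
  have down: "(0 < x i \<and> y = x(i := x i - 1)) = False" for i
    using assms(2) down_feasible[OF assms(1), of i] by auto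
  show ?thesis unfolding trans_rate_def up down by simp
qed

lemma sum_trans_rate:
  assumes x: "\<And>i. x(i := x i + 1) \<in> T \<or> arrival_rate r i x = 0" "\<And>i. x(i := x i - 1) \<in> T" and T: "finite T"
  shows "(\<Sum>y\<in>T. trans_rate r x y * h y) = (\<Sum>i\<in>UNIV. arrival_rate r i x * h (x(i := x i + 1)) + charge_rate r i x * h (x(i := x i - 1)))"
proof -
  have "(\<Sum>y\<in>T. trans_rate r x y * h y) = (\<Sum>i\<in>UNIV. \<Sum>y\<in>T.
      (if y = x(i := x i + 1) then arrival_rate r i x * h (x(i := x i + 1)) else 0) +
      (if y = x(i := x i - 1) then charge_rate r i x * h (x(i := x i - 1)) else 0))"
    unfolding trans_rate_def sum_distrib_right
    by (subst sum.swap) (intro sum.cong refl, auto simp: charge_rate_0 distrib_right)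
  also have "\<dots> = (\<Sum>i\<in>UNIV. arrival_rate r i x * h (x(i := x i + 1)) + charge_rate r i x * h (x(i := x i - 1)))"
    using x T by (intro sum.cong refl) (auto simp: sum.distrib)
  finally show ?thesis .
qed

lemma sum_charge_rate: "(\<Sum>i\<in>UNIV. charge_rate r i x) \<le> mu * cap r"
proof -
  have "(\<Sum>i\<in>UNIV. charge_rate r i x) \<le> (\<Sum>i\<in>UNIV. mu * cap r * weight i)"
    unfolding charge_rate_eq using rates by (intro sum_mono) (auto simp: mult_ac intro!: mult_left_mono)
  then show ?thesis by (simp add: sum_distrib_left[symmetric] sum_weight)
qed

lemma exit_rate_trans_rate: "exit_rate (trans_rate r) x = (\<Sum>i\<in>UNIV. arrival_rate r i x + charge_rate r i x)"
proof -
  have "exit_rate (trans_rate r) x = (\<Sum>y\<in>neighbours x - {x}. trans_rate r x y)"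
    by (rule exit_rate_finite[OF finite_neighbours trans_rate_neighbours])
  also have "\<dots> = (\<Sum>y\<in>neighbours x. trans_rate r x y)"
    by (intro sum.mono_neutral_left finite_neighbours) (auto simp: trans_rate_self)
  also have "\<dots> = (\<Sum>i\<in>UNIV. arrival_rate r i x + charge_rate r i x)"
    using sum_trans_rate[of x "neighbours x" "\<lambda>_. 1"] finite_neighbours by (auto simp: neighbours_def)
  finally show ?thesis .
qed

lemma exit_rate_le: "exit_rate (trans_rate r) x \<le> lam * real r + mu * cap r"
proof -
  have "not_waiting r x \<le> real r" by (simp add: not_waiting_eq)
  then have "lam * not_waiting r x \<le> lam * real r" using rates by (intro mult_left_mono) auto
  then show ?thesis using sum_charge_rate[of x]
    by (simp add: exit_rate_trans_rate sum.distrib sum_arrival_rate)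
qed

lemma trans_rate_down_pos:
  assumes "0 < x i" shows "0 < trans_rate r x (x(i := x i - 1))"
  unfolding trans_rate_def
  by (rule sum_pos2[of _ i]) (use assms charge_rate_pos[of x i] charge_rate_nonneg in \<open>auto intro!: add_nonneg_pos add_nonneg_nonneg\<close>)

lemma reaches_zero: "(x, \<lambda>_. 0) \<in> {(x, y). x \<noteq> y \<and> 0 < trans_rate r x y}\<^sup>*"
proof (induction "\<Sum>i\<in>UNIV. x i" arbitrary: x rule: less_induct)
  case less
  show ?case
  proof (cases "\<exists>i. 0 < x i")
    case True
    then obtain i where i: "0 < x i" by blast
    have "(\<Sum>j\<in>UNIV. (x(i := x i - 1)) j) < (\<Sum>j\<in>UNIV. x j)"
      by (rule sum_strict_mono_ex1) (use i in auto)
    from less[OF this] have "(x(i := x i - 1), \<lambda>_. 0) \<in> {(x, y). x \<noteq> y \<and> 0 < trans_rate r x y}\<^sup>*" .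
    moreover have "x \<noteq> x(i := x i - 1)" using i by (auto simp: fun_eq_iff intro!: exI[of _ i])
    ultimately show ?thesis using trans_rate_down_pos[of x i, OF i]
      by (intro converse_rtrancl_into_rtrancl[of x "x(i := x i - 1)"]) auto
  next
    case False
    then have "x = (\<lambda>_. 0)" by auto
    then show ?thesis by simp
  qed
qed

text \<open>Existence holds on the finite closed set of feasible states, uniqueness among all
  distributions, because every state can be emptied.\<close>

lemma steady_state: "stationary_pmf (trans_rate r) (steady_state r)" "set_pmf (steady_state r) \<subseteq> feasible r"
proof -
  obtain \<pi> where \<pi>: "stationary_pmf (trans_rate r) \<pi>" "set_pmf \<pi> \<subseteq> feasible r"
    using stationary_pmf_exists[where q = "trans_rate r" and S = "feasible r", OF finite_feasible _ trans_rate_nonneg trans_rate_closed]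
      zero_feasible by blast
  have "finite {y. trans_rate r x y \<noteq> 0}" for x
    by (rule finite_subset[OF _ finite_neighbours[of x]]) (use trans_rate_neighbours in blast)
  then have "\<pi>' = \<pi>" if "stationary_pmf (trans_rate r) \<pi>'" for \<pi>'
    using stationary_pmf_unique[OF that \<pi>(1) trans_rate_nonneg _ exit_rate_le reaches_zero] by blast
  then have "steady_state r = \<pi>" unfolding steady_state_def using \<pi>(1) by blast
  then show "stationary_pmf (trans_rate r) (steady_state r)" "set_pmf (steady_state r) \<subseteq> feasible r"
    using \<pi> by auto
qed

text \<open>The only property of the steady state used below, for varying \<open>f\<close>.\<close>

lemma expectation_generator: "measure_pmf.expectation (steady_state r) (generator r f) = 0"
proof -
  have "measure_pmf.expectation (steady_state r) (generator r f)
      = measure_pmf.expectation (steady_state r) (\<lambda>x. \<Sum>y\<in>feasible r. trans_rate r x y * (f y - f x))"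
  proof (intro integral_cong_AE)
    show "AE x in measure_pmf (steady_state r). generator r f x = (\<Sum>y\<in>feasible r. trans_rate r x y * (f y - f x))"
      unfolding AE_measure_pmf_iff
    proof
      fix x assume "x \<in> set_pmf (steady_state r)"
      then have x: "x \<in> feasible r" using steady_state(2) by blast
      show "generator r f x = (\<Sum>y\<in>feasible r. trans_rate r x y * (f y - f x))"
        using up_feasible[OF x] down_feasible[OF x] finite_feasible
        by (subst sum_trans_rate) (auto simp: generator_def)
    qed
  qed auto
  then show ?thesis
    using stationary_expectation_generator[OF steady_state(1) finite_feasible steady_state(2) trans_rate_closed] by simp
qed

lemma integrable_steady_state [simp, intro]: "integrable (measure_pmf (steady_state r)) (f :: _ \<Rightarrow> real)"
  by (rule integrable_measure_pmf_finite) (rule finite_subset[OF steady_state(2) finite_feasible])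

lemma expectation_mono:
  "(\<And>x. x \<in> feasible r \<Longrightarrow> f x \<le> h x) \<Longrightarrow>
    measure_pmf.expectation (steady_state r) f \<le> measure_pmf.expectation (steady_state r) (h :: _ \<Rightarrow> real)"
  using steady_state(2) by (intro integral_mono_AE) (auto simp: AE_measure_pmf_iff)

end

end

section \<open>Moment bounds in steady state\<close>

context swapping_network
begin

abbreviation mean :: "nat \<Rightarrow> (('s \<Rightarrow> nat) \<Rightarrow> real) \<Rightarrow> real" where
  "mean r f \<equiv> measure_pmf.expectation (steady_state r) f"

definition inv_weight :: real where "inv_weight = (\<Sum>i\<in>UNIV. 1 / weight i)"

lemma inv_weight_ge: "1 / weight i \<le> inv_weight"
  unfolding inv_weight_def by (rule member_le_sum) auto

lemma inv_weight_pos: "0 < inv_weight"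
  using inv_weight_ge[of undefined] weight_pos[of undefined] by (meson less_le_trans zero_less_divide_1_iff)

lemma weight_inv_weight: "1 \<le> weight i * inv_weight"
  using mult_left_mono[OF inv_weight_ge[of i], of "weight i"] by simp

definition rate_const :: real where "rate_const = mu * (2 + \<bar>g\<bar>)"

lemma rate_const_pos: "0 < rate_const" using rates by (simp add: rate_const_def add_pos_nonneg)

text \<open>Chosen such that the waiting vehicles at one station of level beyond \<open>offered + tail_start * scale\<close>
  suffice to bring the arrival rate below the capacity, however small the weight of the station.\<close>

definition tail_start :: real where
  "tail_start = max g (b + (1 + mu * \<bar>g\<bar> / lam) * inv_weight)"

lemma tail_start_ge: "b \<le> tail_start" "g \<le> tail_start"
  using rates inv_weight_pos by (auto simp: tail_start_def le_max_iff_disj)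

definition overflow :: "nat \<Rightarrow> real \<Rightarrow> real" where
  "overflow r u = max 0 (u - (offered r + tail_start * scale r))"

lemma overflow_nonneg [simp]: "0 \<le> overflow r u" by (simp add: overflow_def)

lemma mono_overflow: "mono (overflow r)" by (auto simp: mono_def overflow_def)

text \<open>The positive part squared has second derivative at most \<open>2\<close>.\<close>

lemma overflow_square_step: "(overflow r (u + h))\<^sup>2 \<le> (overflow r u)\<^sup>2 + 2 * h * overflow r u + h\<^sup>2"
proof -
  have "\<bar>overflow r (u + h)\<bar> \<le> \<bar>overflow r u + h\<bar>" by (auto simp: overflow_def)
  then have "(overflow r (u + h))\<^sup>2 \<le> (overflow r u + h)\<^sup>2" unfolding abs_le_square_iff .
  then show ?thesis by (simp add: power2_sum mult_ac)
qed

lemma offered_rate: "mu * offered r = lam * real r" using rates by (simp add: offered_def)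

lemma sum_weight_mono:
  assumes "\<And>i. f i \<le> c" shows "(\<Sum>i\<in>UNIV. weight i * f i) \<le> c"
proof -
  have "(\<Sum>i\<in>UNIV. weight i * f i) \<le> (\<Sum>i\<in>UNIV. weight i * c)"
    using assms by (intro sum_mono mult_left_mono) auto
  then show ?thesis by (simp add: sum_distrib_right[symmetric] sum_weight)
qed

lemma sum_weight_square_le: "(\<Sum>i\<in>UNIV. weight i * f i)\<^sup>2 \<le> (\<Sum>i\<in>UNIV. weight i * (f i)\<^sup>2)"
proof -
  define m where "m = (\<Sum>i\<in>UNIV. weight i * f i)"
  have "0 \<le> (\<Sum>i\<in>UNIV. weight i * (f i - m)\<^sup>2)" by (intro sum_nonneg) auto
  also have "\<dots> = (\<Sum>i\<in>UNIV. (weight i * (f i)\<^sup>2 - 2 * m * (weight i * f i)) + m\<^sup>2 * weight i)"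
    by (intro sum.cong refl) (simp add: power2_diff algebra_simps)
  also have "\<dots> = (\<Sum>i\<in>UNIV. weight i * (f i)\<^sup>2) - 2 * m * (\<Sum>i\<in>UNIV. weight i * f i) + m\<^sup>2 * (\<Sum>i\<in>UNIV. weight i)"
    by (simp only: sum.distrib sum_subtractf sum_distrib_left)
  finally show ?thesis by (simp add: sum_weight m_def power2_eq_square)
qed

context
  fixes r :: nat
  assumes large: "large r"
begin

lemma scale_le_offered: "scale r \<le> offered r" and offered_ge_1: "1 \<le> offered r"
proof -
  have "1 * scale r \<le> scale r * scale r" using scale_ge_1[OF large] by (intro mult_right_mono) auto
  then show "scale r \<le> offered r" by (simp add: scale_square)
  then show "1 \<le> offered r" using scale_ge_1[OF large] by simp
qed

lemma cap_le: "cap r \<le> (1 + \<bar>g\<bar>) * offered r"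
proof -
  have "g * scale r \<le> \<bar>g\<bar> * scale r" by (intro mult_right_mono) auto
  also have "\<dots> \<le> \<bar>g\<bar> * offered r" by (intro mult_left_mono scale_le_offered) auto
  finally show ?thesis by (simp add: cap_def distrib_right)
qed

lemma total_rate_le:
  "(\<Sum>i\<in>UNIV. arrival_rate r i x) + (\<Sum>i\<in>UNIV. charge_rate r i x) \<le> rate_const * offered r"
proof -
  have "exit_rate (trans_rate r) x \<le> lam * real r + mu * cap r" by (rule exit_rate_le[OF large])
  moreover have "mu * cap r \<le> mu * ((1 + \<bar>g\<bar>) * offered r)"
    using rates by (intro mult_left_mono cap_le) auto
  ultimately show ?thesis
    by (simp add: exit_rate_trans_rate[OF large] sum.distrib rate_const_def offered_rate[symmetric] algebra_simps)
qed

lemma weighted_rate_le: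
  "(\<Sum>i\<in>UNIV. (arrival_rate r i x + charge_rate r i x) / weight i) \<le> inv_weight * rate_const * offered r"
proof -
  have "(\<Sum>i\<in>UNIV. (arrival_rate r i x + charge_rate r i x) / weight i)
      \<le> (\<Sum>i\<in>UNIV. inv_weight * (arrival_rate r i x + charge_rate r i x))"
  proof (rule sum_mono)
    fix i
    have "(arrival_rate r i x + charge_rate r i x) * (1 / weight i) \<le> (arrival_rate r i x + charge_rate r i x) * inv_weight"
      using charge_rate_nonneg[OF large] by (intro mult_left_mono inv_weight_ge add_nonneg_nonneg) auto
    then show "(arrival_rate r i x + charge_rate r i x) / weight i \<le> inv_weight * (arrival_rate r i x + charge_rate r i x)"
      by (simp add: mult.commute)
  qed
  also have "\<dots> = inv_weight * ((\<Sum>i\<in>UNIV. arrival_rate r i x) + (\<Sum>i\<in>UNIV. charge_rate r i x))"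
    by (simp add: sum_distrib_left sum.distrib distrib_left)
  also have "\<dots> \<le> inv_weight * (rate_const * offered r)"
    using inv_weight_pos by (intro mult_left_mono total_rate_le) auto
  finally show ?thesis by (simp add: mult.assoc)
qed

text \<open>A feasible state exceeds the number of vehicles by at most one, so the truncation in
  \<open>not_waiting\<close> costs at most \<open>lam\<close>.\<close>

lemma lam_not_waiting_bounds:
  assumes "x \<in> feasible r"
  shows "lam * (real r - excess r x) \<le> lam * not_waiting r x"
    "lam * not_waiting r x \<le> lam * (real r - excess r x) + lam"
    "lam * not_waiting r x \<le> mu * offered r"
proof -
  have 1: "real r - excess r x \<le> not_waiting r x" "not_waiting r x \<le> (real r - excess r x) + 1" "not_waiting r x \<le> real r"
    using assms by (auto simp: not_waiting_eq feasible_def)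
  show "lam * (real r - excess r x) \<le> lam * not_waiting r x" using 1 rates by (intro mult_left_mono) auto
  show "lam * not_waiting r x \<le> lam * (real r - excess r x) + lam"
    using mult_left_mono[OF 1(2), of lam] rates by (simp add: distrib_left)
  show "lam * not_waiting r x \<le> mu * offered r"
    unfolding offered_rate using 1 rates by (intro mult_left_mono) auto
qed

text \<open>The vehicles waiting at \<open>i\<close> alone reduce the arrival rate by \<open>lam * weight i\<close> times the height
  of its level above that of the spares. By the choice of \<open>tail_start\<close>, the part up to the threshold already compensates the
  difference between capacity and offered load, and the overflow comes on top.\<close>

lemma overload_drift:
  assumes "x \<in> feasible r" and u: "0 < overflow r (level x i)"
  shows "lam * not_waiting r x - mu * cap r \<le> - lam * weight i * overflow r (level x i)"
proof -
  let ?k = "overflow r (level x i)"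
  have "weight i * max 0 (level x i - (offered r + b * scale r)) \<le> excess r x"
    unfolding excess_eq by (rule member_le_sum) auto
  moreover have "weight i * (level x i - (offered r + b * scale r)) \<le> weight i * max 0 (level x i - (offered r + b * scale r))"
    by (intro mult_left_mono) auto
  moreover have "level x i - (offered r + b * scale r) = ?k + (tail_start - b) * scale r"
    using u by (simp add: overflow_def algebra_simps max_def split: if_splits)
  ultimately have e: "weight i * ?k + weight i * ((tail_start - b) * scale r) \<le> excess r x"
    by (simp add: distrib_left)
  have "(1 + mu * \<bar>g\<bar> / lam) * 1 \<le> (1 + mu * \<bar>g\<bar> / lam) * (weight i * inv_weight)"
    using rates by (intro mult_left_mono weight_inv_weight) auto
  also have "\<dots> \<le> weight i * (tail_start - b)"
    using mult_left_mono[of "(1 + mu * \<bar>g\<bar> / lam) * inv_weight" "tail_start - b" "weight i"]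
    by (simp add: tail_start_def mult_ac)
  finally have "lam * ((1 + mu * \<bar>g\<bar> / lam) * scale r) \<le> lam * (weight i * (tail_start - b) * scale r)"
    using rates by (intro mult_left_mono mult_right_mono) auto
  then have 1: "lam * scale r + mu * \<bar>g\<bar> * scale r \<le> lam * (weight i * ((tail_start - b) * scale r))"
  proof -
    have "lam * ((1 + mu * \<bar>g\<bar> / lam) * scale r) = lam * scale r + mu * \<bar>g\<bar> * scale r"
      using rates by (simp add: distrib_right distrib_left)
    moreover have "lam * (weight i * (tail_start - b) * scale r) = lam * (weight i * ((tail_start - b) * scale r))"
      by (simp add: mult.assoc)
    ultimately show ?thesis using \<open>lam * ((1 + mu * \<bar>g\<bar> / lam) * scale r) \<le> lam * (weight i * (tail_start - b) * scale r)\<close> by linarith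
  qed
  have 2: "lam \<le> lam * scale r" using scale_ge_1[OF large] rates by simp
  have "- g * scale r \<le> \<bar>g\<bar> * scale r" by (intro mult_right_mono) auto
  then have 3: "- (mu * g * scale r) \<le> mu * \<bar>g\<bar> * scale r"
    using mult_left_mono[of "- g * scale r" "\<bar>g\<bar> * scale r" mu] rates by (simp add: mult.assoc)
  have 4: "lam * (weight i * ?k) + lam * (weight i * ((tail_start - b) * scale r)) \<le> lam * excess r x"
    using mult_left_mono[OF e, of lam] rates by (simp add: distrib_left)
  have 5: "mu * cap r = lam * real r + mu * g * scale r"
    by (simp add: cap_def distrib_left offered_rate)
  have 6: "- lam * weight i * ?k = - (lam * (weight i * ?k))" by simp
  show ?thesis using lam_not_waiting_bounds(2)[OF assms(1)] 1 2 3 4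
    unfolding 5 6 right_diff_distrib by linarith
qed

text \<open>The Lyapunov function is the weighted sum of the squared overflows. Arrivals see at most the
  weighted average of the overflows, as they prefer low levels, and all charging points of a
  station with overflow are busy; \<open>overload_drift\<close> does the rest.\<close>

lemma mean_overflow_square:
  "mean r (\<lambda>x. \<Sum>i\<in>UNIV. (weight i * overflow r (level x i))\<^sup>2) \<le> inv_weight * rate_const / (2 * lam) * offered r"
proof -
  let ?f = "\<lambda>x. \<Sum>i\<in>UNIV. weight i * (overflow r (level x i))\<^sup>2"
  have step: "?f (x(i := k)) - ?f x = weight i * (overflow r (real k / weight i))\<^sup>2 - weight i * (overflow r (level x i))\<^sup>2" for x i k
  proof -
    have "?f (x(i := k)) - ?f x = (\<Sum>j\<in>UNIV. if j = i then weight i * (overflow r (real k / weight i))\<^sup>2 - weight i * (overflow r (level x i))\<^sup>2 else 0)"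
      unfolding sum_subtractf[symmetric] by (intro sum.cong) (auto simp: level_upd)
    then show ?thesis by simp
  qed
  have "generator r ?f x \<le> - 2 * lam * (\<Sum>i\<in>UNIV. (weight i * overflow r (level x i))\<^sup>2) + inv_weight * rate_const * offered r"
    if x: "x \<in> feasible r" for x
  proof -
    let ?k = "\<lambda>i. overflow r (level x i)"
    have up: "?f (x(i := x i + 1)) - ?f x \<le> 2 * ?k i + 1 / weight i" for i
    proof -
      have "weight i * (overflow r (level x i + 1 / weight i))\<^sup>2 \<le> weight i * ((?k i)\<^sup>2 + 2 * (1 / weight i) * ?k i + (1 / weight i)\<^sup>2)"
        by (intro mult_left_mono overflow_square_step) auto
      also have "\<dots> = weight i * (?k i)\<^sup>2 + 2 * ?k i + 1 / weight i" by (simp add: distrib_left power2_eq_square)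
      finally have "weight i * (overflow r (level x i + 1 / weight i))\<^sup>2 \<le> weight i * (?k i)\<^sup>2 + 2 * ?k i + 1 / weight i" .
      note A = this
      have B: "real (x i + 1) / weight i = level x i + 1 / weight i" by (simp add: level_def add_divide_distrib)
      show ?thesis unfolding step B using A by linarith
    qed
    have down: "charge_rate r i x * (?f (x(i := x i - 1)) - ?f x) \<le> charge_rate r i x * (- 2 * ?k i + 1 / weight i)" for i
    proof (cases "x i = 0")
      case True
      then show ?thesis by (simp add: charge_rate_0[OF large])
    next
      case False
      have "weight i * (overflow r (level x i + - 1 / weight i))\<^sup>2 \<le> weight i * ((?k i)\<^sup>2 + 2 * (- 1 / weight i) * ?k i + (- 1 / weight i)\<^sup>2)"
        by (intro mult_left_mono overflow_square_step) auto
      also have "\<dots> = weight i * (?k i)\<^sup>2 - 2 * ?k i + 1 / weight i" by (simp add: distrib_left right_diff_distrib power2_eq_square)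
      finally have "weight i * (overflow r (level x i + - 1 / weight i))\<^sup>2 \<le> weight i * (?k i)\<^sup>2 - 2 * ?k i + 1 / weight i" .
      note A = this
      have B: "real (x i - 1) / weight i = level x i + - 1 / weight i"
        using False by (simp add: level_def diff_divide_distrib of_nat_diff)
      have "?f (x(i := x i - 1)) - ?f x \<le> - 2 * ?k i + 1 / weight i"
        unfolding step B using A by linarith
      then show ?thesis using charge_rate_nonneg[OF large] by (intro mult_left_mono)
    qed
    have "generator r ?f x \<le> (\<Sum>i\<in>UNIV. arrival_rate r i x * (2 * ?k i + 1 / weight i) + charge_rate r i x * (- 2 * ?k i + 1 / weight i))"
      unfolding generator_def by (intro sum_mono add_mono mult_left_mono up down) auto
    also have "\<dots> = 2 * (\<Sum>i\<in>UNIV. arrival_rate r i x * ?k i) - 2 * (\<Sum>i\<in>UNIV. charge_rate r i x * ?k i)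
        + (\<Sum>i\<in>UNIV. (arrival_rate r i x + charge_rate r i x) / weight i)"
      unfolding sum_distrib_left sum_subtractf[symmetric] sum.distrib[symmetric]
      by (intro sum.cong refl) (simp add: field_simps)
    also have "(\<Sum>i\<in>UNIV. arrival_rate r i x * ?k i) \<le> (\<Sum>i\<in>UNIV. weight i * (lam * not_waiting r x * ?k i))"
      using sum_arrival_rate_mono_le[OF mono_overflow[of r], of r x] by (simp add: sum_distrib_left mult_ac)
    also have "(\<Sum>i\<in>UNIV. charge_rate r i x * ?k i) = (\<Sum>i\<in>UNIV. weight i * (mu * cap r * ?k i))"
    proof (intro sum.cong refl)
      fix i
      show "charge_rate r i x * ?k i = weight i * (mu * cap r * ?k i)"
      proof (cases "?k i = 0")
        case False
        then have "offered r + tail_start * scale r \<le> level x i" by (simp add: overflow_def max_def split: if_splits)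
        moreover have "g * scale r \<le> tail_start * scale r" using tail_start_ge by (intro mult_right_mono) auto
        ultimately have "cap r \<le> level x i" by (simp add: cap_def)
        then show ?thesis by (simp add: charge_rate_eq min_absorb2)
      qed simp
    qed
    finally have "generator r ?f x \<le> 2 * (\<Sum>i\<in>UNIV. weight i * ((lam * not_waiting r x - mu * cap r) * ?k i))
        + (\<Sum>i\<in>UNIV. (arrival_rate r i x + charge_rate r i x) / weight i)"
      by (simp add: sum_subtractf right_diff_distrib left_diff_distrib)
    also have "(\<Sum>i\<in>UNIV. weight i * ((lam * not_waiting r x - mu * cap r) * ?k i)) \<le> (\<Sum>i\<in>UNIV. - lam * (weight i * ?k i)\<^sup>2)"
    proof (rule sum_mono)
      fix i
      show "weight i * ((lam * not_waiting r x - mu * cap r) * ?k i) \<le> - lam * (weight i * ?k i)\<^sup>2"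
      proof (cases "?k i = 0")
        case False
        then have k: "0 < ?k i" using overflow_nonneg[of r "level x i"] by linarith
        have "weight i * ((lam * not_waiting r x - mu * cap r) * ?k i) \<le> weight i * ((- lam * weight i * ?k i) * ?k i)"
          using overload_drift[OF x k] by (intro mult_left_mono mult_right_mono) auto
        then show ?thesis by (simp add: power2_eq_square mult_ac)
      qed simp
    qed
    also note weighted_rate_le[of x]
    finally show ?thesis by (simp add: sum_negf sum_distrib_left[symmetric])
  qed
  note drift = this
  define S where "S x = (\<Sum>i\<in>UNIV. (weight i * overflow r (level x i))\<^sup>2)" for x
  have "mean r (generator r ?f) \<le> mean r (\<lambda>x. - 2 * lam * S x + inv_weight * rate_const * offered r)"
    unfolding S_def by (rule expectation_mono[OF large]) (rule drift)
  then have "2 * lam * mean r S \<le> inv_weight * rate_const * offered r"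
    unfolding expectation_generator[OF large] by (simp add: integrable_steady_state[OF large])
  then have "mean r S \<le> inv_weight * rate_const / (2 * lam) * offered r"
    using rates by (simp add: field_simps)
  then show ?thesis by (simp only: S_def[abs_def])
qed

end

definition overflow_const :: real where "overflow_const = inv_weight\<^sup>2 * (inv_weight * rate_const / (2 * lam))"
definition excess_const :: real where "excess_const = 2 * overflow_const + 2 * (tail_start - b)\<^sup>2"

definition spread_bound :: real where "spread_bound = 2 + \<bar>b\<bar> + mu / lam"
definition spread_const :: real where
  "spread_const = (inv_weight * rate_const + 4 * spread_bound * lam\<^sup>2 / mu * excess_const) / mu"
definition excess_mean_const :: real where "excess_mean_const = (1 + excess_const) / 2"
definition deficit_const :: real where "deficit_const = inv_weight * (mu * \<bar>g\<bar> + lam * excess_mean_const) / mu"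

context
  fixes r :: nat
  assumes large: "large r"
begin

lemma mean_overflow_square_le: "mean r (\<lambda>x. (overflow r (level x i))\<^sup>2) \<le> overflow_const * offered r"
proof -
  have "(overflow r (level x i))\<^sup>2 \<le> inv_weight\<^sup>2 * (\<Sum>i\<in>UNIV. (weight i * overflow r (level x i))\<^sup>2)" for x
  proof -
    have "1 * overflow r (level x i) \<le> (weight i * inv_weight) * overflow r (level x i)"
      by (intro mult_right_mono weight_inv_weight) auto
    then have "(overflow r (level x i))\<^sup>2 \<le> (inv_weight * (weight i * overflow r (level x i)))\<^sup>2"
      by (intro power_mono) (auto simp: mult_ac)
    also have "\<dots> \<le> inv_weight\<^sup>2 * (\<Sum>i\<in>UNIV. (weight i * overflow r (level x i))\<^sup>2)"
      unfolding power_mult_distrib[of inv_weight]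
      by (intro mult_left_mono member_le_sum[of i UNIV "\<lambda>i. (weight i * overflow r (level x i))\<^sup>2"]) auto
    finally show ?thesis .
  qed
  then have "mean r (\<lambda>x. (overflow r (level x i))\<^sup>2) \<le> mean r (\<lambda>x. inv_weight\<^sup>2 * (\<Sum>i\<in>UNIV. (weight i * overflow r (level x i))\<^sup>2))"
    by (rule expectation_mono[OF large])
  also have "\<dots> = inv_weight\<^sup>2 * mean r (\<lambda>x. \<Sum>i\<in>UNIV. (weight i * overflow r (level x i))\<^sup>2)" by simp
  also have "\<dots> \<le> inv_weight\<^sup>2 * (inv_weight * rate_const / (2 * lam) * offered r)"
    by (intro mult_left_mono mean_overflow_square[OF large]) auto
  finally show ?thesis by (simp add: overflow_const_def mult_ac)
qed

lemma mean_excess_square: "mean r (\<lambda>x. (excess r x)\<^sup>2) \<le> excess_const * offered r"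
proof -
  have "(excess r x)\<^sup>2 \<le> (\<Sum>i\<in>UNIV. weight i * (2 * (overflow r (level x i))\<^sup>2 + 2 * (tail_start - b)\<^sup>2 * offered r))" for x
  proof -
    have "(excess r x)\<^sup>2 \<le> (\<Sum>i\<in>UNIV. weight i * (max 0 (level x i - (offered r + b * scale r)))\<^sup>2)"
      unfolding excess_eq by (rule sum_weight_square_le)
    also have "\<dots> \<le> (\<Sum>i\<in>UNIV. weight i * (2 * (overflow r (level x i))\<^sup>2 + 2 * (tail_start - b)\<^sup>2 * offered r))"
    proof (intro sum_mono mult_left_mono)
      fix i
      have "b * scale r \<le> tail_start * scale r" using tail_start_ge by (intro mult_right_mono) auto
      then have "max 0 (level x i - (offered r + b * scale r)) \<le> overflow r (level x i) + (tail_start - b) * scale r"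
        by (auto simp: overflow_def left_diff_distrib)
      then have "(max 0 (level x i - (offered r + b * scale r)))\<^sup>2 \<le> (overflow r (level x i) + (tail_start - b) * scale r)\<^sup>2"
        by (intro power_mono) auto
      also have "\<dots> \<le> 2 * (overflow r (level x i))\<^sup>2 + 2 * ((tail_start - b) * scale r)\<^sup>2"
        using sum_squares_bound[of "overflow r (level x i)" "(tail_start - b) * scale r"] by (simp add: power2_sum)
      finally show "(max 0 (level x i - (offered r + b * scale r)))\<^sup>2 \<le> 2 * (overflow r (level x i))\<^sup>2 + 2 * (tail_start - b)\<^sup>2 * offered r"
        by (simp add: power_mult_distrib scale_def)
    qed auto
    finally show ?thesis .
  qed
  then have "mean r (\<lambda>x. (excess r x)\<^sup>2) \<le> mean r (\<lambda>x. \<Sum>i\<in>UNIV. weight i * (2 * (overflow r (level x i))\<^sup>2 + 2 * (tail_start - b)\<^sup>2 * offered r))"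
    by (rule expectation_mono[OF large])
  also have "\<dots> = (\<Sum>i\<in>UNIV. weight i * (2 * mean r (\<lambda>x. (overflow r (level x i))\<^sup>2) + 2 * (tail_start - b)\<^sup>2 * offered r))"
    by (simp add: integrable_steady_state[OF large])
  also have "\<dots> \<le> excess_const * offered r"
    using mean_overflow_square_le by (intro sum_weight_mono) (simp add: excess_const_def distrib_right)
  finally show ?thesis .
qed

lemma mean_excess: "mean r (excess r) \<le> excess_mean_const * scale r"
proof -
  have s: "0 < scale r" using scale_ge_1[OF large] by simp
  have "excess r x \<le> scale r / 2 + (excess r x)\<^sup>2 / (2 * scale r)" for x
    using sum_squares_bound[of "scale r" "excess r x"] s by (simp add: field_simps power2_eq_square)
  then have "mean r (excess r) \<le> mean r (\<lambda>x. scale r / 2 + (excess r x)\<^sup>2 / (2 * scale r))"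
    by (rule expectation_mono[OF large])
  also have "\<dots> = scale r / 2 + mean r (\<lambda>x. (excess r x)\<^sup>2) / (2 * scale r)"
    by (simp add: integrable_steady_state[OF large])
  also have "\<dots> \<le> scale r / 2 + excess_const * offered r / (2 * scale r)"
    using s by (intro add_left_mono divide_right_mono mean_excess_square) auto
  also have "\<dots> = excess_mean_const * scale r"
    using s by (simp add: excess_mean_const_def scale_square[symmetric] field_simps)
  finally show ?thesis .
qed

lemma spread_le:
  assumes "x \<in> feasible r" shows "spread x \<le> spread_bound * offered r"
proof -
  have "spread x \<le> (\<Sum>i\<in>UNIV. \<Sum>j\<in>UNIV. pair_prob i j * (level x i + level x j)) / 4"
    unfolding spread_def by (intro divide_right_mono sum_mono mult_left_mono) (auto simp: abs_le_iff)
  also have "(\<Sum>i\<in>UNIV. \<Sum>j\<in>UNIV. pair_prob i j * (level x i + level x j)) = (\<Sum>i\<in>UNIV. \<Sum>j\<in>UNIV. pair_prob i j * level x i) + (\<Sum>i\<in>UNIV. \<Sum>j\<in>UNIV. pair_prob i j * level x i)"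
    using sum_pair_prob_swap[of "\<lambda>i j. level x i"] by (simp add: distrib_left sum.distrib)
  also have "(\<Sum>i\<in>UNIV. \<Sum>j\<in>UNIV. pair_prob i j * level x i) = 2 * total x"
    by (simp add: sum_distrib_right[symmetric] sum_pair_prob mult.assoc sum_distrib_left total_def)
  finally have "spread x \<le> total x" by simp
  also have "total x \<le> (\<Sum>i\<in>UNIV. spares r i + max 0 (real (x i) - spares r i))"
    unfolding total_def by (intro sum_mono) auto
  also have "\<dots> = offered r + b * scale r + excess r x"
    by (simp add: sum.distrib excess_def spares_eq sum_distrib_right[symmetric] sum_weight)
  also have "b * scale r \<le> \<bar>b\<bar> * offered r"
    by (intro mult_mono scale_le_offered[OF large]) auto
  also have "excess r x \<le> mu / lam * offered r + offered r"
  proof -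
    have "mu / lam * offered r = real r" using rates by (simp add: offered_def)
    then show ?thesis using assms offered_ge_1[OF large] by (simp add: feasible_def)
  qed
  finally show ?thesis by (simp add: spread_bound_def algebra_simps)
qed

lemma mean_generator_total: "mean r (\<lambda>x. lam * not_waiting r x) = mean r (\<lambda>x. \<Sum>i\<in>UNIV. charge_rate r i x)"
proof -
  have tot: "total (x(i := k)) - total x = real k - real (x i)" for x i k
  proof -
    have "total (x(i := k)) - total x = (\<Sum>j\<in>UNIV. if j = i then real k - real (x i) else 0)"
      unfolding total_def sum_subtractf[symmetric] by (intro sum.cong) auto
    then show ?thesis by simp
  qed
  have "charge_rate r i x * (real (x i - 1) - real (x i)) = - charge_rate r i x" for x i
    using charge_rate_0[OF large, of x i] by (cases "x i = 0") (auto simp: of_nat_diff)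
  then have "generator r total x = lam * not_waiting r x - (\<Sum>i\<in>UNIV. charge_rate r i x)" for x
    unfolding generator_def tot by (simp add: sum.distrib sum_subtractf sum_arrival_rate sum_negf)
  then have "generator r total = (\<lambda>x. lam * not_waiting r x - (\<Sum>i\<in>UNIV. charge_rate r i x))" by (rule ext)
  then have "mean r (generator r total) = mean r (\<lambda>x. lam * not_waiting r x - (\<Sum>i\<in>UNIV. charge_rate r i x))" by (rule arg_cong)
  also have "\<dots> = mean r (\<lambda>x. lam * not_waiting r x) - mean r (\<lambda>x. \<Sum>i\<in>UNIV. charge_rate r i x)"
    by (rule Bochner_Integration.integral_diff) (rule integrable_steady_state[OF large])+
  finally show ?thesis using expectation_generator[OF large, of total] by simp
qed

text \<open>The Lyapunov function is the weighted variance of the levels, as the total is their weighted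
  mean. Arrivals decrease it in proportion to the spread, and completions do not increase it, since
  higher levels are served at least as fast. What remains is the second-order term, of the order of
  the total rate.\<close>

lemma mean_not_waiting_spread: "2 * mean r (\<lambda>x. lam * not_waiting r x * spread x) \<le> inv_weight * rate_const * offered r"
proof -
  \<comment> \<open>the variance of the levels under the weights\<close>
  let ?f = "\<lambda>x. (\<Sum>i\<in>UNIV. weight i * (level x i)\<^sup>2) - (total x)\<^sup>2"
  have tot: "total (x(i := k)) = total x + (real k - real (x i))" for x i k
  proof -
    have "total (x(i := k)) - total x = (\<Sum>j\<in>UNIV. if j = i then real k - real (x i) else 0)"
      unfolding total_def sum_subtractf[symmetric] by (intro sum.cong) auto
    then show ?thesis by simp
  qed
  have sq: "(\<Sum>j\<in>UNIV. weight j * (level (x(i := k)) j)\<^sup>2) = (\<Sum>j\<in>UNIV. weight j * (level x j)\<^sup>2)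
      + ((real k)\<^sup>2 / weight i - (real (x i))\<^sup>2 / weight i)" for x i k
  proof -
    have "(\<Sum>j\<in>UNIV. weight j * (level (x(i := k)) j)\<^sup>2) - (\<Sum>j\<in>UNIV. weight j * (level x j)\<^sup>2)
        = (\<Sum>j\<in>UNIV. if j = i then (real k)\<^sup>2 / weight i - (real (x i))\<^sup>2 / weight i else 0)"
      unfolding sum_subtractf[symmetric] by (intro sum.cong) (auto simp: level_upd level_def power2_eq_square)
    then show ?thesis by simp
  qed
  have up: "?f (x(i := x i + 1)) - ?f x \<le> 2 * (level x i - total x) + 1 / weight i" for x i
    unfolding tot sq by (simp add: level_def power2_sum add_divide_distrib)
  have down: "charge_rate r i x * (?f (x(i := x i - 1)) - ?f x) \<le> charge_rate r i x * (- 2 * (level x i - total x) + 1 / weight i)" for x i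
  proof (cases "x i = 0")
    case True
    then show ?thesis by (simp add: charge_rate_0[OF large])
  next
    case False
    then have "real (x i - 1) = real (x i) - 1" by (simp add: of_nat_diff)
    then have "?f (x(i := x i - 1)) - ?f x \<le> - 2 * (level x i - total x) + 1 / weight i"
      unfolding tot sq by (simp add: level_def power2_diff power2_sum add_divide_distrib diff_divide_distrib)
    then show ?thesis using charge_rate_nonneg[OF large] by (intro mult_left_mono)
  qed
  have "generator r ?f x \<le> - 2 * (lam * not_waiting r x * spread x) + inv_weight * rate_const * offered r" for x
  proof -
    have "generator r ?f x \<le> (\<Sum>i\<in>UNIV. arrival_rate r i x * (2 * (level x i - total x) + 1 / weight i)
        + charge_rate r i x * (- 2 * (level x i - total x) + 1 / weight i))"
      unfolding generator_def by (intro sum_mono add_mono mult_left_mono up down) auto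
    also have "\<dots> = 2 * ((\<Sum>i\<in>UNIV. arrival_rate r i x * level x i) - (\<Sum>i\<in>UNIV. arrival_rate r i x) * total x)
        - 2 * (\<Sum>i\<in>UNIV. charge_rate r i x * (level x i - total x))
        + (\<Sum>i\<in>UNIV. (arrival_rate r i x + charge_rate r i x) / weight i)"
      unfolding sum_distrib_left sum_distrib_right sum_subtractf[symmetric] sum.distrib[symmetric]
      by (intro sum.cong refl) (simp add: field_simps)
    also have "(\<Sum>i\<in>UNIV. arrival_rate r i x * level x i) - (\<Sum>i\<in>UNIV. arrival_rate r i x) * total x = - (lam * not_waiting r x * spread x)"
      unfolding sum_arrival_rate_level sum_arrival_rate total_def by (simp add: right_diff_distrib)
    finally have 1: "generator r ?f x \<le> - 2 * (lam * not_waiting r x * spread x)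
        - 2 * (\<Sum>i\<in>UNIV. charge_rate r i x * (level x i - total x)) + inv_weight * rate_const * offered r"
      using weighted_rate_le[OF large, of x] by simp
    have "0 \<le> (\<Sum>i\<in>UNIV. mu * weight i * ((min (level x i) (cap r) - min (total x) (cap r)) * (level x i - total x)))"
    proof (rule sum_nonneg)
      fix i
      have "0 \<le> (min (level x i) (cap r) - min (total x) (cap r)) * (level x i - total x)"
        by (cases "level x i \<le> total x") (auto intro!: mult_nonneg_nonneg mult_nonpos_nonpos)
      then show "0 \<le> mu * weight i * ((min (level x i) (cap r) - min (total x) (cap r)) * (level x i - total x))"
        using rates by simp
    qed
    also have "\<dots> = (\<Sum>i\<in>UNIV. charge_rate r i x * (level x i - total x))
        - mu * min (total x) (cap r) * (\<Sum>i\<in>UNIV. weight i * (level x i - total x))"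
      unfolding charge_rate_eq sum_distrib_left sum_subtractf[symmetric]
      by (intro sum.cong refl) (simp add: algebra_simps)
    also have "(\<Sum>i\<in>UNIV. weight i * (level x i - total x)) = 0"
      by (simp add: right_diff_distrib sum_subtractf sum_distrib_right[symmetric] sum_weight total_def)
    finally show ?thesis using 1 by simp
  qed
  then have "mean r (generator r ?f) \<le> mean r (\<lambda>x. - 2 * (lam * not_waiting r x * spread x) + inv_weight * rate_const * offered r)"
    by (rule expectation_mono[OF large])
  then show ?thesis
    unfolding expectation_generator[OF large] by (simp add: integrable_steady_state[OF large])
qed

text \<open>Where at least half of the vehicles are not waiting, the arrival rate is of the order \<open>r\<close> and
  the preceding bound applies. Elsewhere the excess is at least \<open>r / 2\<close>, and its second moment
  makes this so unlikely that the trivial bound on the spread suffices.\<close>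

lemma mean_spread: "mean r spread \<le> spread_const"
proof -
  have "mu * offered r * spread x \<le> 2 * (lam * not_waiting r x * spread x) + 4 * spread_bound * lam\<^sup>2 / mu * (excess r x)\<^sup>2"
    if x: "x \<in> feasible r" for x
  proof (cases "real r / 2 \<le> not_waiting r x")
    case True
    then have "lam * real r * spread x \<le> 2 * (lam * not_waiting r x * spread x)"
      using rates by (simp add: mult.assoc mult_right_mono mult_left_mono flip: mult.assoc[of "not_waiting r x"])
        (use mult_right_mono[of "real r" "2 * not_waiting r x" "spread x"] in auto)
    moreover have "0 \<le> 4 * spread_bound * lam\<^sup>2 / mu * (excess r x)\<^sup>2"
      using rates by (simp add: spread_bound_def)
    ultimately show ?thesis unfolding offered_rate by linarith
  next
    case False
    then have e: "real r / 2 \<le> excess r x" by (auto simp: not_waiting_eq max_def split: if_splits)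
    have "(real r / 2)\<^sup>2 \<le> (excess r x)\<^sup>2" using e by (intro power_mono) auto
    then have e2: "(real r)\<^sup>2 \<le> 4 * (excess r x)\<^sup>2" by (simp add: power_divide)
    have "mu * offered r * spread x \<le> mu * offered r * (spread_bound * offered r)"
      using rates by (intro mult_left_mono spread_le x) auto
    also have "\<dots> = spread_bound * lam\<^sup>2 / mu * (real r)\<^sup>2"
      using rates by (simp add: offered_def power2_eq_square field_simps)
    also have "\<dots> \<le> spread_bound * lam\<^sup>2 / mu * (4 * (excess r x)\<^sup>2)"
      using rates e2 by (intro mult_left_mono) (auto simp: spread_bound_def)
    also have "spread_bound * lam\<^sup>2 / mu * (4 * (excess r x)\<^sup>2) = 4 * spread_bound * lam\<^sup>2 / mu * (excess r x)\<^sup>2"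
      by simp
    also have "\<dots> \<le> 2 * (lam * not_waiting r x * spread x) + 4 * spread_bound * lam\<^sup>2 / mu * (excess r x)\<^sup>2"
    proof -
      have "0 \<le> 2 * (lam * not_waiting r x * spread x)" using rates by simp
      then show ?thesis by linarith
    qed
    finally show ?thesis .
  qed
  then have "mean r (\<lambda>x. mu * offered r * spread x)
      \<le> mean r (\<lambda>x. 2 * (lam * not_waiting r x * spread x) + 4 * spread_bound * lam\<^sup>2 / mu * (excess r x)\<^sup>2)"
    by (rule expectation_mono[OF large])
  then have "mu * offered r * mean r spread \<le> 2 * mean r (\<lambda>x. lam * not_waiting r x * spread x) + 4 * spread_bound * lam\<^sup>2 / mu * mean r (\<lambda>x. (excess r x)\<^sup>2)"
    by (simp add: integrable_steady_state[OF large])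
  also have "\<dots> \<le> inv_weight * rate_const * offered r + 4 * spread_bound * lam\<^sup>2 / mu * (excess_const * offered r)"
    using rates by (intro add_mono mult_left_mono mean_not_waiting_spread mean_excess_square) (auto simp: spread_bound_def)
  also have "\<dots> = mu * offered r * spread_const"
    using rates by (simp add: spread_const_def field_simps)
  finally show ?thesis using offered_ge_1[OF large] rates by simp
qed

text \<open>Arrivals and completions have equal means. The arrival rate falls short of the capacity by the
  order of \<open>scale r\<close> in the mean, and so must the rate of completions, that is, the idle capacity.\<close>

lemma mean_deficit_sum: "mean r (\<lambda>x. \<Sum>i\<in>UNIV. weight i * max 0 (cap r - level x i)) \<le> (mu * \<bar>g\<bar> + lam * excess_mean_const) / mu * scale r"
proof -
  have c: "(\<Sum>i\<in>UNIV. charge_rate r i x) = mu * cap r - mu * (\<Sum>i\<in>UNIV. weight i * max 0 (cap r - level x i))" for x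
  proof -
    have "charge_rate r i x = mu * cap r * weight i - mu * (weight i * max 0 (cap r - level x i))" for i
      unfolding charge_rate_eq by (auto simp: min_def max_def algebra_simps)
    then show ?thesis by (simp add: sum_subtractf sum_distrib_left[symmetric] sum_weight)
  qed
  have "mean r (\<lambda>x. lam * real r - lam * excess r x) \<le> mean r (\<lambda>x. lam * not_waiting r x)"
    using lam_not_waiting_bounds(1)[OF large] by (intro expectation_mono[OF large]) (simp add: right_diff_distrib)
  then have "lam * real r - lam * mean r (excess r) \<le> mu * cap r - mu * mean r (\<lambda>x. \<Sum>i\<in>UNIV. weight i * max 0 (cap r - level x i))"
    unfolding mean_generator_total c by (simp add: integrable_steady_state[OF large])
  moreover have "lam * mean r (excess r) \<le> lam * (excess_mean_const * scale r)"
    using rates by (intro mult_left_mono mean_excess) auto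
  moreover have "mu * cap r - lam * real r \<le> mu * \<bar>g\<bar> * scale r"
  proof -
    have "mu * cap r - lam * real r = mu * g * scale r" by (simp add: cap_def distrib_left offered_rate)
    also have "\<dots> \<le> mu * \<bar>g\<bar> * scale r" using rates by (intro mult_right_mono mult_left_mono) auto
    finally show ?thesis .
  qed
  ultimately have "mu * mean r (\<lambda>x. \<Sum>i\<in>UNIV. weight i * max 0 (cap r - level x i)) \<le> (mu * \<bar>g\<bar> + lam * excess_mean_const) * scale r"
    by (simp add: algebra_simps)
  then show ?thesis using rates by (simp add: field_simps)
qed

lemma mean_deficit: "mean r (\<lambda>x. max 0 (cap r - level x i)) \<le> deficit_const * scale r"
proof -
  have "max 0 (cap r - level x i) \<le> inv_weight * (\<Sum>i\<in>UNIV. weight i * max 0 (cap r - level x i))" for x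
  proof -
    have "1 * max 0 (cap r - level x i) \<le> (weight i * inv_weight) * max 0 (cap r - level x i)"
      by (intro mult_right_mono weight_inv_weight) auto
    also have "\<dots> = inv_weight * (weight i * max 0 (cap r - level x i))" by (simp add: mult_ac)
    also have "\<dots> \<le> inv_weight * (\<Sum>i\<in>UNIV. weight i * max 0 (cap r - level x i))"
      using inv_weight_pos by (intro mult_left_mono member_le_sum[of i UNIV "\<lambda>i. weight i * max 0 (cap r - level x i)"]) auto
    finally show ?thesis by simp
  qed
  then have "mean r (\<lambda>x. max 0 (cap r - level x i)) \<le> mean r (\<lambda>x. inv_weight * (\<Sum>i\<in>UNIV. weight i * max 0 (cap r - level x i)))"
    by (rule expectation_mono[OF large])
  also have "\<dots> = inv_weight * mean r (\<lambda>x. \<Sum>i\<in>UNIV. weight i * max 0 (cap r - level x i))" by simp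
  also have "\<dots> \<le> inv_weight * ((mu * \<bar>g\<bar> + lam * excess_mean_const) / mu * scale r)"
    using inv_weight_pos by (intro mult_left_mono mean_deficit_sum) auto
  finally show ?thesis by (simp add: deficit_const_def)
qed

end
end

section \<open>Comparison with the diffusion\<close>

lemma MVT_between:
  fixes f :: "real \<Rightarrow> real"
  assumes "\<And>x. (f has_real_derivative f' x) (at x)"
  obtains z where "f c = f a + (c - a) * f' z" "\<bar>z - a\<bar> \<le> \<bar>c - a\<bar>"
proof -
  consider "a < c" | "c < a" | "a = c" by linarith
  then show ?thesis
  proof cases
    case 1
    from MVT2[OF this, of f f'] assms obtain z where "a < z" "z < c" "f c - f a = (c - a) * f' z" by auto
    then show ?thesis using that[of z] by auto
  next
    case 2
    from MVT2[OF this, of f f'] assms obtain z where "c < z" "z < a" "f a - f c = (a - c) * f' z" by auto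
    then show ?thesis using that[of z] by (auto simp: algebra_simps)
  next
    case 3
    then show ?thesis using that[of a] by auto
  qed
qed

text \<open>Taylor's formula with the remainder controlled by the modulus of continuity of the second
  derivative, as the solution of the Stein equation has only two derivatives.\<close>

lemma second_order_expansion:
  fixes F F' F'' :: "real \<Rightarrow> real"
  assumes F: "\<And>x. (F has_real_derivative F' x) (at x)" and F': "\<And>x. (F' has_real_derivative F'' x) (at x)"
    and w: "\<And>a c. \<bar>a - c\<bar> \<le> \<bar>h\<bar> \<Longrightarrow> \<bar>F'' a - F'' c\<bar> \<le> w"
  shows "\<bar>F (y + h) - F y - h * F' y - h\<^sup>2 / 2 * F'' y\<bar> \<le> h\<^sup>2 * w"
proof -
  define G where "G t = F (y + t) - t * F' y - t\<^sup>2 / 2 * F'' y" for t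
  have G: "(G has_real_derivative (F' (y + t) - F' y - t * F'' y)) (at t)" for t
    unfolding G_def by (rule derivative_eq_intros DERIV_chain2[OF F] refl | simp)+
  obtain z where z: "G h = G 0 + (h - 0) * (F' (y + z) - F' y - z * F'' y)" "\<bar>z - 0\<bar> \<le> \<bar>h - 0\<bar>"
    by (rule MVT_between[OF G])
  obtain x where x: "F' (y + z) = F' y + (y + z - y) * F'' x" "\<bar>x - y\<bar> \<le> \<bar>y + z - y\<bar>"
    by (rule MVT_between[OF F'])
  have "G h - G 0 = h * (z * (F'' x - F'' y))" using z(1) x(1) by (simp add: algebra_simps)
  then have "\<bar>G h - G 0\<bar> = \<bar>h\<bar> * (\<bar>z\<bar> * \<bar>F'' x - F'' y\<bar>)" by (simp add: abs_mult)
  also have "\<dots> \<le> \<bar>h\<bar> * (\<bar>h\<bar> * w)"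
    using z(2) x(2) w[of x y] by (intro mult_left_mono mult_mono) auto
  also have "\<dots> = h\<^sup>2 * w" by (simp add: power2_eq_square)
  finally show ?thesis by (simp add: G_def algebra_simps)
qed

lemma uniformly_continuous_compact_support:
  fixes f :: "real \<Rightarrow> real"
  assumes "continuous_on UNIV f" and z: "\<And>x. K < \<bar>x\<bar> \<Longrightarrow> f x = 0" and e: "0 < e"
  obtains d where "0 < d" "\<And>a c. \<bar>a - c\<bar> \<le> d \<Longrightarrow> \<bar>f a - f c\<bar> \<le> e"
proof -
  have "uniformly_continuous_on {- (\<bar>K\<bar> + 1)..\<bar>K\<bar> + 1} f"
    by (rule compact_uniformly_continuous[OF continuous_on_subset[OF assms(1)]]) auto
  then obtain d where d: "0 < d" and u: "\<And>a c. a \<in> {- (\<bar>K\<bar> + 1)..\<bar>K\<bar> + 1} \<Longrightarrow> c \<in> {- (\<bar>K\<bar> + 1)..\<bar>K\<bar> + 1} \<Longrightarrow> dist c a < d \<Longrightarrow> dist (f c) (f a) < e"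
    using e unfolding uniformly_continuous_on_def by metis
  show ?thesis
  proof (rule that[of "min (d / 2) 1"])
    show "0 < min (d / 2) 1" using d by simp
    fix a c :: real assume ac: "\<bar>a - c\<bar> \<le> min (d / 2) 1"
    show "\<bar>f a - f c\<bar> \<le> e"
    proof (cases "a \<in> {- (\<bar>K\<bar> + 1)..\<bar>K\<bar> + 1} \<and> c \<in> {- (\<bar>K\<bar> + 1)..\<bar>K\<bar> + 1}")
      case True
      have "dist a c < d" using ac d by (simp add: dist_real_def)
      from u[OF _ _ this] True show ?thesis by (simp add: dist_real_def)
    next
      case False
      then have "K < \<bar>a\<bar>" "K < \<bar>c\<bar>" using ac by auto
      then show ?thesis using z e by simp
    qed
  qed
qed

lemma bounded_compact_support:
  fixes f :: "real \<Rightarrow> real"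
  assumes "continuous_on UNIV f" and z: "\<And>x. K < \<bar>x\<bar> \<Longrightarrow> f x = 0"
  obtains B where "0 \<le> B" "\<And>x. \<bar>f x\<bar> \<le> B"
proof -
  have "compact (f ` {-K..K})" by (intro compact_continuous_image continuous_on_subset[OF assms(1)]) auto
  then obtain C where C: "\<And>x. x \<in> {-K..K} \<Longrightarrow> \<bar>f x\<bar> \<le> C"
    by (metis bounded_iff compact_imp_bounded imageI real_norm_def)
  have "\<bar>f x\<bar> \<le> \<bar>C\<bar>" for x
  proof (cases "K < \<bar>x\<bar>")
    case False
    then have "x \<in> {-K..K}" by auto
    from C[OF this] show ?thesis by simp
  qed (simp add: z)
  then show ?thesis using that[of "\<bar>C\<bar>"] by simp
qed

sublocale swapping_network \<subseteq> limit_diffusion lam mu b g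
  by unfold_locales (use rates g_le_b in auto)

context swapping_network
begin

lemma drift_lipschitz: "\<bar>drift a - drift c\<bar> \<le> (lam + mu) * \<bar>a - c\<bar>"
proof -
  have 1: "\<bar>max 0 (a - b) - max 0 (c - b)\<bar> \<le> \<bar>a - c\<bar>" and 2: "\<bar>min a g - min c g\<bar> \<le> \<bar>a - c\<bar>" by auto
  have "drift a - drift c = - (lam * (max 0 (a - b) - max 0 (c - b))) - mu * (min a g - min c g)"
    by (simp add: limit_drift_def algebra_simps)
  also have "\<bar>\<dots>\<bar> \<le> \<bar>lam * (max 0 (a - b) - max 0 (c - b))\<bar> + \<bar>mu * (min a g - min c g)\<bar>" by linarith
  also have "\<dots> \<le> lam * \<bar>a - c\<bar> + mu * \<bar>a - c\<bar>"
    unfolding abs_mult using rates 1 2 by (intro add_mono mult_mono) auto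
  finally show ?thesis by (simp add: distrib_right)
qed

definition scaled_total :: "nat \<Rightarrow> ('s \<Rightarrow> nat) \<Rightarrow> real" where
  "scaled_total r x = (total x - offered r) / scale r"

definition scaled_level :: "nat \<Rightarrow> 's \<Rightarrow> ('s \<Rightarrow> nat) \<Rightarrow> real" where
  "scaled_level r i x = (level x i - offered r) / scale r"

text \<open>A choice of the constant in \<open>level_total_diff_le_spread\<close>; it depends neither on the state nor on \<open>r\<close>.\<close>

definition spread_factor :: real where
  "spread_factor = (SOME C. 0 \<le> C \<and> (\<forall>x i. \<bar>level x i - total x\<bar> \<le> C * spread x))"

lemma spread_factor: "0 \<le> spread_factor" "\<bar>level x i - total x\<bar> \<le> spread_factor * spread x"
proof -
  have "\<exists>C. 0 \<le> C \<and> (\<forall>x i. \<bar>level x i - total x\<bar> \<le> C * spread x)"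
    using level_total_diff_le_spread by blast
  from someI_ex[OF this] show "0 \<le> spread_factor" "\<bar>level x i - total x\<bar> \<le> spread_factor * spread x"
    unfolding spread_factor_def by blast+
qed

lemma total_upd: "total (x(i := k)) = total x + (real k - real (x i))"
proof -
  have "total (x(i := k)) - total x = (\<Sum>j\<in>UNIV. if j = i then real k - real (x i) else 0)"
    unfolding total_def sum_subtractf[symmetric] by (intro sum.cong) auto
  then show ?thesis by simp
qed

text \<open>The charging capacity that lies idle, in units of charging points.\<close>

definition deficit :: "nat \<Rightarrow> ('s \<Rightarrow> nat) \<Rightarrow> real" where
  "deficit r x = (\<Sum>i\<in>UNIV. weight i * max 0 (cap r - level x i))"

context
  fixes r :: nat
  assumes large: "large r"
begin

lemma scale_pos: "0 < scale r" using scale_ge_1[OF large] by simp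

lemma scaled_level_total_diff: "\<bar>scaled_level r i x - scaled_total r x\<bar> \<le> spread_factor * spread x / scale r"
proof -
  have "\<bar>scaled_level r i x - scaled_total r x\<bar> = \<bar>level x i - total x\<bar> / scale r"
    using scale_pos by (simp add: scaled_level_def scaled_total_def diff_divide_distrib[symmetric])
  then show ?thesis using spread_factor(2)[of x i] scale_pos by (simp add: divide_right_mono)
qed

lemma sum_charge_rate_deficit: "(\<Sum>i\<in>UNIV. charge_rate r i x) = mu * cap r - mu * deficit r x"
proof -
  have "charge_rate r i x = mu * cap r * weight i - mu * (weight i * max 0 (cap r - level x i))" for i
    unfolding charge_rate_eq by (auto simp: min_def max_def algebra_simps)
  then show ?thesis by (simp add: sum_subtractf sum_distrib_left[symmetric] sum_weight deficit_def)
qed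

lemma deficit_nonneg: "0 \<le> deficit r x" unfolding deficit_def by (intro sum_nonneg) auto

text \<open>Up to the truncation in \<open>not_waiting\<close>, the net rate divided by \<open>scale r\<close> is the weighted average
  of the drift at the scaled levels. The levels differ from the total by the spread, and the drift is
  Lipschitz.\<close>

lemma net_rate:
  assumes x: "x \<in> feasible r"
  shows "\<bar>((\<Sum>i\<in>UNIV. arrival_rate r i x) - (\<Sum>i\<in>UNIV. charge_rate r i x)) / scale r - drift (scaled_total r x)\<bar>
    \<le> (lam + (lam + mu) * (spread_factor * spread x)) / scale r"
proof -
  let ?v = "\<lambda>i. scaled_level r i x"
  let ?A = "\<Sum>i\<in>UNIV. arrival_rate r i x" and ?C = "\<Sum>i\<in>UNIV. charge_rate r i x"
  have s: "0 < scale r" by (rule scale_pos)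
  have lv: "level x i = offered r + scale r * ?v i" for i using s by (simp add: scaled_level_def)
  define m1 where "m1 = (\<Sum>i\<in>UNIV. weight i * max 0 (?v i - b))"
  define m2 where "m2 = (\<Sum>i\<in>UNIV. weight i * min (?v i) g)"
  have ex: "excess r x = scale r * m1"
  proof -
    have "max 0 (level x i - (offered r + b * scale r)) = scale r * max 0 (?v i - b)" for i
      unfolding lv using s by (simp add: max_mult_distrib_left algebra_simps)
    then show ?thesis unfolding excess_eq m1_def sum_distrib_left by (intro sum.cong refl) simp
  qed
  have ch: "?C = mu * offered r + mu * (scale r * m2)"
  proof -
    have "min (level x i) (cap r) = offered r + scale r * min (?v i) g" for i
      unfolding lv cap_def using s by (simp add: min_mult_distrib_left min_add_distrib_right mult.commute)
    then have "charge_rate r i x = mu * offered r * weight i + mu * (scale r * (weight i * min (?v i) g))" for i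
      unfolding charge_rate_eq by (simp add: algebra_simps)
    then have "?C = (\<Sum>i\<in>UNIV. mu * offered r * weight i) + (\<Sum>i\<in>UNIV. mu * (scale r * (weight i * min (?v i) g)))"
      by (simp only: sum.distrib)
    then show ?thesis by (simp only: sum_distrib_left[symmetric] sum_weight m2_def mult_1_right)
  qed
  define e where "e = ?A - (lam * real r - lam * excess r x)"
  have e: "0 \<le> e" "e \<le> lam" unfolding e_def sum_arrival_rate
    using lam_not_waiting_bounds[OF large x] by (auto simp: right_diff_distrib)
  have S: "(\<Sum>i\<in>UNIV. weight i * drift (?v i)) = - lam * m1 - mu * m2"
    unfolding m1_def m2_def sum_distrib_left sum_subtractf[symmetric] limit_drift_def
    by (intro sum.cong refl) (simp add: right_diff_distrib mult_ac)
  have "?A = lam * real r - lam * (scale r * m1) + e" unfolding e_def ex by simp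
  then have "?A - ?C = scale r * (\<Sum>i\<in>UNIV. weight i * drift (?v i)) + e"
    unfolding S ch offered_rate by (simp only:) (simp add: right_diff_distrib mult_ac)
  then have "(?A - ?C) / scale r = (\<Sum>i\<in>UNIV. weight i * drift (?v i)) + e / scale r"
    using s by (simp add: add_divide_distrib)
  moreover have "\<bar>(\<Sum>i\<in>UNIV. weight i * drift (?v i)) - drift (scaled_total r x)\<bar> \<le> (lam + mu) * (spread_factor * spread x) / scale r"
  proof -
    define c where "c = drift (scaled_total r x)"
    have "(\<Sum>i\<in>UNIV. weight i * (drift (?v i) - c)) = (\<Sum>i\<in>UNIV. weight i * drift (?v i)) - (\<Sum>i\<in>UNIV. weight i) * c"
      by (simp only: right_diff_distrib sum_subtractf sum_distrib_right)
    then have "(\<Sum>i\<in>UNIV. weight i * drift (?v i)) - drift (scaled_total r x) = (\<Sum>i\<in>UNIV. weight i * (drift (?v i) - c))"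
      by (simp only: sum_weight mult_1_left c_def)
    also have "\<bar>\<dots>\<bar> \<le> (\<Sum>i\<in>UNIV. \<bar>weight i * (drift (?v i) - c)\<bar>)" by (rule sum_abs)
    also have "\<dots> = (\<Sum>i\<in>UNIV. weight i * \<bar>drift (?v i) - drift (scaled_total r x)\<bar>)"
      by (simp only: abs_mult c_def abs_of_nonneg[OF weight_nonneg])
    also have "\<dots> \<le> (lam + mu) * (spread_factor * spread x / scale r)"
    proof (rule sum_weight_mono)
      fix i
      have "\<bar>drift (?v i) - drift (scaled_total r x)\<bar> \<le> (lam + mu) * \<bar>?v i - scaled_total r x\<bar>" by (rule drift_lipschitz)
      also have "\<dots> \<le> (lam + mu) * (spread_factor * spread x / scale r)"
        using rates by (intro mult_left_mono scaled_level_total_diff) auto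
      finally show "\<bar>drift (?v i) - drift (scaled_total r x)\<bar> \<le> (lam + mu) * (spread_factor * spread x / scale r)" .
    qed
    finally show ?thesis by (simp only: times_divide_eq_right)
  qed
  moreover have "0 \<le> e / scale r" "e / scale r \<le> lam / scale r" using e s by (auto simp: divide_right_mono)
  ultimately show ?thesis unfolding add_divide_distrib by linarith
qed

text \<open>Both total rates are close to \<open>mu * offered r\<close>. This produces the infinitesimal variance
  \<open>2 * mu\<close>.\<close>

lemma sum_rate_diff:
  assumes x: "x \<in> feasible r"
  shows "\<bar>((\<Sum>i\<in>UNIV. arrival_rate r i x) + (\<Sum>i\<in>UNIV. charge_rate r i x)) / (2 * offered r) - mu\<bar>
    \<le> (lam * excess r x + lam + mu * \<bar>g\<bar> * scale r + mu * deficit r x) / (2 * offered r)"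
proof -
  let ?A = "\<Sum>i\<in>UNIV. arrival_rate r i x" and ?C = "\<Sum>i\<in>UNIV. charge_rate r i x"
  have n: "0 < offered r" using offered_ge_1[OF large] by simp
  have a: "\<bar>?A - mu * offered r\<bar> \<le> lam * excess r x + lam"
    unfolding sum_arrival_rate using lam_not_waiting_bounds[OF large x] offered_rate[of r] rates
      mult_nonneg_nonneg[of lam "excess r x"] by (simp add: right_diff_distrib abs_le_iff)
  have "\<bar>mu * (g * scale r)\<bar> = mu * \<bar>g\<bar> * scale r" using rates by (simp add: abs_mult)
  moreover have "?C - mu * offered r = mu * (g * scale r) - mu * deficit r x"
    by (simp add: sum_charge_rate_deficit cap_def algebra_simps)
  moreover have "0 \<le> mu * deficit r x" using rates deficit_nonneg by simp
  ultimately have c: "\<bar>?C - mu * offered r\<bar> \<le> mu * \<bar>g\<bar> * scale r + mu * deficit r x" by linarith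
  have "(?A + ?C) / (2 * offered r) - mu = ((?A - mu * offered r) + (?C - mu * offered r)) / (2 * offered r)"
    using n by (simp add: field_simps)
  also have "\<bar>\<dots>\<bar> = \<bar>(?A - mu * offered r) + (?C - mu * offered r)\<bar> / (2 * offered r)" using n by simp
  also have "\<dots> \<le> (lam * excess r x + lam + mu * \<bar>g\<bar> * scale r + mu * deficit r x) / (2 * offered r)"
    using n a c by (intro divide_right_mono) linarith+
  finally show ?thesis .
qed

text \<open>A jump moves the scaled total by \<open>1 / scale r\<close>; the first-order term of the expansion meets
  \<open>net_rate\<close> and the second-order term \<open>sum_rate_diff\<close>.\<close>

lemma generator_scaled_total:
  assumes x: "x \<in> feasible r"
    and F: "\<And>x. (F has_real_derivative F' x) (at x)" and F': "\<And>x. (F' has_real_derivative F'' x) (at x)"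
    and w: "\<And>a c. \<bar>a - c\<bar> \<le> 1 / scale r \<Longrightarrow> \<bar>F'' a - F'' c\<bar> \<le> w" and w0: "0 \<le> w"
    and M: "0 \<le> M" "\<And>y. \<bar>F' y\<bar> \<le> M" "\<And>y. \<bar>F'' y\<bar> \<le> M"
  shows "\<bar>generator r (\<lambda>x. F (scaled_total r x)) x - (drift (scaled_total r x) * F' (scaled_total r x) + mu * F'' (scaled_total r x))\<bar>
    \<le> M * ((lam + (lam + mu) * (spread_factor * spread x)) / scale r)
      + M * ((lam * excess r x + lam + mu * \<bar>g\<bar> * scale r + mu * deficit r x) / (2 * offered r)) + rate_const * w"
proof -
  define A where "A = (\<Sum>i\<in>UNIV. arrival_rate r i x)"
  define C where "C = (\<Sum>i\<in>UNIV. charge_rate r i x)"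
  note net = net_rate[OF x, folded A_def C_def] and rate_diff = sum_rate_diff[OF x, folded A_def C_def]
  define y where "y = scaled_total r x"
  define h where "h = 1 / scale r"
  have s: "0 < scale r" by (rule scale_pos)
  have h: "0 < h" "h\<^sup>2 = 1 / offered r" using s by (auto simp: h_def power_divide scale_def)
  have up: "scaled_total r (x(i := x i + 1)) = y + h" for i
    using s by (simp add: scaled_total_def total_upd y_def h_def add_divide_distrib diff_divide_distrib)
  have dn: "charge_rate r i x * F (scaled_total r (x(i := x i - 1))) = charge_rate r i x * F (y + - h)" for i
  proof (cases "x i = 0")
    case True
    then show ?thesis by (simp add: charge_rate_0[OF large])
  next
    case False
    then have "scaled_total r (x(i := x i - 1)) = y + - h"
      using s by (simp add: scaled_total_def total_upd y_def h_def of_nat_diff add_divide_distrib diff_divide_distrib)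
    then show ?thesis by simp
  qed
  have gen: "generator r (\<lambda>x. F (scaled_total r x)) x = A * (F (y + h) - F y) + C * (F (y + - h) - F y)"
    unfolding generator_def right_diff_distrib up dn y_def[symmetric] A_def C_def sum_distrib_right
    by (simp only: sum.distrib sum_subtractf)
  define E1 where "E1 = F (y + h) - F y - h * F' y - h\<^sup>2 / 2 * F'' y"
  define E2 where "E2 = F (y + - h) - F y - (- h) * F' y - (- h)\<^sup>2 / 2 * F'' y"
  have E1: "\<bar>E1\<bar> \<le> h\<^sup>2 * w" unfolding E1_def
    by (rule second_order_expansion[OF F F']) (use w h in \<open>auto simp: h_def\<close>)
  have E2: "\<bar>E2\<bar> \<le> h\<^sup>2 * w" unfolding E2_def using second_order_expansion[OF F F', of "- h" w y] w h by (auto simp: h_def)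
  have A0: "0 \<le> A" "0 \<le> C" unfolding A_def C_def using charge_rate_nonneg[OF large] by (auto intro!: sum_nonneg)
  have "A * \<bar>E1\<bar> + C * \<bar>E2\<bar> \<le> (A + C) * (h\<^sup>2 * w)"
    unfolding distrib_right using E1 E2 A0 by (intro add_mono mult_left_mono) auto
  also have "\<dots> \<le> rate_const * offered r * (h\<^sup>2 * w)"
    using total_rate_le[OF large, of x, folded A_def C_def] w0 by (intro mult_right_mono) auto
  also have "\<dots> = rate_const * w" using offered_ge_1[OF large] by (simp add: h(2))
  finally have err: "A * \<bar>E1\<bar> + C * \<bar>E2\<bar> \<le> rate_const * w" .
  have i1: "(A - C) * h = (A - C) / scale r" by (simp add: h_def)
  have i2: "(A + C) * (h\<^sup>2 / 2) = (A + C) / (2 * offered r)" by (simp add: h(2))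
  have "generator r (\<lambda>x. F (scaled_total r x)) x = (A - C) * h * F' y + (A + C) * (h\<^sup>2 / 2) * F'' y + (A * E1 + C * E2)"
    unfolding gen E1_def E2_def by (simp add: algebra_simps power2_eq_square)
  then have "generator r (\<lambda>x. F (scaled_total r x)) x - (drift y * F' y + mu * F'' y)
      = ((A - C) / scale r - drift y) * F' y + ((A + C) / (2 * offered r) - mu) * F'' y + (A * E1 + C * E2)"
    unfolding i1 i2 by (simp add: left_diff_distrib)
  also have "\<bar>\<dots>\<bar> \<le> \<bar>((A - C) / scale r - drift y) * F' y\<bar> + \<bar>((A + C) / (2 * offered r) - mu) * F'' y\<bar> + (A * \<bar>E1\<bar> + C * \<bar>E2\<bar>)"
  proof -
    have "\<bar>A * E1\<bar> = A * \<bar>E1\<bar>" "\<bar>C * E2\<bar> = C * \<bar>E2\<bar>" using A0 by (simp_all add: abs_mult)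
    note eqs = this
    have tri: "\<bar>p + q + (a + c)\<bar> \<le> \<bar>p\<bar> + \<bar>q\<bar> + (\<bar>a\<bar> + \<bar>c\<bar>)" for p q a c :: real
      by linarith
    show ?thesis unfolding eqs[symmetric] by (rule tri)
  qed
  also have "\<dots> \<le> M * ((lam + (lam + mu) * (spread_factor * spread x)) / scale r)
      + M * ((lam * excess r x + lam + mu * \<bar>g\<bar> * scale r + mu * deficit r x) / (2 * offered r)) + rate_const * w"
  proof -
    have "\<bar>((A - C) / scale r - drift y) * F' y\<bar> \<le> M * ((lam + (lam + mu) * (spread_factor * spread x)) / scale r)"
      unfolding abs_mult mult.commute[of M]
      by (intro mult_mono net[folded y_def] M(2) abs_ge_zero order_trans[OF abs_ge_zero net[folded y_def]])
    moreover have "\<bar>((A + C) / (2 * offered r) - mu) * F'' y\<bar>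
      \<le> M * ((lam * excess r x + lam + mu * \<bar>g\<bar> * scale r + mu * deficit r x) / (2 * offered r))"
      unfolding abs_mult mult.commute[of M]
      by (intro mult_mono rate_diff M(3) abs_ge_zero order_trans[OF abs_ge_zero rate_diff])
    ultimately show ?thesis using err by (intro add_mono)
  qed
  finally show ?thesis unfolding y_def .
qed

end

definition stein_const :: "real \<Rightarrow> real" where
  "stein_const M = M * (lam + (lam + mu) * (spread_factor * spread_const))
     + M * (lam * excess_mean_const + lam + mu * \<bar>g\<bar> + (mu * \<bar>g\<bar> + lam * excess_mean_const)) / 2"

lemma mean_stein_bound:
  assumes large: "large r"
    and F: "\<And>x. (F has_real_derivative F' x) (at x)" and F': "\<And>x. (F' has_real_derivative F'' x) (at x)"
    and w: "\<And>a c. \<bar>a - c\<bar> \<le> 1 / scale r \<Longrightarrow> \<bar>F'' a - F'' c\<bar> \<le> w" and w0: "0 \<le> w"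
    and M: "0 \<le> M" "\<And>y. \<bar>F' y\<bar> \<le> M" "\<And>y. \<bar>F'' y\<bar> \<le> M"
  shows "\<bar>mean r (\<lambda>x. drift (scaled_total r x) * F' (scaled_total r x) + mu * F'' (scaled_total r x))\<bar>
    \<le> stein_const M / scale r + rate_const * w"
proof -
  let ?H = "\<lambda>x. drift (scaled_total r x) * F' (scaled_total r x) + mu * F'' (scaled_total r x)"
  let ?G = "generator r (\<lambda>x. F (scaled_total r x))"
  let ?B = "\<lambda>x. M * ((lam + (lam + mu) * (spread_factor * spread x)) / scale r)
      + M * ((lam * excess r x + lam + mu * \<bar>g\<bar> * scale r + mu * deficit r x) / (2 * offered r)) + rate_const * w"
  note int = integrable_steady_state[OF large]
  have s: "0 < scale r" by (rule scale_pos[OF large])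
  have n: "0 < offered r" using offered_ge_1[OF large] by simp
  have b: "\<bar>?G x - ?H x\<bar> \<le> ?B x" if "x \<in> feasible r" for x
    by (rule generator_scaled_total[OF large that F F' w w0 M])
  have "mean r ?H = - mean r (\<lambda>x. ?G x - ?H x)"
    using expectation_generator[OF large, of "\<lambda>x. F (scaled_total r x)"]
    by (subst Bochner_Integration.integral_diff[OF int int]) simp
  then have "\<bar>mean r ?H\<bar> \<le> mean r (\<lambda>x. \<bar>?G x - ?H x\<bar>)" by (simp only: abs_minus_cancel integral_abs_bound)
  also have "\<dots> \<le> mean r ?B" by (rule expectation_mono[OF large b])
  also have "\<dots> = M * ((lam + (lam + mu) * (spread_factor * mean r spread)) / scale r)
      + M * ((lam * mean r (excess r) + lam + mu * \<bar>g\<bar> * scale r + mu * mean r (deficit r)) / (2 * offered r)) + rate_const * w"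
    by (simp add: int)
  also have "\<dots> \<le> M * ((lam + (lam + mu) * (spread_factor * spread_const)) / scale r)
      + M * ((lam * (excess_mean_const * scale r) + lam * scale r + mu * \<bar>g\<bar> * scale r + mu * ((mu * \<bar>g\<bar> + lam * excess_mean_const) / mu * scale r)) / (2 * offered r)) + rate_const * w"
  proof -
    have 1: "lam \<le> lam * scale r" using scale_ge_1[OF large] rates by simp
    have d: "mean r (deficit r) \<le> (mu * \<bar>g\<bar> + lam * excess_mean_const) / mu * scale r"
      using mean_deficit_sum[OF large] by (simp add: deficit_def[abs_def])
    have a1: "lam * mean r (excess r) \<le> lam * (excess_mean_const * scale r)"
      by (rule mult_left_mono[OF mean_excess[OF large]]) (use rates in simp)
    have a2: "mu * mean r (deficit r) \<le> mu * ((mu * \<bar>g\<bar> + lam * excess_mean_const) / mu * scale r)"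
      by (rule mult_left_mono[OF d]) (use rates in simp)
    have a3: "(lam + mu) * (spread_factor * mean r spread) \<le> (lam + mu) * (spread_factor * spread_const)"
      by (rule mult_left_mono[OF mult_left_mono[OF mean_spread[OF large] spread_factor(1)]]) (use rates in simp)
    have "M * ((lam + (lam + mu) * (spread_factor * mean r spread)) / scale r) \<le> M * ((lam + (lam + mu) * (spread_factor * spread_const)) / scale r)"
      by (rule mult_left_mono[OF divide_right_mono[OF add_left_mono[OF a3]] M(1)]) (use s in simp)
    moreover have "M * ((lam * mean r (excess r) + lam + mu * \<bar>g\<bar> * scale r + mu * mean r (deficit r)) / (2 * offered r))
      \<le> M * ((lam * (excess_mean_const * scale r) + lam * scale r + mu * \<bar>g\<bar> * scale r + mu * ((mu * \<bar>g\<bar> + lam * excess_mean_const) / mu * scale r)) / (2 * offered r))"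
      by (rule mult_left_mono[OF divide_right_mono[OF add_mono[OF add_right_mono[OF add_mono[OF a1 1]] a2]] M(1)]) (use n in simp)
    ultimately show ?thesis by (rule add_right_mono[OF add_mono])
  qed
  also have "\<dots> = stein_const M / scale r + rate_const * w"
  proof -
    have o: "offered r = scale r * scale r" by (simp add: scale_square)
    have "M * ((lam * (excess_mean_const * scale r) + lam * scale r + mu * \<bar>g\<bar> * scale r + mu * ((mu * \<bar>g\<bar> + lam * excess_mean_const) / mu * scale r)) / (2 * offered r))
      = M * (lam * excess_mean_const + lam + mu * \<bar>g\<bar> + (mu * \<bar>g\<bar> + lam * excess_mean_const)) / 2 / scale r"
      unfolding o using s rates by (simp add: field_simps)
    note eq = this
    have "stein_const M / scale r = M * (lam + (lam + mu) * (spread_factor * spread_const)) / scale r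
        + M * (lam * excess_mean_const + lam + mu * \<bar>g\<bar> + (mu * \<bar>g\<bar> + lam * excess_mean_const)) / 2 / scale r"
      unfolding stein_const_def by (rule add_divide_distrib)
    then show ?thesis unfolding eq by (simp only: times_divide_eq_right)
  qed
  finally show ?thesis .
qed

lemma filterlim_scale: "filterlim scale at_top sequentially"
proof -
  have "filterlim offered at_top sequentially"
    unfolding offered_def[abs_def] using rates by real_asymp
  then show ?thesis unfolding scale_def[abs_def] by (rule filterlim_compose[OF sqrt_at_top])
qed

lemma eventually_scale_ge: "eventually (\<lambda>r. c \<le> scale r) sequentially"
  using filterlim_scale by (simp add: filterlim_at_top)

lemma eventually_large: "eventually large sequentially"
  using eventually_scale_ge[of "1 + \<bar>g\<bar>"]
proof eventually_elim
  case (elim r)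
  then have "0 < scale r * (scale r + g)" by (intro mult_pos_pos) auto
  then show ?case using elim by (simp add: large_def cap_def distrib_left scale_square mult.commute)
qed

lemma inverse_scale_tendsto: "(\<lambda>r. c / scale r) \<longlonglongrightarrow> 0"
  by (rule tendsto_divide_0[OF tendsto_const filterlim_at_top_imp_at_infinity[OF filterlim_scale]])

lemma mean_scaled_total_centred:
  assumes h: "continuous_on UNIV h" and K: "0 \<le> K" "\<And>x. K < \<bar>x\<bar> \<Longrightarrow> h x = 0"
    and centred: "(\<integral>x. h x * weight_fn x \<partial>lborel) = 0"
  shows "(\<lambda>r. mean r (\<lambda>x. h (scaled_total r x))) \<longlonglongrightarrow> 0"
proof -
  obtain F F' F'' where F: "\<And>x. (F has_real_derivative F' x) (at x)"
    and F': "\<And>x. (F' has_real_derivative F'' x) (at x)" and cF'': "continuous_on UNIV F''"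
    and F'z: "\<And>x. K < \<bar>x\<bar> \<Longrightarrow> F' x = 0" and eq: "\<And>x. drift x * F' x + mu * F'' x = h x"
    using stein_equation_solution[OF h K centred] by blast
  have F''z: "F'' x = 0" if "K < \<bar>x\<bar>" for x
    using eq[of x] F'z[OF that] K(2)[OF that] rates by simp
  have cF': "continuous_on UNIV F'" using F' by (auto simp: continuous_on_eq_continuous_at intro: DERIV_isCont)
  obtain M1 where M1: "0 \<le> M1" "\<And>x. \<bar>F' x\<bar> \<le> M1" using bounded_compact_support[OF cF' F'z] by blast
  obtain M2 where M2: "0 \<le> M2" "\<And>x. \<bar>F'' x\<bar> \<le> M2" using bounded_compact_support[OF cF'' F''z] by blast
  define M where "M = M1 + M2"
  have M: "0 \<le> M" "\<bar>F' x\<bar> \<le> M" "\<bar>F'' x\<bar> \<le> M" for x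
    using M1 M2 by (auto simp: M_def add_increasing add_increasing2)
  show ?thesis
  proof (rule tendstoI)
    fix e :: real assume e: "0 < e"
    \<comment> \<open>splits \<open>e\<close> between the two terms of \<open>mean_stein_bound\<close>\<close>
    define w where "w = e / (2 * rate_const)"
    have w: "0 < w" using e rate_const_pos by (simp add: w_def)
    obtain d where d: "0 < d" "\<And>a c. \<bar>a - c\<bar> \<le> d \<Longrightarrow> \<bar>F'' a - F'' c\<bar> \<le> w"
      using uniformly_continuous_compact_support[OF cF'' F''z w] by blast
    have "eventually (\<lambda>r. stein_const M / scale r < e / 2) sequentially"
      using order_tendstoD(2)[OF inverse_scale_tendsto[of "stein_const M"], of "e / 2"] e by simp
    moreover have "eventually (\<lambda>r. 1 / scale r < d) sequentially"
      using order_tendstoD(2)[OF inverse_scale_tendsto[of 1], of d] d by simp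
    ultimately show "eventually (\<lambda>r. dist (mean r (\<lambda>x. h (scaled_total r x))) 0 < e) sequentially"
      using eventually_large
    proof eventually_elim
      case (elim r)
      have "\<bar>mean r (\<lambda>x. drift (scaled_total r x) * F' (scaled_total r x) + mu * F'' (scaled_total r x))\<bar>
        \<le> stein_const M / scale r + rate_const * w"
        by (rule mean_stein_bound[OF elim(3) F F' _ _ M]) (use d(2) elim(2) w in auto)
      moreover have "rate_const * w = e / 2" using rate_const_pos by (simp add: w_def)
      ultimately have "\<bar>mean r (\<lambda>x. h (scaled_total r x))\<bar> < e"
        unfolding eq using elim(1) by linarith
      then show ?case by (simp add: dist_real_def)
    qed
  qed
qed

end

section \<open>Limits at a single station\<close>

context swapping_network
begin

lemma mean_overflow: "large r \<Longrightarrow> mean r (\<lambda>x. overflow r (level x i)) \<le> (1 + overflow_const) / 2 * scale r"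
proof -
  assume large: "large r"
  have s: "0 < scale r" by (rule scale_pos[OF large])
  have "overflow r (level x i) \<le> scale r / 2 + (overflow r (level x i))\<^sup>2 / (2 * scale r)" for x
    using sum_squares_bound[of "scale r" "overflow r (level x i)"] s by (simp add: field_simps power2_eq_square)
  then have "mean r (\<lambda>x. overflow r (level x i)) \<le> mean r (\<lambda>x. scale r / 2 + (overflow r (level x i))\<^sup>2 / (2 * scale r))"
    by (rule expectation_mono[OF large])
  also have "\<dots> = scale r / 2 + mean r (\<lambda>x. (overflow r (level x i))\<^sup>2) / (2 * scale r)"
    by (simp add: integrable_steady_state[OF large])
  also have "\<dots> \<le> scale r / 2 + overflow_const * offered r / (2 * scale r)"
    using s by (intro add_left_mono divide_right_mono mean_overflow_square_le[OF large]) auto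
  also have "\<dots> = (1 + overflow_const) / 2 * scale r"
    using s by (simp add: scale_square[symmetric] field_simps)
  finally show ?thesis .
qed

text \<open>The scaled level of a station with one battery less, the form in which the level found by an
  arriving vehicle appears after exchanging arrivals for completions.\<close>

definition found_level :: "nat \<Rightarrow> 's \<Rightarrow> ('s \<Rightarrow> nat) \<Rightarrow> real" where
  "found_level r i x = ((real (x i) - 1) / weight i - offered r) / scale r"

definition found_law :: "'s \<Rightarrow> nat \<Rightarrow> real measure" where
  "found_law i r = distr (measure_pmf (steady_state r)) borel (found_level r i)"

lemma real_distribution_found_law: "real_distribution (found_law i r)"
  unfolding found_law_def by (rule prob_space.real_distribution_distr) (auto intro: measure_pmf.prob_space_axioms)

lemma integral_found_law: "f \<in> borel_measurable borel \<Longrightarrow> (\<integral>z. f z \<partial>found_law i r) = mean r (\<lambda>x. f (found_level r i x))" for f :: "real \<Rightarrow> real"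
  unfolding found_law_def by (subst integral_distr) auto

lemma measure_found_law: "A \<in> sets borel \<Longrightarrow> measure (found_law i r) A = measure_pmf.prob (steady_state r) {x. found_level r i x \<in> A}"
  unfolding found_law_def by (subst measure_distr) (auto simp: vimage_def)

lemma found_level_eq: "found_level r i x = scaled_level r i x - 1 / weight i / scale r"
  by (simp add: found_level_def scaled_level_def level_def diff_divide_distrib)

lemma found_level_total_diff:
  assumes large: "large r"
  shows "\<bar>found_level r i x - scaled_total r x\<bar> \<le> (spread_factor * spread x + 1 / weight i) / scale r"
proof -
  have "0 \<le> 1 / weight i / scale r" using scale_pos[OF large] by simp
  then show ?thesis using scaled_level_total_diff[OF large, of i x]
    unfolding found_level_eq add_divide_distrib by linarith
qed

text \<open>The found level differs from the scaled total by the spread over \<open>scale r\<close>, small in the mean,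
  so uniform continuity transfers the limit from the total to a single station.\<close>

lemma mean_found_level_centred:
  assumes h: "continuous_on UNIV h" and K: "0 \<le> K" "\<And>x. K < \<bar>x\<bar> \<Longrightarrow> h x = 0"
    and centred: "(\<integral>x. h x * weight_fn x \<partial>lborel) = 0"
  shows "(\<lambda>r. mean r (\<lambda>x. h (found_level r i x))) \<longlonglongrightarrow> 0"
proof -
  have "(\<lambda>r. mean r (\<lambda>x. h (found_level r i x)) - mean r (\<lambda>x. h (scaled_total r x))) \<longlonglongrightarrow> 0"
  proof (rule tendstoI)
    fix e :: real assume e: "0 < e"
    obtain B where B: "0 \<le> B" "\<And>x. \<bar>h x\<bar> \<le> B" using bounded_compact_support[OF h K(2)] by blast
    obtain d where d: "0 < d" "\<And>a c. \<bar>a - c\<bar> \<le> d \<Longrightarrow> \<bar>h a - h c\<bar> \<le> e / 2"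
    proof -
      have "0 < e / 2" using e by simp
      from uniformly_continuous_compact_support[OF h K(2) this] that show ?thesis by blast
    qed
    \<comment> \<open>a linear bound on the modulus of continuity, as only the mean distance is known to be small\<close>
    have lip: "\<bar>h a - h c\<bar> \<le> e / 2 + 2 * B / d * \<bar>a - c\<bar>" for a c
    proof (cases "\<bar>a - c\<bar> \<le> d")
      case True
      have "0 \<le> 2 * B / d * \<bar>a - c\<bar>" using B d by simp
      then show ?thesis using d(2)[OF True] by linarith
    next
      case False
      then have "2 * B \<le> 2 * B / d * \<bar>a - c\<bar>" using B d by (simp add: field_simps mult_left_mono)
      then show ?thesis using B(2)[of a] B(2)[of c] e by linarith
    qed
    define D where "D = spread_factor * spread_const + 1 / weight i"
    have "eventually (\<lambda>r. 2 * B / d * D / scale r < e / 2) sequentially"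
      by (rule order_tendstoD(2)[OF inverse_scale_tendsto]) (use e in simp)
    with eventually_large
    show "eventually (\<lambda>r. dist (mean r (\<lambda>x. h (found_level r i x)) - mean r (\<lambda>x. h (scaled_total r x))) 0 < e) sequentially"
    proof eventually_elim
      case (elim r)
      note int = integrable_steady_state[OF elim(1)]
      have s: "0 < scale r" by (rule scale_pos[OF elim(1)])
      have "\<bar>mean r (\<lambda>x. h (found_level r i x)) - mean r (\<lambda>x. h (scaled_total r x))\<bar>
          = \<bar>mean r (\<lambda>x. h (found_level r i x) - h (scaled_total r x))\<bar>"
        by (subst Bochner_Integration.integral_diff[OF int int]) simp
      also have "\<dots> \<le> mean r (\<lambda>x. \<bar>h (found_level r i x) - h (scaled_total r x)\<bar>)" by (rule integral_abs_bound)
      also have "\<dots> \<le> mean r (\<lambda>x. e / 2 + 2 * B / d * ((spread_factor * spread x + 1 / weight i) / scale r))"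
      proof (rule expectation_mono[OF elim(1)])
        fix x
        have "2 * B / d * \<bar>found_level r i x - scaled_total r x\<bar> \<le> 2 * B / d * ((spread_factor * spread x + 1 / weight i) / scale r)"
          using B d by (intro mult_left_mono found_level_total_diff[OF elim(1)]) auto
        then show "\<bar>h (found_level r i x) - h (scaled_total r x)\<bar> \<le> e / 2 + 2 * B / d * ((spread_factor * spread x + 1 / weight i) / scale r)"
          using lip[of "found_level r i x" "scaled_total r x"] by linarith
      qed
      also have "\<dots> = e / 2 + 2 * B / d * ((spread_factor * mean r spread + 1 / weight i) / scale r)"
        by (simp add: int)
      also have "\<dots> \<le> e / 2 + 2 * B / d * (D / scale r)"
        unfolding D_def using B d s spread_factor(1) mean_spread[OF elim(1)]
        by (intro add_left_mono mult_left_mono divide_right_mono add_right_mono) auto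
      also have "\<dots> < e" using elim(2) by simp
      finally show ?case by (simp add: dist_real_def)
    qed
  qed
  from tendsto_add[OF this mean_scaled_total_centred[OF assms]] show ?thesis by simp
qed

text \<open>The overflow controls the positive and the deficit the negative values; both have means of the
  order \<open>scale r\<close>. This gives tightness.\<close>

lemma abs_found_level_le:
  assumes large: "large r"
  shows "\<bar>found_level r i x\<bar> \<le> (overflow r (level x i) + max 0 (cap r - level x i) + 1 / weight i) / scale r + \<bar>tail_start\<bar> + \<bar>g\<bar>"
proof -
  have s: "0 < scale r" by (rule scale_pos[OF large])
  have t: "tail_start * scale r \<le> \<bar>tail_start\<bar> * scale r" "g * scale r \<le> \<bar>g\<bar> * scale r"
    "0 \<le> \<bar>tail_start\<bar> * scale r"  "0 \<le> \<bar>g\<bar> * scale r"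
    using s by (auto intro!: mult_right_mono)
  have t': "- g * scale r \<le> \<bar>g\<bar> * scale r" using s by (intro mult_right_mono) auto
  have "level x i - offered r \<le> overflow r (level x i) + \<bar>tail_start\<bar> * scale r"
    using t by (auto simp: overflow_def)
  moreover have "offered r - level x i \<le> max 0 (cap r - level x i) + \<bar>g\<bar> * scale r"
    using t t' by (auto simp: cap_def)
  moreover have "0 \<le> max 0 (cap r - level x i)" "0 \<le> overflow r (level x i)" by auto
  ultimately have "\<bar>level x i - offered r\<bar> \<le> overflow r (level x i) + max 0 (cap r - level x i) + \<bar>tail_start\<bar> * scale r + \<bar>g\<bar> * scale r"
    using t by linarith
  then have "\<bar>scaled_level r i x\<bar> \<le> (overflow r (level x i) + max 0 (cap r - level x i) + \<bar>tail_start\<bar> * scale r + \<bar>g\<bar> * scale r) / scale r"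
    using s by (simp add: scaled_level_def divide_right_mono)
  also have "\<dots> = (overflow r (level x i) + max 0 (cap r - level x i)) / scale r + \<bar>tail_start\<bar> + \<bar>g\<bar>"
    using s by (simp add: add_divide_distrib)
  moreover have "0 \<le> 1 / weight i / scale r" using s by simp
  ultimately show ?thesis unfolding found_level_eq add_divide_distrib by linarith
qed

definition found_moment :: "'s \<Rightarrow> real" where
  "found_moment i = (1 + overflow_const) / 2 + deficit_const + 1 / weight i + \<bar>tail_start\<bar> + \<bar>g\<bar>"

lemma mean_abs_found_level:
  assumes large: "large r"
  shows "mean r (\<lambda>x. \<bar>found_level r i x\<bar>) \<le> found_moment i"
proof -
  note int = integrable_steady_state[OF large]
  have s: "0 < scale r" "1 \<le> scale r" using scale_pos[OF large] scale_ge_1[OF large] by auto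
  have "mean r (\<lambda>x. \<bar>found_level r i x\<bar>) \<le> mean r (\<lambda>x. (overflow r (level x i) + max 0 (cap r - level x i) + 1 / weight i) / scale r + \<bar>tail_start\<bar> + \<bar>g\<bar>)"
    by (rule expectation_mono[OF large abs_found_level_le[OF large]])
  also have "\<dots> = (mean r (\<lambda>x. overflow r (level x i)) + mean r (\<lambda>x. max 0 (cap r - level x i)) + 1 / weight i) / scale r + \<bar>tail_start\<bar> + \<bar>g\<bar>"
    by (simp add: int)
  also have "\<dots> \<le> ((1 + overflow_const) / 2 * scale r + deficit_const * scale r + 1 / weight i * scale r) / scale r + \<bar>tail_start\<bar> + \<bar>g\<bar>"
  proof -
    have "1 / weight i * 1 \<le> 1 / weight i * scale r" using s by (intro mult_left_mono) auto
    then show ?thesis using s mean_overflow[OF large, of i] mean_deficit[OF large, of i]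
      by (intro add_right_mono divide_right_mono add_mono) auto
  qed
  also have "\<dots> = found_moment i" using s by (simp add: found_moment_def add_divide_distrib)
  finally show ?thesis .
qed

lemma weak_conv_found_law: "weak_conv_m (found_law i) steady_law"
proof (rule weak_conv_steady_law[OF real_distribution_found_law])
  fix h K assume h: "continuous_on UNIV h" "0 \<le> K" "\<And>x. K < \<bar>x\<bar> \<Longrightarrow> h x = 0" "(\<integral>x. h x * weight_fn x \<partial>lborel) = 0"
  show "(\<lambda>n. \<integral>x. h x \<partial>found_law i n) \<longlonglongrightarrow> 0"
    using mean_found_level_centred[OF h] borel_measurable_continuous_onI[OF h(1)] by (simp add: integral_found_law)
next
  fix e :: real assume e: "0 < e"
  define R where "R = (\<bar>found_moment i\<bar> + 1) / e"
  have R: "0 < R" using e by (simp add: R_def add_pos_pos)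
  have "measure (found_law i r) {x. R < \<bar>x\<bar>} \<le> e" if large: "large r" for r
  proof -
    have "measure (found_law i r) {x. R < \<bar>x\<bar>} = mean r (indicator {x. R < \<bar>found_level r i x\<bar>})"
      by (subst measure_found_law) auto
    also have "\<dots> \<le> mean r (\<lambda>x. \<bar>found_level r i x\<bar> / R)"
      by (rule expectation_mono[OF large]) (use R in \<open>auto split: split_indicator simp: field_simps\<close>)
    also have "\<dots> = mean r (\<lambda>x. \<bar>found_level r i x\<bar>) / R" by simp
    also have "\<dots> \<le> (\<bar>found_moment i\<bar> + 1) / R"
      using R mean_abs_found_level[OF large, of i] by (intro divide_right_mono) auto
    also have "\<dots> = e"
    proof -
      have "\<bar>found_moment i\<bar> + 1 \<noteq> 0" by linarith
      then show ?thesis using e by (simp add: R_def)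
    qed
    finally show ?thesis .
  qed
  then show "\<exists>R. eventually (\<lambda>r. measure (found_law i r) {x. R < \<bar>x\<bar>} \<le> e) sequentially"
    by (intro exI[of _ R] eventually_mono[OF eventually_large])
qed

text \<open>The steady law has no atom at \<open>b\<close>.\<close>

lemma prob_found_level_ge_tendsto:
  "(\<lambda>r. measure_pmf.prob (steady_state r) {x. b \<le> found_level r i x}) \<longlonglongrightarrow> measure steady_law {b..}"
proof -
  interpret N: real_distribution steady_law by (rule real_distribution_steady_law)
  have "measure steady_law {b} = 0" by (rule measure_steady_law_null) auto
  moreover have "frontier {b..} = {b}" by (rule frontier_real_atLeast)
  ultimately have "emeasure steady_law (frontier {b..}) = 0" by (simp add: N.emeasure_eq_measure)
  with weak_conv_imp_continuity_set_conv[OF real_distribution_found_law real_distribution_steady_law weak_conv_found_law, of "{b..}" i]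
  show ?thesis by (simp add: measure_found_law)
qed

lemma mean_found_excess_square:
  assumes large: "large r"
  shows "mean r (\<lambda>x. (max 0 (found_level r i x - b))\<^sup>2) \<le> excess_const"
proof -
  note int = integrable_steady_state[OF large]
  have s: "0 < scale r" by (rule scale_pos[OF large])
  have "(max 0 (found_level r i x - b))\<^sup>2 \<le> 2 * ((overflow r (level x i))\<^sup>2 / offered r) + 2 * (tail_start - b)\<^sup>2" for x
  proof -
    have "tail_start * scale r - b * scale r = (tail_start - b) * scale r" by (simp add: left_diff_distrib)
    moreover have "level x i - offered r \<le> overflow r (level x i) + tail_start * scale r" by (auto simp: overflow_def)
    ultimately have "level x i - offered r - b * scale r \<le> overflow r (level x i) + (tail_start - b) * scale r" by linarith
    then have "(level x i - offered r - b * scale r) / scale r \<le> (overflow r (level x i) + (tail_start - b) * scale r) / scale r"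
      using s by (intro divide_right_mono) auto
    then have "scaled_level r i x - b \<le> overflow r (level x i) / scale r + (tail_start - b)"
      using s by (simp add: scaled_level_def add_divide_distrib diff_divide_distrib)
    moreover have "0 \<le> 1 / weight i / scale r" using s by simp
    ultimately have "found_level r i x - b \<le> overflow r (level x i) / scale r + (tail_start - b)"
      unfolding found_level_eq by linarith
    moreover have "0 \<le> overflow r (level x i) / scale r" "0 \<le> tail_start - b" using s tail_start_ge by auto
    ultimately have "max 0 (found_level r i x - b) \<le> overflow r (level x i) / scale r + (tail_start - b)" by linarith
    then have "(max 0 (found_level r i x - b))\<^sup>2 \<le> (overflow r (level x i) / scale r + (tail_start - b))\<^sup>2"
      by (intro power_mono) auto
    also have "\<dots> \<le> 2 * (overflow r (level x i) / scale r)\<^sup>2 + 2 * (tail_start - b)\<^sup>2"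
      using sum_squares_bound[of "overflow r (level x i) / scale r" "tail_start - b"] by (simp add: power2_sum)
    finally show ?thesis by (simp add: power_divide scale_def)
  qed
  then have "mean r (\<lambda>x. (max 0 (found_level r i x - b))\<^sup>2)
      \<le> mean r (\<lambda>x. 2 * ((overflow r (level x i))\<^sup>2 / offered r) + 2 * (tail_start - b)\<^sup>2)"
    by (rule expectation_mono[OF large])
  also have "\<dots> = 2 * (mean r (\<lambda>x. (overflow r (level x i))\<^sup>2) / offered r) + 2 * (tail_start - b)\<^sup>2"
    by (simp add: int)
  also have "\<dots> \<le> 2 * overflow_const + 2 * (tail_start - b)\<^sup>2"
    using mean_overflow_square_le[OF large, of i] offered_ge_1[OF large]
    by (simp add: pos_divide_le_eq)
  finally show ?thesis by (simp add: excess_const_def)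
qed

text \<open>Weak convergence covers the excess truncated at a level \<open>R\<close>; the remainder is at most the second
  moment over \<open>R\<close>, uniformly in \<open>r\<close>.\<close>

lemma mean_found_excess_tendsto:
  "(\<lambda>r. mean r (\<lambda>x. max 0 (found_level r i x - b))) \<longlonglongrightarrow> moment3 / total_mass"
proof (rule tendstoI)
  fix e :: real assume e: "0 < e"
  interpret N: real_distribution steady_law by (rule real_distribution_steady_law)
  define f where "f R z = min (max 0 (z - b)) R" for R z :: real
  have fm [measurable]: "f R \<in> borel_measurable borel" for R unfolding f_def by measurable
  have lim: "(\<lambda>k. \<integral>z. f (real k) z \<partial>steady_law) \<longlonglongrightarrow> (\<integral>z. max 0 (z - b) \<partial>steady_law)"
  proof (rule integral_dominated_convergence[where w = "\<lambda>z. max 0 (z - b)"])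
    show "integrable steady_law (\<lambda>z. max 0 (z - b))"
      using has_bochner_integral_steady_law_excess by (rule integrable.intros)
    show "AE z in steady_law. (\<lambda>k. f (real k) z) \<longlonglongrightarrow> max 0 (z - b)"
    proof (intro AE_I2 tendsto_eventually)
      fix z
      obtain N :: nat where N: "max 0 (z - b) \<le> real N" using real_arch_simple by blast
      show "eventually (\<lambda>k. f (real k) z = max 0 (z - b)) sequentially"
        by (rule eventually_sequentiallyI[of N]) (use N in \<open>auto simp: f_def min_def\<close>)
    qed
    show "AE z in steady_law. norm (f (real k) z) \<le> max 0 (z - b)" for k
      by (intro AE_I2) (auto simp: f_def)
  qed auto
  have J: "(\<integral>z. max 0 (z - b) \<partial>steady_law) = moment3 / total_mass"
    using has_bochner_integral_steady_law_excess by (rule has_bochner_integral_integral_eq)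
  have "eventually (\<lambda>k. \<bar>(\<integral>z. f (real k) z \<partial>steady_law) - moment3 / total_mass\<bar> < e / 3) sequentially"
    using tendstoD[OF lim, of "e / 3"] e unfolding J by (simp add: dist_real_def)
  moreover have "eventually (\<lambda>k. excess_const / real k < e / 3) sequentially"
    using order_tendstoD(2)[OF lim_const_over_n[of excess_const], of "e / 3"] e by simp
  ultimately have "eventually (\<lambda>k. \<bar>(\<integral>z. f (real k) z \<partial>steady_law) - moment3 / total_mass\<bar> < e / 3 \<and> excess_const / real k < e / 3 \<and> 0 < k) sequentially"
    using eventually_gt_at_top[of 0] by eventually_elim auto
  then obtain k :: nat where k: "\<bar>(\<integral>z. f (real k) z \<partial>steady_law) - moment3 / total_mass\<bar> < e / 3"
    "excess_const / real k < e / 3" "0 < k" by (auto simp: eventually_sequentially)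
  define R where "R = real k"
  have R: "0 < R" using k by (simp add: R_def)
  have "isCont (f R) z" for z unfolding f_def by (intro continuous_intros)
  moreover have "norm (f R z) \<le> R" for z using R by (auto simp: f_def)
  ultimately have "(\<lambda>r. \<integral>z. f R z \<partial>found_law i r) \<longlonglongrightarrow> (\<integral>z. f R z \<partial>steady_law)"
    using weak_conv_imp_integral_bdd_continuous_conv[OF real_distribution_found_law real_distribution_steady_law weak_conv_found_law]
    by blast
  then have "(\<lambda>r. mean r (\<lambda>x. f R (found_level r i x))) \<longlonglongrightarrow> (\<integral>z. f R z \<partial>steady_law)"
    by (simp add: integral_found_law)
  then have "eventually (\<lambda>r. \<bar>mean r (\<lambda>x. f R (found_level r i x)) - (\<integral>z. f R z \<partial>steady_law)\<bar> < e / 3) sequentially"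
    using e by (auto dest!: tendstoD[where e = "e / 3"] simp: dist_real_def)
  with eventually_large
  show "eventually (\<lambda>r. dist (mean r (\<lambda>x. max 0 (found_level r i x - b))) (moment3 / total_mass) < e) sequentially"
  proof eventually_elim
    case (elim r)
    note int = integrable_steady_state[OF elim(1)]
    have z: "0 \<le> z - min z R" "z - min z R \<le> z\<^sup>2 / R" if "0 \<le> z" for z :: real
    proof -
      show "z - min z R \<le> z\<^sup>2 / R"
      proof (cases "z \<le> R")
        case True
        then show ?thesis using R by simp
      next
        case False
        have "z * R \<le> z * z" using False that by (intro mult_left_mono) auto
        then have "z \<le> z\<^sup>2 / R" using R by (simp add: pos_le_divide_eq power2_eq_square)
        then show ?thesis using False R by simp
      qed
    qed auto
    let ?d = "\<lambda>x. max 0 (found_level r i x - b) - f R (found_level r i x)"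
    have "mean r ?d \<le> mean r (\<lambda>x. (max 0 (found_level r i x - b))\<^sup>2 / R)"
      by (rule expectation_mono[OF elim(1)]) (use z(2) in \<open>simp add: f_def\<close>)
    also have "\<dots> = mean r (\<lambda>x. (max 0 (found_level r i x - b))\<^sup>2) / R" by simp
    also have "\<dots> \<le> excess_const / R"
      using R by (intro divide_right_mono mean_found_excess_square[OF elim(1)]) auto
    also have "\<dots> < e / 3" using k by (simp add: R_def)
    finally have "mean r ?d < e / 3" .
    moreover have "0 \<le> mean r ?d"
      by (rule integral_nonneg_AE) (use z(1) in \<open>simp add: f_def\<close>)
    moreover have "mean r ?d = mean r (\<lambda>x. max 0 (found_level r i x - b)) - mean r (\<lambda>x. f R (found_level r i x))"
      by (rule Bochner_Integration.integral_diff[OF int int])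
    ultimately show ?case using elim(2) k(1) unfolding R_def dist_real_def by linarith
  qed
qed

lemma scale_over_cap_tendsto: "(\<lambda>r. scale r / cap r) \<longlonglongrightarrow> 0" and offered_over_cap_tendsto: "(\<lambda>r. offered r / cap r) \<longlonglongrightarrow> 1"
proof -
  have f: "filterlim (\<lambda>r. scale r + g) at_top sequentially"
    using filterlim_tendsto_add_at_top[OF tendsto_const filterlim_scale, of g] by (simp add: add.commute)
  have i: "(\<lambda>r. 1 / (scale r + g)) \<longlonglongrightarrow> 0"
    by (rule tendsto_divide_0[OF tendsto_const filterlim_at_top_imp_at_infinity[OF f]])
  have c: "eventually (\<lambda>r. scale r / cap r = 1 / (scale r + g) \<and> offered r / cap r = 1 - g * (1 / (scale r + g))) sequentially"
    using eventually_large
  proof eventually_elim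
    case (elim r)
    have s: "0 < scale r" by (rule scale_pos[OF elim])
    have cap: "cap r = scale r * (scale r + g)" by (simp add: cap_def distrib_left scale_square mult.commute)
    then have "0 < scale r + g" using cap_pos[OF elim] s by (simp add: zero_less_mult_iff)
    then have "scale r / cap r = 1 / (scale r + g)" "offered r / cap r = scale r / (scale r + g)"
      unfolding cap scale_square[symmetric] using s by simp_all
    moreover have "scale r / (scale r + g) = 1 - g * (1 / (scale r + g))"
      using \<open>0 < scale r + g\<close> by (simp add: field_simps)
    ultimately show ?case by simp
  qed
  show "(\<lambda>r. scale r / cap r) \<longlonglongrightarrow> 0"
    by (rule Lim_transform_eventually[OF i]) (use c in \<open>auto elim: eventually_mono\<close>)
  have "(\<lambda>r. 1 - g * (1 / (scale r + g))) \<longlonglongrightarrow> 1 - g * 0" by (intro tendsto_intros i)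
  then have "(\<lambda>r. 1 - g * (1 / (scale r + g))) \<longlonglongrightarrow> 1" by simp
  then show "(\<lambda>r. offered r / cap r) \<longlonglongrightarrow> 1"
    by (rule Lim_transform_eventually) (use c in \<open>auto elim: eventually_mono\<close>)
qed

lemma charger_utilization_bounds:
  assumes large: "large r"
  shows "1 - deficit_const * (scale r / cap r) \<le> charger_utilization r i" "charger_utilization r i \<le> 1"
proof -
  note int = integrable_steady_state[OF large]
  have c: "0 < cap r" by (rule cap_pos[OF large])
  have u: "min (real (x i)) (chargers r i) / chargers r i = 1 - max 0 (cap r - level x i) / cap r" for x
  proof -
    have "min (real (x i)) (chargers r i) = weight i * min (level x i) (cap r)"
      unfolding chargers_eq weight_level[symmetric] by (simp add: min_mult_distrib_left)
    then show ?thesis using c by (auto simp: chargers_eq field_simps min_def max_def)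
  qed
  have "charger_utilization r i = 1 - mean r (\<lambda>x. max 0 (cap r - level x i)) / cap r"
    unfolding charger_utilization_def u by (simp add: int)
  moreover have "mean r (\<lambda>x. max 0 (cap r - level x i)) / cap r \<le> deficit_const * scale r / cap r"
    using c by (intro divide_right_mono mean_deficit[OF large]) auto
  moreover have "0 \<le> mean r (\<lambda>x. max 0 (cap r - level x i))" by (intro integral_nonneg_AE) auto
  ultimately show "1 - deficit_const * (scale r / cap r) \<le> charger_utilization r i" "charger_utilization r i \<le> 1"
    using c by auto
qed

lemma charger_utilization_tendsto: "(\<lambda>r. charger_utilization r i) \<longlonglongrightarrow> 1"
proof (rule tendsto_sandwich)
  show "eventually (\<lambda>r. 1 - deficit_const * (scale r / cap r) \<le> charger_utilization r i) sequentially"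
    by (rule eventually_mono[OF eventually_large charger_utilization_bounds(1)])
  show "eventually (\<lambda>r. charger_utilization r i \<le> 1) sequentially"
    by (rule eventually_mono[OF eventually_large charger_utilization_bounds(2)])
  have "(\<lambda>r. 1 - deficit_const * (scale r / cap r)) \<longlonglongrightarrow> 1 - deficit_const * 0"
    by (intro tendsto_intros scale_over_cap_tendsto)
  then show "(\<lambda>r. 1 - deficit_const * (scale r / cap r)) \<longlonglongrightarrow> 1" by simp
qed simp

text \<open>A battery that is fully charged at a station counts either towards the idle charging capacity or
  towards the difference of spares and charging points, both of order \<open>scale r\<close>.\<close>

lemma battery_utilization_tendsto: "(\<lambda>r. battery_utilization r i) \<longlonglongrightarrow> 1"
proof (rule tendsto_sandwich)
  have bounds: "1 - (deficit_const + (b - g)) * (scale r / cap r) \<le> battery_utilization r i \<and> battery_utilization r i \<le> 1"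
    if large: "large r" for r
  proof -
    note int = integrable_steady_state[OF large]
    have c: "0 < cap r" by (rule cap_pos[OF large])
    let ?B = "spares r i"
    have B: "0 < ?B" by (rule spares_pos[OF large])
    have wB: "weight i * cap r \<le> ?B" using chargers_le_spares[OF large, of i] by (simp add: chargers_eq)
    have low: "1 - (max 0 (cap r - level x i) + (b - g) * scale r) / cap r \<le> real (x i) / (?B + max 0 (real (x i) - ?B))" for x
    proof (cases "?B \<le> real (x i)")
      case True
      have "0 \<le> (max 0 (cap r - level x i) + (b - g) * scale r) / cap r"
        using c g_le_b by (intro divide_nonneg_pos add_nonneg_nonneg) auto
      then show ?thesis using True B by simp
    next
      case False
      have e: "?B - real (x i) = weight i * ((cap r - level x i) + (b - g) * scale r)"
        by (simp add: spares_eq cap_def algebra_simps)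
      have "1 - real (x i) / ?B = weight i * ((cap r - level x i) + (b - g) * scale r) / ?B"
        using B unfolding e[symmetric] by (simp add: diff_divide_distrib)
      also have "\<dots> \<le> weight i * (max 0 (cap r - level x i) + (b - g) * scale r) / ?B"
        using B by (intro divide_right_mono mult_left_mono) auto
      also have "\<dots> \<le> weight i * (max 0 (cap r - level x i) + (b - g) * scale r) / (weight i * cap r)"
        using wB c g_le_b B by (intro divide_left_mono mult_nonneg_nonneg add_nonneg_nonneg) auto
      also have "\<dots> = (max 0 (cap r - level x i) + (b - g) * scale r) / cap r" by simp
      finally show ?thesis using False by simp
    qed
    have "mean r (\<lambda>x. 1 - (max 0 (cap r - level x i) + (b - g) * scale r) / cap r) \<le> battery_utilization r i"
      unfolding battery_utilization_def by (rule expectation_mono[OF large low])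
    moreover have "mean r (\<lambda>x. 1 - (max 0 (cap r - level x i) + (b - g) * scale r) / cap r)
        = 1 - (mean r (\<lambda>x. max 0 (cap r - level x i)) + (b - g) * scale r) / cap r"
      by (simp add: int)
    moreover have "(mean r (\<lambda>x. max 0 (cap r - level x i)) + (b - g) * scale r) / cap r
        \<le> (deficit_const * scale r + (b - g) * scale r) / cap r"
      using c by (intro divide_right_mono add_right_mono mean_deficit[OF large]) auto
    moreover have "(deficit_const * scale r + (b - g) * scale r) / cap r = (deficit_const + (b - g)) * (scale r / cap r)"
      by (simp add: distrib_right)
    moreover have "battery_utilization r i \<le> mean r (\<lambda>_. 1)"
      unfolding battery_utilization_def
    proof (rule expectation_mono[OF large])
      fix x
      have "real (x i) \<le> ?B + max 0 (real (x i) - ?B)" "0 < ?B + max 0 (real (x i) - ?B)" using B by auto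
      then show "real (x i) / (?B + max 0 (real (x i) - ?B)) \<le> 1" by simp
    qed
    ultimately show ?thesis by simp
  qed
  show "eventually (\<lambda>r. 1 - (deficit_const + (b - g)) * (scale r / cap r) \<le> battery_utilization r i) sequentially"
    by (rule eventually_mono[OF eventually_large bounds[THEN conjunct1]])
  show "eventually (\<lambda>r. battery_utilization r i \<le> 1) sequentially"
    by (rule eventually_mono[OF eventually_large bounds[THEN conjunct2]])
  have "(\<lambda>r. 1 - (deficit_const + (b - g)) * (scale r / cap r)) \<longlonglongrightarrow> 1 - (deficit_const + (b - g)) * 0"
    by (intro tendsto_intros scale_over_cap_tendsto)
  then show "(\<lambda>r. 1 - (deficit_const + (b - g)) * (scale r / cap r)) \<longlonglongrightarrow> 1" by simp
qed simp

end

section \<open>The waiting time given the state found\<close>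

lemma pmf_jump_pmf:
  fixes q :: "'a \<Rightarrow> 'a \<Rightarrow> real"
  assumes q0: "\<And>y. 0 \<le> q x y" and T: "finite T" "\<And>y. y \<notin> T \<Longrightarrow> q x y = 0" and pos: "0 < exit_rate q x"
  shows "pmf (jump_pmf q x) y = (if y = x then 0 else q x y / exit_rate q x)"
proof -
  define w where "w y = (if y = x then 0 else q x y / exit_rate q x)" for y
  have w0: "0 \<le> w y" for y using q0 pos by (simp add: w_def)
  have "(\<integral>\<^sup>+y. ennreal (w y) \<partial>count_space UNIV) = (\<Sum>y\<in>T. ennreal (w y))"
    using T by (intro nn_integral_count_space') (auto simp: w_def)
  also have "\<dots> = ennreal (\<Sum>y\<in>T. w y)" using w0 by (simp add: sum_ennreal)
  also have "(\<Sum>y\<in>T. w y) = (\<Sum>y\<in>T - {x}. q x y / exit_rate q x)"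
    using T(1) by (intro sum.mono_neutral_cong_right) (auto simp: w_def)
  also have "\<dots> = 1"
    using exit_rate_finite[OF T(1), of q x, OF T(2)] pos by (simp add: sum_divide_distrib[symmetric])
  finally have "pmf (embed_pmf w) y = w y" using w0 by (intro pmf_embed_pmf) auto
  then show ?thesis by (simp add: jump_pmf_def w_def[abs_def])
qed

lemma nn_integral_jump_pmf:
  fixes q :: "'a \<Rightarrow> 'a \<Rightarrow> real" and f :: "'a \<Rightarrow> real"
  assumes q0: "\<And>y. 0 \<le> q x y" and T: "finite T" "\<And>y. y \<notin> T \<Longrightarrow> q x y = 0" and pos: "0 < exit_rate q x"
    and self: "q x x = 0" and f0: "\<And>y. 0 \<le> f y"
  shows "(\<integral>\<^sup>+y. ennreal (f y) \<partial>measure_pmf (jump_pmf q x)) = ennreal ((\<Sum>y\<in>T. q x y * f y) / exit_rate q x)"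
proof -
  note pj = pmf_jump_pmf[where q = q and T = T, OF q0 T pos]
  have "(\<integral>\<^sup>+y. ennreal (f y) \<partial>measure_pmf (jump_pmf q x))
      = (\<integral>\<^sup>+y. ennreal (pmf (jump_pmf q x) y) * ennreal (f y) \<partial>count_space UNIV)"
    by (rule nn_integral_measure_pmf)
  also have "\<dots> = (\<Sum>y\<in>T. ennreal (pmf (jump_pmf q x) y) * ennreal (f y))"
    using T by (intro nn_integral_count_space') (auto simp: pj)
  also have "\<dots> = (\<Sum>y\<in>T. ennreal (q x y * f y / exit_rate q x))"
    using q0 f0 pos self by (intro sum.cong refl) (auto simp: pj ennreal_mult[symmetric])
  also have "\<dots> = ennreal (\<Sum>y\<in>T. q x y * f y / exit_rate q x)"
    using q0 f0 pos by (intro sum_ennreal) auto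
  finally show ?thesis by (simp add: sum_divide_distrib)
qed

context swapping_network
begin

context
  fixes r :: nat and i :: 's
begin

definition service_rate :: real where "service_rate = mu * chargers r i"

definition total_rate :: "('s \<Rightarrow> nat) \<Rightarrow> real" where
  "total_rate y = (\<Sum>j\<in>UNIV. arrival_rate r j y + charge_rate r j y)"

definition total_rate_bound :: real where "total_rate_bound = lam * real r + mu * cap r"

text \<open>The state of the tagged chain after a network jump to \<open>z\<close>.\<close>

definition tagged_succ :: "('s \<Rightarrow> nat) \<Rightarrow> nat \<Rightarrow> ('s \<Rightarrow> nat) \<Rightarrow> ('s \<Rightarrow> nat) \<times> nat" where
  "tagged_succ y m z = (z, if z i < y i then m - 1 else m)"

text \<open>A vehicle that needs \<open>m\<close> more completions has \<open>m - 1\<close> vehicles waiting before it, so at least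
  \<open>m\<close> batteries in excess of the spares are in need of charging. In particular all charging points
  are busy.\<close>

definition tagged_states :: "(('s \<Rightarrow> nat) \<times> nat) set" where
  "tagged_states = {(y, m). m = 0 \<or> spares r i + real m \<le> real (y i)}"

definition wait_law :: "('s \<Rightarrow> nat) \<Rightarrow> real measure" where
  "wait_law x = hitting_time_law (tagged_rate r i) {(y, m). m = 0} (x(i := x i + 1), completions_needed r i x)"

lemma tagged_rate_eq: "tagged_rate r i (y, m) w = (if w = tagged_succ y m (fst w) then trans_rate r y (fst w) else 0)"
  by (cases w) (simp add: tagged_rate_def tagged_succ_def)

lemma tagged_rate_self: "tagged_rate r i s s = 0"
  by (cases s) (simp add: tagged_rate_eq tagged_succ_def trans_rate_self)

lemma tagged_rate_support: "w \<notin> tagged_succ y m ` neighbours y \<Longrightarrow> tagged_rate r i (y, m) w = 0"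
  using trans_rate_neighbours[of "fst w" y r] by (auto simp: tagged_rate_eq)

lemma finite_tagged_support: "finite (tagged_succ y m ` neighbours y)"
  by (simp add: finite_neighbours)

lemma inj_tagged_succ: "inj_on (tagged_succ y m) A"
  by (auto simp: inj_on_def tagged_succ_def)

lemma initial_tagged_state: "(x(i := x i + 1), completions_needed r i x) \<in> tagged_states"
  by (auto simp: tagged_states_def completions_needed_def) linarith

context
  assumes large: "large r"
begin

lemma service_rate_pos: "0 < service_rate"
  using rates chargers_pos[OF large, of i] by (simp add: service_rate_def)

lemma total_rate_le_bound: "total_rate y \<le> total_rate_bound"
  using exit_rate_le[OF large, of y] by (simp add: exit_rate_trans_rate[OF large] total_rate_def total_rate_bound_def)

lemma service_rate_le_bound: "service_rate \<le> total_rate_bound"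
proof -
  have "weight i * cap r \<le> 1 * cap r"
    using weight_le_1[of i] cap_pos[OF large] by (intro mult_right_mono) auto
  then have "mu * (weight i * cap r) \<le> mu * cap r" using rates by simp
  moreover have "0 \<le> lam * real r" using rates by simp
  ultimately show ?thesis by (simp add: service_rate_def chargers_eq total_rate_bound_def)
qed

lemma tagged_rate_nonneg: "0 \<le> tagged_rate r i s w"
  by (cases s) (simp add: tagged_rate_eq trans_rate_nonneg[OF large])

lemma sum_tagged_rate: "(\<Sum>w\<in>tagged_succ y m ` neighbours y. tagged_rate r i (y, m) w * f w)
   = (\<Sum>j\<in>UNIV. arrival_rate r j y * f (tagged_succ y m (y(j := y j + 1))) + charge_rate r j y * f (tagged_succ y m (y(j := y j - 1))))"
proof -
  have "(\<Sum>w\<in>tagged_succ y m ` neighbours y. tagged_rate r i (y, m) w * f w) = (\<Sum>z\<in>neighbours y. trans_rate r y z * f (tagged_succ y m z))"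
    by (subst sum.reindex[OF inj_tagged_succ]) (auto simp: tagged_rate_eq tagged_succ_def intro!: sum.cong)
  also have "\<dots> = (\<Sum>j\<in>UNIV. arrival_rate r j y * f (tagged_succ y m (y(j := y j + 1))) + charge_rate r j y * f (tagged_succ y m (y(j := y j - 1))))"
    by (rule sum_trans_rate[OF large]) (simp_all add: neighbours_def)
  finally show ?thesis .
qed

lemma exit_rate_tagged: "exit_rate (tagged_rate r i) (y, m) = total_rate y"
proof -
  have "exit_rate (tagged_rate r i) (y, m) = (\<Sum>w\<in>tagged_succ y m ` neighbours y - {(y, m)}. tagged_rate r i (y, m) w)"
    by (rule exit_rate_finite[where q = "tagged_rate r i" and x = "(y, m)", OF finite_tagged_support tagged_rate_support])
  also have "\<dots> = (\<Sum>w\<in>tagged_succ y m ` neighbours y. tagged_rate r i (y, m) w * 1)"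
    by (simp, intro sum.mono_neutral_left finite_tagged_support) (auto simp: tagged_rate_self)
  also have "\<dots> = total_rate y" by (subst sum_tagged_rate) (simp add: total_rate_def)
  finally show ?thesis .
qed

lemma charge_rate_tagged:
  assumes "(y, m) \<in> tagged_states" "m \<noteq> 0"
  shows "charge_rate r i y = service_rate" "0 < y i"
proof -
  have "spares r i < real (y i)" using assms by (auto simp: tagged_states_def)
  then show "charge_rate r i y = service_rate" "0 < y i"
    using chargers_le_spares[OF large, of i] spares_pos[OF large, of i]
    by (auto simp: charge_rate_def service_rate_def min_def)
qed

lemma total_rate_pos:
  assumes "(y, m) \<in> tagged_states" "m \<noteq> 0"
  shows "service_rate \<le> total_rate y" "0 < total_rate y"
proof -
  have "charge_rate r i y \<le> arrival_rate r i y + charge_rate r i y" by simp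
  also have "\<dots> \<le> total_rate y" unfolding total_rate_def
    by (rule member_le_sum) (auto intro!: add_nonneg_nonneg charge_rate_nonneg[OF large])
  finally show "service_rate \<le> total_rate y" using charge_rate_tagged[OF assms] by simp
  then show "0 < total_rate y" using service_rate_pos by simp
qed

text \<open>The next jump is a completion at the station of the tagged vehicle with probability
  \<open>service_rate / total_rate y\<close>, whatever the rest of the state: all charging points are busy.\<close>

lemma nn_integral_tagged_jump:
  assumes s: "(y, m) \<in> tagged_states" "m \<noteq> 0" and f0: "\<And>n. 0 \<le> f n"
  shows "(\<integral>\<^sup>+w. ennreal (f (snd w)) \<partial>measure_pmf (jump_pmf (tagged_rate r i) (y, m)))
    = ennreal (f m + service_rate / total_rate y * (f (m - 1) - f m))"
proof -
  have "(\<Sum>w\<in>tagged_succ y m ` neighbours y. tagged_rate r i (y, m) w * f (snd w))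
      = (\<Sum>j\<in>UNIV. (arrival_rate r j y + charge_rate r j y) * f m + (if j = i then charge_rate r i y * (f (m - 1) - f m) else 0))"
  proof (subst sum_tagged_rate, intro sum.cong refl)
    fix j
    have alg: "A * u + C * u = (A + C) * u + 0" "A * u + C * v = (A + C) * u + C * (v - u)" for A C u v :: real
      by (simp_all add: distrib_right right_diff_distrib)
    have up: "snd (tagged_succ y m (y(j := y j + 1))) = m" by (simp add: tagged_succ_def)
    have down: "snd (tagged_succ y m (y(j := y j - 1))) = (if j = i then m - 1 else m)"
      using charge_rate_tagged(2)[OF s] by (simp add: tagged_succ_def)
    show "arrival_rate r j y * f (snd (tagged_succ y m (y(j := y j + 1)))) + charge_rate r j y * f (snd (tagged_succ y m (y(j := y j - 1))))
        = (arrival_rate r j y + charge_rate r j y) * f m + (if j = i then charge_rate r i y * (f (m - 1) - f m) else 0)"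
      unfolding up down
    proof (cases "j = i")
      case True
      show "arrival_rate r j y * f m + charge_rate r j y * f (if j = i then m - 1 else m)
          = (arrival_rate r j y + charge_rate r j y) * f m + (if j = i then charge_rate r i y * (f (m - 1) - f m) else 0)"
        unfolding True if_P[OF refl] by (rule alg(2))
    next
      case False
      show "arrival_rate r j y * f m + charge_rate r j y * f (if j = i then m - 1 else m)
          = (arrival_rate r j y + charge_rate r j y) * f m + (if j = i then charge_rate r i y * (f (m - 1) - f m) else 0)"
        unfolding if_not_P[OF False] by (rule alg(1))
    qed
  qed
  also have "\<dots> = total_rate y * f m + service_rate * (f (m - 1) - f m)"
    by (simp add: sum.distrib sum_distrib_right[symmetric] total_rate_def charge_rate_tagged[OF s])
  finally have sum: "(\<Sum>w\<in>tagged_succ y m ` neighbours y. tagged_rate r i (y, m) w * f (snd w))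
      = total_rate y * f m + service_rate * (f (m - 1) - f m)" .
  have "(\<integral>\<^sup>+w. ennreal (f (snd w)) \<partial>measure_pmf (jump_pmf (tagged_rate r i) (y, m)))
      = ennreal ((\<Sum>w\<in>tagged_succ y m ` neighbours y. tagged_rate r i (y, m) w * f (snd w)) / exit_rate (tagged_rate r i) (y, m))"
    by (rule nn_integral_jump_pmf[where q = "tagged_rate r i" and x = "(y, m)" and f = "\<lambda>w. f (snd w)",
          OF tagged_rate_nonneg finite_tagged_support tagged_rate_support _ tagged_rate_self f0])
      (simp_all add: exit_rate_tagged total_rate_pos[OF s])
  also have "\<dots> = ennreal (f m + service_rate / total_rate y * (f (m - 1) - f m))"
    unfolding sum exit_rate_tagged using total_rate_pos[OF s] by (simp add: add_divide_distrib)
  finally show ?thesis .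
qed

text \<open>An arrival at the station only lengthens the queue, and a completion there lowers both the queue
  and the number of completions needed by one.\<close>

lemma tagged_states_closed:
  assumes s: "s \<in> tagged_states" "s \<notin> {(y, m). m = 0}" and w: "w \<in> set_pmf (jump_pmf (tagged_rate r i) s)"
  shows "w \<in> tagged_states"
proof -
  obtain y m where ym: "s = (y, m)" by (cases s)
  have s': "(y, m) \<in> tagged_states" "m \<noteq> 0" using s by (auto simp: ym)
  have "pmf (jump_pmf (tagged_rate r i) (y, m)) w = (if w = (y, m) then 0 else tagged_rate r i (y, m) w / exit_rate (tagged_rate r i) (y, m))"
    by (rule pmf_jump_pmf[where q = "tagged_rate r i" and x = "(y, m)", OF tagged_rate_nonneg finite_tagged_support tagged_rate_support])
      (simp_all add: exit_rate_tagged total_rate_pos[OF s'])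
  then have "tagged_rate r i (y, m) w \<noteq> 0" using w by (auto simp: set_pmf_iff ym split: if_splits)
  then obtain z where z: "w = tagged_succ y m z" "z \<in> neighbours y" using tagged_rate_support[of w y m] by blast
  from z(2) have "z i = y i \<or> z i = y i + 1 \<or> z i = y i - 1"
    by (auto simp: neighbours_def split: if_splits)
  moreover have "spares r i + real m \<le> real (y i)" using s' by (auto simp: tagged_states_def)
  moreover have "0 < y i" by (rule charge_rate_tagged[OF s'])
  ultimately show ?thesis using s'(2)
    by (auto simp: z(1) tagged_succ_def tagged_states_def of_nat_diff)
qed

text \<open>With \<open>m\<close> completions to go, each takes a mean time of \<open>1 / service_rate\<close>, so
  \<open>h (y, m) = m / service_rate\<close> solves the recursion for the mean. The number of jumps until the next
  completion is not bounded, but each jump is one with probability bounded below; hence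
  \<open>2 ^ m\<close> decays geometrically in the mean and dominates \<open>m\<close>.\<close>

lemma wait_law:
  shows "real_distribution (wait_law x)"
    and "measure (wait_law x) {0<..} = (if completions_needed r i x = 0 then 0 else 1)"
    and "AE t in wait_law x. 0 \<le> t"
    and "(\<integral>\<^sup>+t. ennreal t \<partial>wait_law x) = ennreal (real (completions_needed r i x) / service_rate)"
proof -
  let ?A = "{(y :: 's \<Rightarrow> nat, m :: nat). m = 0}"
  let ?s = "(x(i := x i + 1), completions_needed r i x)"
  have "real_distribution (wait_law x) \<and> measure (wait_law x) {0<..} = (if completions_needed r i x = 0 then 0 else 1)
    \<and> (AE t in wait_law x. 0 \<le> t) \<and> (\<integral>\<^sup>+t. ennreal t \<partial>wait_law x) = ennreal (real (completions_needed r i x) / service_rate)"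
  proof (cases "completions_needed r i x = 0")
    case True
    then have w: "wait_law x = return borel 0"
      unfolding wait_law_def by (intro hitting_time_law_eq_return) simp
    have "AE t in return borel (0::real). 0 \<le> t" by (subst AE_return) auto
    then show ?thesis unfolding w using True
      by (auto simp: real_distribution_def real_distribution_axioms_def nn_integral_return measure_return intro!: prob_space_return)
  next
    case False
    define \<rho> where "\<rho> = 1 - service_rate / (2 * total_rate_bound)"
    have tb: "0 < total_rate_bound" using service_rate_pos service_rate_le_bound by linarith
    have \<rho>: "0 \<le> \<rho>" "\<rho> < 1"
      using service_rate_pos service_rate_le_bound tb by (auto simp: \<rho>_def field_simps)
    have step: "ennreal (real (snd s) / service_rate) = ennreal (1 / exit_rate (tagged_rate r i) s) +
        (\<integral>\<^sup>+w. ennreal (real (snd w) / service_rate) \<partial>measure_pmf (jump_pmf (tagged_rate r i) s))"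
      if s: "s \<in> tagged_states" "s \<notin> ?A" for s
    proof -
      obtain y m where ym: "s = (y, m)" by (cases s)
      have s': "(y, m) \<in> tagged_states" "m \<noteq> 0" using s by (auto simp: ym)
      note pos = total_rate_pos[OF s']
      have d: "real (m - 1) = real m - 1" using s'(2) by (simp add: of_nat_diff)
      have "service_rate / total_rate y * (real (m - 1) / service_rate - real m / service_rate) = - (1 / total_rate y)"
        unfolding d using service_rate_pos by (simp add: diff_divide_distrib)
      then have "(\<integral>\<^sup>+w. ennreal (real (snd w) / service_rate) \<partial>measure_pmf (jump_pmf (tagged_rate r i) (y, m)))
          = ennreal (real m / service_rate - 1 / total_rate y)"
        using nn_integral_tagged_jump[OF s', of "\<lambda>n. real n / service_rate"] service_rate_pos by simp
      moreover have "1 / total_rate y \<le> real m / service_rate"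
        using pos s'(2) service_rate_pos by (intro frac_le) auto
      ultimately show ?thesis using pos by (simp add: ym exit_rate_tagged ennreal_plus[symmetric] del: ennreal_plus)
    qed
    have V: "real (snd s) / service_rate \<le> 2 ^ snd s / service_rate" if "s \<in> tagged_states" for s :: "('s \<Rightarrow> nat) \<times> nat"
      using service_rate_pos of_nat_less_two_power[of "snd s", where 'a = real]
      by (intro divide_right_mono) linarith+
    \<comment> \<open>a completion halves \<open>2 ^ m\<close>, and every jump is one with probability at least \<open>service_rate / total_rate_bound\<close>\<close>
    have V_step: "(\<integral>\<^sup>+w. ennreal (2 ^ snd w / service_rate) \<partial>measure_pmf (jump_pmf (tagged_rate r i) s)) \<le> ennreal (\<rho> * (2 ^ snd s / service_rate))"
      if s: "s \<in> tagged_states" "s \<notin> ?A" for s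
    proof -
      obtain y m where ym: "s = (y, m)" by (cases s)
      have s': "(y, m) \<in> tagged_states" "m \<noteq> 0" using s by (auto simp: ym)
      note pos = total_rate_pos[OF s']
      obtain n where n: "m = Suc n" using s'(2) by (cases m) auto
      have "service_rate / (2 * total_rate_bound) \<le> service_rate / (2 * total_rate y)"
        using pos total_rate_le_bound[of y] service_rate_pos tb by (intro divide_left_mono) auto
      then have "(1 - service_rate / (2 * total_rate y)) * (2 ^ m / service_rate) \<le> \<rho> * (2 ^ m / service_rate)"
        unfolding \<rho>_def using service_rate_pos by (intro mult_right_mono) auto
      moreover have "2 ^ m / service_rate + service_rate / total_rate y * (2 ^ (m - 1) / service_rate - 2 ^ m / service_rate)
          = (1 - service_rate / (2 * total_rate y)) * (2 ^ m / service_rate)"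
        unfolding n using service_rate_pos pos by (simp add: field_simps)
      ultimately show ?thesis
        using nn_integral_tagged_jump[OF s', of "\<lambda>n. 2 ^ n / service_rate"] service_rate_pos
        by (simp add: ym ennreal_leI)
    qed
    have start: "?s \<in> tagged_states" "?s \<notin> ?A" using initial_tagged_state False by auto
    have pos: "0 < exit_rate (tagged_rate r i) s" if "s \<in> tagged_states" "s \<notin> ?A" for s
      using that total_rate_pos by (cases s) (auto simp: exit_rate_tagged)
    have h0: "real (snd s) / service_rate = 0" if "s \<in> tagged_states" "s \<in> ?A" for s :: "('s \<Rightarrow> nat) \<times> nat"
      using that by auto
    note law = hitting_time_law[where I = tagged_states and A = ?A and q = "tagged_rate r i"
        and h = "\<lambda>s. real (snd s) / service_rate" and V = "\<lambda>s. 2 ^ snd s / service_rate" and \<rho> = \<rho> and x = ?s,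
        OF tagged_states_closed pos h0 step V \<rho> V_step start, folded wait_law_def]
    have 1: "real_distribution (wait_law x)" "measure (wait_law x) {0<..} = 1"
      "(\<integral>\<^sup>+t. ennreal t \<partial>wait_law x) = ennreal (real (completions_needed r i x) / service_rate)"
      using law by simp_all
    interpret W: real_distribution "wait_law x" by (rule 1)
    have "AE t in wait_law x. t \<in> {0<..}" using 1(2) by (subst (asm) W.prob_eq_1) auto
    then have "AE t in wait_law x. 0 \<le> t" by (rule AE_mp) auto
    then show ?thesis using 1 False by simp
  qed
  then show "real_distribution (wait_law x)"
    and "measure (wait_law x) {0<..} = (if completions_needed r i x = 0 then 0 else 1)"
    and "AE t in wait_law x. 0 \<le> t"
    and "(\<integral>\<^sup>+t. ennreal t \<partial>wait_law x) = ennreal (real (completions_needed r i x) / service_rate)"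
    by blast+
qed

end
end
end

section \<open>Waiting in steady state\<close>

context swapping_network
begin

text \<open>Level crossing: with the sum of \<open>f\<close> up to the queue length as test function, an arrival gains
  \<open>f (x i)\<close> and a completion loses \<open>f (x i - 1)\<close>. It replaces the arrival rate, which depends on all
  levels, by the charging rate at \<open>i\<close>.\<close>

lemma mean_arrival_rate_shift:
  assumes large: "large r"
  shows "mean r (\<lambda>x. arrival_rate r i x * f (x i)) = mean r (\<lambda>x. charge_rate r i x * f (x i - 1))"
proof -
  note int = integrable_steady_state[OF large]
  let ?F = "\<lambda>x :: 's \<Rightarrow> nat. \<Sum>k<x i. f k"
  have "generator r ?F x = arrival_rate r i x * f (x i) - charge_rate r i x * f (x i - 1)" for x
  proof -
    have up: "arrival_rate r j x * (?F (x(j := x j + 1)) - ?F x) = (if j = i then arrival_rate r i x * f (x i) else 0)" for j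
      by auto
    have down: "charge_rate r j x * (?F (x(j := x j - 1)) - ?F x) = (if j = i then - (charge_rate r i x * f (x i - 1)) else 0)" for j
    proof (cases "x i = 0")
      case True
      then show ?thesis by (simp add: charge_rate_0[OF large])
    next
      case False
      then obtain n where "x i = Suc n" by (cases "x i") auto
      then show ?thesis by auto
    qed
    show ?thesis unfolding generator_def up down by (simp add: sum.distrib)
  qed
  then have "generator r ?F = (\<lambda>x. arrival_rate r i x * f (x i) - charge_rate r i x * f (x i - 1))" by (rule ext)
  then have "0 = mean r (\<lambda>x. arrival_rate r i x * f (x i) - charge_rate r i x * f (x i - 1))"
    using expectation_generator[OF large, of ?F] by simp
  also have "\<dots> = mean r (\<lambda>x. arrival_rate r i x * f (x i)) - mean r (\<lambda>x. charge_rate r i x * f (x i - 1))"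
    by (rule Bochner_Integration.integral_diff[OF int int])
  finally show ?thesis by simp
qed

lemma mean_charge_rate: "large r \<Longrightarrow> mean r (charge_rate r i) = service_rate r i * charger_utilization r i"
proof -
  assume large: "large r"
  have "charge_rate r i x = service_rate r i * (min (real (x i)) (chargers r i) / chargers r i)" for x
    using chargers_pos[OF large, of i] by (simp add: charge_rate_def service_rate_def)
  then have "charge_rate r i = (\<lambda>x. service_rate r i * (min (real (x i)) (chargers r i) / chargers r i))" by (rule ext)
  then show ?thesis by (simp add: charger_utilization_def)
qed

text \<open>With zero utilization there would be no arrivals and hence no state found by them.\<close>

definition busy :: "nat \<Rightarrow> 's \<Rightarrow> bool" where
  "busy r i \<longleftrightarrow> large r \<and> 0 < charger_utilization r i"

lemma mean_arrival_rate: "large r \<Longrightarrow> mean r (arrival_rate r i) = service_rate r i * charger_utilization r i"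
  using mean_arrival_rate_shift[of r i "\<lambda>_. 1"] mean_charge_rate[of r i] by simp

lemma mean_arrival_rate_pos: "busy r i \<Longrightarrow> 0 < mean r (arrival_rate r i)"
  using service_rate_pos[of r i] by (simp add: busy_def mean_arrival_rate)

lemma eventually_busy: "eventually (\<lambda>r. busy r i) sequentially"
proof -
  have "eventually (\<lambda>r. 0 < charger_utilization r i) sequentially"
    using order_tendstoD(1)[OF charger_utilization_tendsto, of 0 i] by simp
  with eventually_large show ?thesis by eventually_elim (simp add: busy_def)
qed

text \<open>The weights in the definition of the state found form a probability as soon as the mean arrival
  rate is positive.\<close>

lemma nn_integral_found_state:
  assumes "busy r i" and f0: "\<And>x. 0 \<le> f x"
  shows "(\<integral>\<^sup>+x. ennreal (f x) \<partial>measure_pmf (found_state r i)) = ennreal (mean r (\<lambda>x. arrival_rate r i x * f x) / mean r (arrival_rate r i))"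
proof -
  have large: "large r" using assms by (simp add: busy_def)
  define Z where "Z = mean r (arrival_rate r i)"
  have Z: "0 < Z" unfolding Z_def by (rule mean_arrival_rate_pos[OF assms(1)])
  define w where "w x = pmf (steady_state r) x * arrival_rate r i x / Z" for x
  have w0: "0 \<le> w x" for x using Z by (simp add: w_def)
  have int_w: "(\<integral>\<^sup>+x. ennreal (w x * f x) \<partial>count_space UNIV) = ennreal (mean r (\<lambda>x. arrival_rate r i x * f x) / Z)"
    if f0: "\<And>x. 0 \<le> f x" for f
  proof -
    have "(\<integral>\<^sup>+x. ennreal (w x * f x) \<partial>count_space UNIV)
        = (\<integral>\<^sup>+x. ennreal (pmf (steady_state r) x) * ennreal (arrival_rate r i x * f x / Z) \<partial>count_space UNIV)"
      using f0 Z by (intro nn_integral_cong) (simp add: w_def ennreal_mult[symmetric])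
    also have "\<dots> = (\<integral>\<^sup>+x. ennreal (arrival_rate r i x * f x / Z) \<partial>measure_pmf (steady_state r))"
      by (rule nn_integral_measure_pmf[symmetric])
    also have "\<dots> = ennreal (mean r (\<lambda>x. arrival_rate r i x * f x / Z))"
      using f0 Z by (intro nn_integral_eq_integral integrable_steady_state[OF large]) auto
    finally show ?thesis by simp
  qed
  have "(\<integral>\<^sup>+x. ennreal (w x) \<partial>count_space UNIV) = 1"
    using int_w[of "\<lambda>_. 1"] Z by (simp add: Z_def[symmetric])
  then have "pmf (embed_pmf w) x = w x" for x using w0 by (intro pmf_embed_pmf) auto
  moreover have "found_state r i = embed_pmf w"
    by (simp add: found_state_def w_def[abs_def] Z_def)
  ultimately have pm: "pmf (found_state r i) x = w x" for x by simp
  have "(\<integral>\<^sup>+x. ennreal (f x) \<partial>measure_pmf (found_state r i)) = (\<integral>\<^sup>+x. ennreal (w x * f x) \<partial>count_space UNIV)"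
    unfolding nn_integral_measure_pmf pm using w0 f0 by (intro nn_integral_cong) (simp add: ennreal_mult)
  then show ?thesis using int_w[OF f0] by (simp add: Z_def)
qed

text \<open>The number of completions needed, as a function of the queue length alone.\<close>

definition places :: "nat \<Rightarrow> 's \<Rightarrow> nat \<Rightarrow> real" where
  "places r i k = (if spares r i \<le> real k then real (nat \<lfloor>real k - spares r i\<rfloor> + 1) else 0)"

lemma completions_needed_eq: "real (completions_needed r i x) = places r i (x i)"
  by (simp add: completions_needed_def places_def)

lemma waiting_time_kernel:
  "large r \<Longrightarrow> wait_law r i \<in> measure_pmf (found_state r i) \<rightarrow>\<^sub>M subprob_algebra borel"
proof -
  assume large: "large r"
  have "wait_law r i x \<in> space (subprob_algebra borel)" for x
  proof -
    interpret real_distribution "wait_law r i x" by (rule wait_law[OF large])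
    show ?thesis by (simp add: space_subprob_algebra prob_space_imp_subprob_space prob_space_axioms)
  qed
  then show ?thesis by simp
qed

lemma waiting_time_eq: "waiting_time r i = measure_pmf (found_state r i) \<bind> wait_law r i"
  by (simp add: waiting_time_def wait_law_def[abs_def])

text \<open>Where \<open>f\<close> does not vanish all charging points are busy, so the charging rate in the shifted mean
  is constant and cancels against the mean arrival rate, up to the utilization.\<close>

lemma found_mean_service:
  assumes "busy r i" and z: "\<And>k. real k < spares r i \<Longrightarrow> f k = 0"
  shows "mean r (\<lambda>x. arrival_rate r i x * f (x i)) / mean r (arrival_rate r i) = mean r (\<lambda>x. f (x i - 1)) / charger_utilization r i"
proof -
  have large: "large r" using assms by (simp add: busy_def)
  have "charge_rate r i x * f (x i - 1) = service_rate r i * f (x i - 1)" for x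
  proof (cases "real (x i - 1) < spares r i")
    case False
    then have "chargers r i \<le> real (x i)" using chargers_le_spares[OF large, of i] by linarith
    then have "min (real (x i)) (chargers r i) = chargers r i" by (rule min.absorb2)
    then show ?thesis by (simp only: charge_rate_def service_rate_def)
  next
    case True
    then show ?thesis by (simp only: z mult_zero_right)
  qed
  then have "(\<lambda>x. charge_rate r i x * f (x i - 1)) = (\<lambda>x. service_rate r i * f (x i - 1))" by (rule ext)
  then have shift: "mean r (\<lambda>x. charge_rate r i x * f (x i - 1)) = service_rate r i * mean r (\<lambda>x. f (x i - 1))"
    by (simp only: integral_mult_right_zero)
  show ?thesis
    unfolding mean_arrival_rate_shift[OF large] mean_arrival_rate[OF large] shift
    using service_rate_pos[OF large, of i] by (intro mult_divide_mult_cancel_left) linarith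
qed

text \<open>At an empty station \<open>x i - 1\<close> is \<open>0\<close> rather than \<open>-1\<close>; as the number of spares is positive, this
  does not affect either side.\<close>

lemma found_level_ge_iff:
  assumes large: "large r"
  shows "spares r i \<le> real (x i - 1) \<longleftrightarrow> b \<le> found_level r i x"
    and "max 0 (real (x i - 1) - spares r i) = weight i * scale r * max 0 (found_level r i x - b)"
proof -
  have s: "0 < scale r" by (rule scale_pos[OF large])
  have B: "0 < spares r i" by (rule spares_pos[OF large])
  have e: "real (x i) - 1 - spares r i = weight i * scale r * (found_level r i x - b)"
  proof -
    have w: "0 < weight i" by simp
    have "n - 1 - w * (o' + b * s) = w * s * (((n - 1) / w - o') / s - b)" if "0 < w" "0 < s" for n w o' s :: real
      using that by (simp add: field_simps)
    from this[OF w s] show ?thesis unfolding found_level_def spares_eq .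
  qed
  define W where "W = weight i * scale r"
  have W: "0 < W" using s by (simp add: W_def)
  define z where "z = found_level r i x - b"
  have e': "real (x i) - 1 - spares r i = W * z" using e by (simp only: W_def z_def)
  have sign: "0 \<le> z \<longleftrightarrow> b \<le> found_level r i x" by (simp add: z_def)
  show "spares r i \<le> real (x i - 1) \<longleftrightarrow> b \<le> found_level r i x"
    unfolding sign[symmetric]
  proof (cases "x i = 0")
    case True
    then have "W * z < 0" using e' B by simp
    then have "\<not> 0 \<le> z" using W by (simp add: mult_less_0_iff)
    then show "spares r i \<le> real (x i - 1) \<longleftrightarrow> 0 \<le> z" using True B by simp
  next
    case False
    then have "real (x i - 1) - spares r i = W * z" using e' by (simp add: of_nat_diff)
    moreover have "0 \<le> W * z \<longleftrightarrow> 0 \<le> z" using W by (simp add: zero_le_mult_iff)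
    ultimately show "spares r i \<le> real (x i - 1) \<longleftrightarrow> 0 \<le> z" by linarith
  qed
  have m: "W * max 0 z = max 0 (W * z)" using W by (simp add: max_mult_distrib_left)
  have "max 0 (real (x i - 1) - spares r i) = W * max 0 z"
    unfolding m e'[symmetric] using B by (cases "x i = 0") (auto simp: of_nat_diff)
  then show "max 0 (real (x i - 1) - spares r i) = weight i * scale r * max 0 (found_level r i x - b)"
    by (simp only: W_def z_def)
qed

lemma waiting_probability:
  assumes "busy r i"
  shows "measure (waiting_time r i) {0<..} = measure_pmf.prob (steady_state r) {x. b \<le> found_level r i x} / charger_utilization r i"
proof -
  have large: "large r" using assms by (simp add: busy_def)
  define f where "f k = (if spares r i \<le> real k then 1 else 0 :: real)" for k
  have c0: "completions_needed r i x = 0 \<longleftrightarrow> \<not> spares r i \<le> real (x i)" for x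
    by (simp add: completions_needed_def)
  have "emeasure (waiting_time r i) {0<..} = (\<integral>\<^sup>+x. emeasure (wait_law r i x) {0<..} \<partial>measure_pmf (found_state r i))"
    unfolding waiting_time_eq by (rule emeasure_bind[OF _ waiting_time_kernel[OF large]]) auto
  also have "\<dots> = (\<integral>\<^sup>+x. ennreal (f (x i)) \<partial>measure_pmf (found_state r i))"
  proof (rule nn_integral_cong)
    fix x
    interpret W: real_distribution "wait_law r i x" by (rule wait_law[OF large])
    show "emeasure (wait_law r i x) {0<..} = ennreal (f (x i))"
      unfolding W.emeasure_eq_measure wait_law(2)[OF large] f_def c0 by simp
  qed
  also have "\<dots> = ennreal (mean r (\<lambda>x. arrival_rate r i x * f (x i)) / mean r (arrival_rate r i))"
    by (rule nn_integral_found_state[OF assms]) (simp add: f_def)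
  also have "mean r (\<lambda>x. arrival_rate r i x * f (x i)) / mean r (arrival_rate r i) = mean r (\<lambda>x. f (x i - 1)) / charger_utilization r i"
    by (rule found_mean_service[OF assms]) (simp add: f_def)
  also have "mean r (\<lambda>x. f (x i - 1)) = measure_pmf.prob (steady_state r) {x. b \<le> found_level r i x}"
  proof -
    have "f (x i - 1) = indicator {x. b \<le> found_level r i x} x" for x
      unfolding f_def found_level_ge_iff(1)[OF large] by simp
    then have "(\<lambda>x. f (x i - 1)) = indicator {x. b \<le> found_level r i x}" by (rule ext)
    then show ?thesis by simp
  qed
  finally have "emeasure (waiting_time r i) {0<..} = ennreal (measure_pmf.prob (steady_state r) {x. b \<le> found_level r i x} / charger_utilization r i)" .
  then show ?thesis using assms by (simp add: measure_def busy_def)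
qed

lemma waiting_mean:
  assumes "busy r i"
  shows "(\<integral>w. w \<partial>waiting_time r i) = mean r (\<lambda>x. places r i (x i - 1)) / (service_rate r i * charger_utilization r i)"
proof -
  have large: "large r" using assms by (simp add: busy_def)
  have k: "wait_law r i \<in> measure_pmf (found_state r i) \<rightarrow>\<^sub>M subprob_algebra borel" by (rule waiting_time_kernel[OF large])
  have "(\<integral>\<^sup>+w. ennreal w \<partial>waiting_time r i) = (\<integral>\<^sup>+x. (\<integral>\<^sup>+t. ennreal t \<partial>wait_law r i x) \<partial>measure_pmf (found_state r i))"
    unfolding waiting_time_eq by (rule nn_integral_bind[OF _ k]) simp
  also have "\<dots> = (\<integral>\<^sup>+x. ennreal (places r i (x i) / service_rate r i) \<partial>measure_pmf (found_state r i))"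
    by (simp add: wait_law(4)[OF large] completions_needed_eq)
  also have "\<dots> = ennreal (mean r (\<lambda>x. arrival_rate r i x * (places r i (x i) / service_rate r i)) / mean r (arrival_rate r i))"
    by (rule nn_integral_found_state[OF assms]) (use service_rate_pos[OF large, of i] in \<open>simp add: places_def\<close>)
  also have "mean r (\<lambda>x. arrival_rate r i x * (places r i (x i) / service_rate r i)) / mean r (arrival_rate r i)
      = mean r (\<lambda>x. places r i (x i - 1) / service_rate r i) / charger_utilization r i"
    by (rule found_mean_service[OF assms, of "\<lambda>k. places r i k / service_rate r i"]) (simp add: places_def)
  also have "\<dots> = mean r (\<lambda>x. places r i (x i - 1)) / (service_rate r i * charger_utilization r i)" by simp
  finally have nn: "(\<integral>\<^sup>+w. ennreal w \<partial>waiting_time r i) = ennreal (mean r (\<lambda>x. places r i (x i - 1)) / (service_rate r i * charger_utilization r i))" .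
  have s: "sets (waiting_time r i) = sets borel"
    unfolding waiting_time_eq by (rule sets_bind[OF sets_kernel[OF k]]) auto
  have "AE w in waiting_time r i. 0 \<le> w"
    unfolding waiting_time_eq by (subst AE_bind[OF k]) (auto simp: wait_law(3)[OF large])
  moreover have "(\<lambda>w. w) \<in> borel_measurable (waiting_time r i)" using s by (simp cong: measurable_cong_sets)
  ultimately have "(\<integral>w. w \<partial>waiting_time r i) = enn2real (\<integral>\<^sup>+w. ennreal w \<partial>waiting_time r i)"
    by (intro integral_eq_nn_integral)
  moreover have "0 \<le> mean r (\<lambda>x. places r i (x i - 1))" by (intro integral_nonneg_AE) (simp add: places_def)
  ultimately show ?thesis using nn assms service_rate_pos[OF large, of i] by (simp add: busy_def)
qed

lemma waiting_probability_tendsto: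
  "(\<lambda>r. measure (waiting_time r i) {0<..}) \<longlonglongrightarrow> measure steady_law {b..}"
proof -
  have "(\<lambda>r. measure_pmf.prob (steady_state r) {x. b \<le> found_level r i x} / charger_utilization r i) \<longlonglongrightarrow> measure steady_law {b..} / 1"
    by (intro tendsto_divide prob_found_level_ge_tendsto charger_utilization_tendsto) simp
  then have "(\<lambda>r. measure_pmf.prob (steady_state r) {x. b \<le> found_level r i x} / charger_utilization r i) \<longlonglongrightarrow> measure steady_law {b..}" by simp
  then show ?thesis
    by (rule Lim_transform_eventually) (rule eventually_mono[OF eventually_busy waiting_probability[symmetric]])
qed

lemma mean_places_bounds:
  assumes large: "large r"
  shows "weight i * scale r * mean r (\<lambda>x. max 0 (found_level r i x - b)) \<le> mean r (\<lambda>x. places r i (x i - 1))"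
    "mean r (\<lambda>x. places r i (x i - 1)) \<le> weight i * scale r * mean r (\<lambda>x. max 0 (found_level r i x - b)) + 1"
proof -
  note int = integrable_steady_state[OF large]
  have p: "max 0 (real k - spares r i) \<le> places r i k" "places r i k \<le> max 0 (real k - spares r i) + 1" for k
    by (auto simp: places_def) linarith+
  have "mean r (\<lambda>x. weight i * scale r * max 0 (found_level r i x - b)) \<le> mean r (\<lambda>x. places r i (x i - 1))"
    by (rule expectation_mono[OF large]) (use p(1) in \<open>simp add: found_level_ge_iff(2)[OF large, symmetric]\<close>)
  then show "weight i * scale r * mean r (\<lambda>x. max 0 (found_level r i x - b)) \<le> mean r (\<lambda>x. places r i (x i - 1))" by simp
  have "mean r (\<lambda>x. places r i (x i - 1)) \<le> mean r (\<lambda>x. weight i * scale r * max 0 (found_level r i x - b) + 1)"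
    by (rule expectation_mono[OF large]) (use p(2) in \<open>simp add: found_level_ge_iff(2)[OF large, symmetric]\<close>)
  then show "mean r (\<lambda>x. places r i (x i - 1)) \<le> weight i * scale r * mean r (\<lambda>x. max 0 (found_level r i x - b)) + 1"
    by (simp add: int)
qed

text \<open>The number of completions needed is the excess over the spares, up to rounding, which vanishes
  against \<open>scale r\<close>. With \<open>scale r * scale r = offered r\<close>, the factor \<open>sqrt r\<close> and the service rate
  \<open>mu * weight i * cap r\<close>, the mean excess remains with the factor \<open>1 / sqrt (lam * mu)\<close>.\<close>

lemma waiting_mean_tendsto:
  "(\<lambda>r. sqrt (real r) * (\<integral>w. w \<partial>waiting_time r i)) \<longlonglongrightarrow> (moment3 / total_mass) / sqrt (lam * mu)"
proof -
  let ?E = "\<lambda>r. mean r (\<lambda>x. max 0 (found_level r i x - b))"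
  let ?c = "sqrt (mu / lam) / mu"
  have c: "?c = 1 / sqrt (lam * mu)"
  proof -
    have "mu = sqrt mu * sqrt mu" using rates by simp
    then show ?thesis using rates by (simp add: real_sqrt_divide real_sqrt_mult field_simps)
  qed
  have low: "(\<lambda>r. ?c * (offered r / cap r) * ?E r / charger_utilization r i) \<longlonglongrightarrow> ?c * 1 * (moment3 / total_mass) / 1"
    by (intro tendsto_intros offered_over_cap_tendsto mean_found_excess_tendsto charger_utilization_tendsto) simp
  have high: "(\<lambda>r. (?c * (offered r / cap r) * ?E r + ?c / weight i * (scale r / cap r)) / charger_utilization r i) \<longlonglongrightarrow> (?c * 1 * (moment3 / total_mass) + ?c / weight i * 0) / 1"
    by (intro tendsto_intros offered_over_cap_tendsto scale_over_cap_tendsto mean_found_excess_tendsto charger_utilization_tendsto) simp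
  have bounds: "?c * (offered r / cap r) * ?E r / charger_utilization r i \<le> sqrt (real r) * (\<integral>w. w \<partial>waiting_time r i) \<and>
      sqrt (real r) * (\<integral>w. w \<partial>waiting_time r i) \<le> (?c * (offered r / cap r) * ?E r + ?c / weight i * (scale r / cap r)) / charger_utilization r i"
    if busy: "busy r i" for r
  proof -
    have large: "large r" and u: "0 < charger_utilization r i" using busy by (auto simp: busy_def)
    have cp: "0 < cap r" by (rule cap_pos[OF large])
    have sr: "sqrt (real r) = sqrt (mu / lam) * scale r"
      using rates unfolding scale_def offered_def by (simp add: real_sqrt_mult[symmetric])
    define P where "P = mean r (\<lambda>x. places r i (x i - 1))"
    have W: "sqrt (real r) * (\<integral>w. w \<partial>waiting_time r i) = (?c / weight i * (scale r / cap r) * P) / charger_utilization r i"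
      unfolding waiting_mean[OF busy] sr P_def service_rate_def chargers_eq by simp
    define K where "K = ?c / weight i * (scale r / cap r)"
    define M where "M = weight i * scale r * ?E r"
    have k: "0 \<le> K" using rates cp by (simp add: K_def)
    have "weight i \<noteq> 0" using weight_pos[of i] by linarith
    then have KM: "K * M = ?c * (offered r / cap r) * ?E r"
      unfolding scale_square[symmetric] by (simp add: K_def M_def)
    have "K * M \<le> K * P"
      unfolding P_def M_def by (rule mult_left_mono[OF mean_places_bounds(1)[OF large] k])
    moreover have "K * P \<le> K * (M + 1)"
      unfolding P_def M_def by (rule mult_left_mono[OF mean_places_bounds(2)[OF large] k])
    ultimately show ?thesis unfolding W K_def[symmetric] KM[symmetric] using u by (simp add: distrib_left divide_right_mono)
  qed
  have "(\<lambda>r. sqrt (real r) * (\<integral>w. w \<partial>waiting_time r i)) \<longlonglongrightarrow> ?c * (moment3 / total_mass)"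
  proof (rule tendsto_sandwich)
    show "eventually (\<lambda>r. ?c * (offered r / cap r) * ?E r / charger_utilization r i \<le> sqrt (real r) * (\<integral>w. w \<partial>waiting_time r i)) sequentially"
      by (rule eventually_mono[OF eventually_busy bounds[THEN conjunct1]])
    show "eventually (\<lambda>r. sqrt (real r) * (\<integral>w. w \<partial>waiting_time r i) \<le> (?c * (offered r / cap r) * ?E r + ?c / weight i * (scale r / cap r)) / charger_utilization r i) sequentially"
      by (rule eventually_mono[OF eventually_busy bounds[THEN conjunct2]])
  qed (use low high in simp_all)
  then show ?thesis unfolding c by (simp add: mult.commute)
qed

end

section \<open>Explicit constants and the limit theorem\<close>

context limit_diffusion
begin

lemma std_normal_cdf_0: "std_normal_cdf 0 = 1 / 2"
proof -
  let ?q = "sqrt (2 * pi)"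
  let ?f = "\<lambda>x :: real. indicator {..<0} x * exp (- x\<^sup>2 / 2) + indicator {0<..} x * exp (- x\<^sup>2 / 2)"
  have 1: "has_bochner_integral lborel ?f (?q * std_normal_cdf 0 + ?q * std_normal_cdf (- 0))"
    by (intro has_bochner_integral_add has_bochner_integral_gauss_lower has_bochner_integral_gauss_upper)
  have "has_bochner_integral lborel std_normal_density 1"
    using std_normal_moment_even[of 0] by simp
  from has_bochner_integral_mult_right[OF this, of ?q]
  have 2: "has_bochner_integral lborel (\<lambda>x. exp (- x\<^sup>2 / 2)) ?q" by (simp add: std_normal_density_def)
  have "AE x in lborel. ?f x = exp (- (x::real)\<^sup>2 / 2)"
    by (rule AE_mp[OF AE_lborel_singleton[of 0]]) (auto split: split_indicator)
  then have "has_bochner_integral lborel ?f ?q \<longleftrightarrow> has_bochner_integral lborel (\<lambda>x. exp (- x\<^sup>2 / 2)) ?q"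
    by (intro has_bochner_integral_cong_AE) simp_all
  then have "?q * std_normal_cdf 0 + ?q * std_normal_cdf (- 0) = ?q"
    using has_bochner_integral_eq[OF 1] 2 by simp
  then have "?q * std_normal_cdf 0 + ?q * std_normal_cdf 0 = ?q * 1" by (simp only: minus_zero mult_1_right)
  then have "?q * (std_normal_cdf 0 + std_normal_cdf 0) = ?q * 1" by (simp only: distrib_left)
  then have "std_normal_cdf 0 + std_normal_cdf 0 = 1" by (subst (asm) mult_left_cancel) simp_all
  then show ?thesis by linarith
qed

text \<open>Normalized by the first mass, the masses of the three ranges are the constants \<open>r1\<close>, \<open>r2\<close>, \<open>r3\<close>.\<close>

lemma mass_ratios:
  shows "mass2 / mass1 = r2 b g" and "mass3 / mass1 = r3 lam mu b g"
    and "moment3 = mass3 * (sqrt (mu / lam) * std_normal_density aspect * inverse (std_normal_cdf (- aspect)) - mu / lam * g)"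
proof -
  let ?q = "sqrt (2 * pi)"
  have q: "0 < ?q" "?q \<noteq> 0" by simp_all
  have P: "0 < std_normal_cdf g" "0 < std_normal_cdf (- aspect)" by (rule normal_cdf_pos)+
  have dens: "std_normal_density z = exp (- z\<^sup>2 / 2) / ?q" for z by (simp add: std_normal_density_def)
  show "mass2 / mass1 = r2 b g"
  proof (cases "g = 0")
    case True
    have m2: "mass2 = b" unfolding mass2_def by (simp add: True)
    have m1: "mass1 = ?q * (1 / 2)" unfolding mass1_def by (simp only: True std_normal_cdf_0)
    have "sqrt (2 / pi) * ?q = sqrt (2 / pi * (2 * pi))" by (rule real_sqrt_mult[symmetric])
    also have "2 / pi * (2 * pi) = 2\<^sup>2" by simp
    finally have "sqrt (2 / pi) * ?q = 2" by simp
    with q(2) have "sqrt (2 / pi) = 2 / ?q" by (rule eq_divide_imp)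
    then show ?thesis unfolding m1 m2 r2_def if_P[OF True] by simp
  next
    case False
    have "exp (- g * g / 2) = ?q * std_normal_density g" by (simp add: dens power2_eq_square)
    moreover have "(u * D * (Y / k)) / (u * C) = D / C * (1 / k) * Y" if "u \<noteq> 0" for u D Y k C :: real
      using that by simp
    ultimately show ?thesis
      unfolding mass2_def mass1_def r2_def if_not_P[OF False] using q(2) by presburger
  qed
  have e1: "exp (g\<^sup>2 / 2 - g * b) = exp (- g\<^sup>2 / 2) * exp (- g * (b - g))"
    unfolding exp_add[symmetric] by (rule arg_cong[of _ _ exp]) (simp add: power2_eq_square field_simps)
  have e2: "exp (aspect\<^sup>2 / 2) = inverse (exp (- aspect\<^sup>2 / 2))"
    unfolding exp_minus[symmetric] by simp
  have r3: "r3 lam mu b g = std_normal_density g / std_normal_cdf g * exp (- g * (b - g)) * sqrt (mu / lam) *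
     inverse (std_normal_density aspect) * std_normal_cdf (- aspect)"
    by (simp add: r3_def aspect_def)
  have "(G * X) * s * inverse A * (u * N) / (u * C) = (G / u) / C * X * s * inverse (A / u) * N"
    if "u \<noteq> 0" "A \<noteq> 0" "C \<noteq> 0" for G X s A u N C :: real
    using that by (simp add: field_simps)
  from this[OF q(2) exp_not_eq_zero P(1)[THEN less_imp_neq, symmetric]] show "mass3 / mass1 = r3 lam mu b g"
    unfolding mass3_def mass1_def r3 dens e1 e2 .
  have sg: "mu / lam * g = sqrt (mu / lam) * aspect"
    using lam_pos mu_pos by (simp add: aspect_def mult.assoc[symmetric])
  define s where "s = sqrt (mu / lam)"
  have ss: "mu / lam = s * s" using lam_pos mu_pos by (simp add: s_def)
  define C where "C = exp (g\<^sup>2 / 2 - g * b) * exp (aspect\<^sup>2 / 2)"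
  define Pa where "Pa = std_normal_cdf (- aspect)"
  define E where "E = exp (- aspect\<^sup>2 / 2)"
  have Pa: "0 < Pa" using P by (simp add: Pa_def)
  have "moment3 = C * (s * s) * (E - aspect * (?q * Pa))"
    unfolding moment3_def ss C_def E_def Pa_def by (simp only: mult_ac)
  also have "\<dots> = (C * s * (?q * Pa)) * (s * (E / ?q) * inverse Pa - s * aspect)"
  proof -
    have "C * (s * s) * (E - k * (u * N)) = (C * s * (u * N)) * (s * (E / u) * inverse N - s * k)"
      if "u \<noteq> 0" "N \<noteq> 0" for k u N :: real
      using that by (simp add: field_simps)
    then show ?thesis using q(2) Pa by simp
  qed
  also have "C * s * (?q * Pa) = mass3"
    unfolding mass3_def C_def s_def Pa_def by (simp only: mult_ac)
  finally show "moment3 = mass3 * (sqrt (mu / lam) * std_normal_density aspect * inverse (std_normal_cdf (- aspect)) - mu / lam * g)"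
    unfolding sg dens E_def Pa_def s_def .
qed

lemma alpha3_eq: "mass3 / total_mass = alpha3 lam mu b g"
proof -
  have "mass3 / total_mass = (mass3 / mass1) / (total_mass / mass1)"
    using mass1_pos by simp
  then have "mass3 / total_mass = (mass3 / mass1) / (mass1 / mass1 + mass2 / mass1 + mass3 / mass1)"
    by (simp only: total_mass_def add_divide_distrib)
  then show ?thesis using mass1_pos by (simp add: mass_ratios alpha3_def r1_def)
qed

text \<open>Numerator and denominator of \<open>r3 / (r1 + r2 + r3)\<close> are divided by \<open>r3\<close>.\<close>

lemma waiting_probability_formula:
  "mass3 / total_mass = inverse (1
      + sqrt (lam / mu) * (std_normal_density aspect / std_normal_density g) * exp (g * (b - g)) * (std_normal_cdf g / std_normal_cdf (- aspect))
      + sqrt (lam / mu) * std_normal_density aspect * exp_quotient b g * inverse (std_normal_cdf (- aspect)))"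
proof -
  have P: "0 < std_normal_cdf g" "0 < std_normal_cdf (- aspect)" by (rule normal_cdf_pos)+
  have D: "0 < std_normal_density g" "0 < std_normal_density aspect" by (simp_all add: normal_density_pos)
  define X where "X = exp (- g * (b - g))"
  have "exp (g * (b - g)) = exp (- (- g * (b - g)))" by simp
  then have ex: "exp (g * (b - g)) = inverse X" unfolding exp_minus X_def .
  have X: "0 < X" by (simp add: X_def)
  define s where "s = sqrt (mu / lam)"
  have s: "sqrt (lam / mu) = inverse s" "0 < s"
    using lam_pos mu_pos by (simp_all add: s_def real_sqrt_divide)
  have r3: "r3 lam mu b g = std_normal_density g / std_normal_cdf g * X * s * inverse (std_normal_density aspect) * std_normal_cdf (- aspect)"
    by (simp add: r3_def aspect_def X_def s_def)
  have r3_pos: "0 < r3 lam mu b g"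
    unfolding r3 using P D X s(2) by (intro mult_pos_pos divide_pos_pos) simp_all
  have alg: "1 / (D / C * x * u * inverse D' * C') = inverse u * (D' / D) * inverse x * (C / C')"
      "(D / C * x * Q) / (D / C * x * u * inverse D' * C') = inverse u * D' * Q * inverse C'"
    if "0 < D" "0 < C" "0 < x" "0 < u" "0 < D'" "0 < C'" for D C x u D' C' Q :: real
    using that by (simp_all add: field_simps)
  have a: "1 / r3 lam mu b g = sqrt (lam / mu) * (std_normal_density aspect / std_normal_density g) * exp (g * (b - g)) * (std_normal_cdf g / std_normal_cdf (- aspect))"
    unfolding r3 s(1) ex by (rule alg(1)[OF D(1) P(1) X s(2) D(2) P(2)])
  have r2: "r2 b g = std_normal_density g / std_normal_cdf g * X * exp_quotient b g"
  proof (cases "g = 0")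
    case True
    have "mass2 / mass1 = std_normal_density g / std_normal_cdf g * b"
      unfolding mass2_def mass1_def by (simp add: True std_normal_density_def)
    then show ?thesis unfolding mass_ratios(1) exp_quotient_def if_P[OF True] by (simp add: True X_def)
  next
    case False
    have "X * exp_quotient b g = 1 / g * (1 - X)"
      unfolding exp_quotient_def if_not_P[OF False] ex using X by (simp add: right_diff_distrib diff_divide_distrib)
    then show ?thesis unfolding r2_def if_not_P[OF False] X_def[symmetric] by (simp only: mult.assoc)
  qed
  have c: "r2 b g / r3 lam mu b g = sqrt (lam / mu) * std_normal_density aspect * exp_quotient b g * inverse (std_normal_cdf (- aspect))"
    unfolding r3 r2 s(1) by (rule alg(2)[OF D(1) P(1) X s(2) D(2) P(2)])
  have "mass3 / total_mass = inverse ((1 + r2 b g + r3 lam mu b g) / r3 lam mu b g)"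
    by (simp add: alpha3_eq alpha3_def r1_def)
  also have "(1 + r2 b g + r3 lam mu b g) / r3 lam mu b g = 1 + 1 / r3 lam mu b g + r2 b g / r3 lam mu b g"
    using r3_pos by (simp add: add_divide_distrib)
  finally show ?thesis unfolding a c .
qed

end

theorem corollary4p7:
  fixes p :: "'s::finite set \<Rightarrow> real" and lam mu b g :: real and i :: 's
  assumes "swapping_network p lam mu b g"
  shows "((\<lambda>r. measure (swapping_network.waiting_time p lam mu b g r i) {0<..})
           \<longlonglongrightarrow> measure (limit_steady_state lam mu b g) {b..}) \<and>
         (measure (limit_steady_state lam mu b g) {b..} =
           inverse (1
             + sqrt (lam / mu) * (std_normal_density (sqrt (mu / lam) * g) / std_normal_density g)
                 * exp (g * (b - g)) * (std_normal_cdf g / std_normal_cdf (- sqrt (mu / lam) * g))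
             + sqrt (lam / mu) * std_normal_density (sqrt (mu / lam) * g) * exp_quotient b g
                 * inverse (std_normal_cdf (- sqrt (mu / lam) * g)))) \<and>
         (0 < measure (limit_steady_state lam mu b g) {b..}) \<and>
         (measure (limit_steady_state lam mu b g) {b..} < 1) \<and>
         ((\<lambda>r. sqrt (real r) * (\<integral>w. w \<partial>swapping_network.waiting_time p lam mu b g r i))
           \<longlonglongrightarrow> alpha3 lam mu b g / sqrt (lam * mu) *
             (sqrt (mu / lam) * std_normal_density (sqrt (mu / lam) * g)
                * inverse (std_normal_cdf (- sqrt (mu / lam) * g)) - mu / lam * g)) \<and>
         ((\<lambda>r. swapping_network.charger_utilization p lam mu b g r i) \<longlonglongrightarrow> 1) \<and>
         ((\<lambda>r. swapping_network.battery_utilization p lam mu b g r i) \<longlonglongrightarrow> 1)"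
proof -
  interpret swapping_network p lam mu b g by (rule assms)
  have asp: "sqrt (mu / lam) * g = aspect" "- sqrt (mu / lam) * g = - aspect" by (simp_all add: aspect_def)
  have m: "measure steady_law {b..} = mass3 / total_mass" by (rule measure_steady_law_upper)
  have pos: "0 < mass3 / total_mass" "mass3 / total_mass < 1"
    using mass1_pos mass2_nonneg mass3_pos total_mass_pos by (simp_all add: total_mass_def)
  have lim: "(moment3 / total_mass) / sqrt (lam * mu) = alpha3 lam mu b g / sqrt (lam * mu) *
      (sqrt (mu / lam) * std_normal_density aspect * inverse (std_normal_cdf (- aspect)) - mu / lam * g)"
    unfolding mass_ratios(3) alpha3_eq[symmetric] by simp
  show ?thesis
    unfolding limit_steady_state_eq asp
    using waiting_probability_tendsto[of i] waiting_mean_tendsto[of i, unfolded lim] charger_utilization_tendsto[of i]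
      battery_utilization_tendsto[of i] pos waiting_probability_formula
    unfolding m by blast
qed

end
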